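(* Let $1\le g\le r$, let $\Gamma=(\gamma_1,\dots,\gamma_r)$ be a tuple of symmetric noncommutative polynomials in $x_1,\dots,x_g$ with $\gamma_j=x_j$ for $1\le j\le g$, and let $\delta=\max_j\deg\gamma_j$. If $p$ is an Archimedean symmetric matrix-valued noncommutative polynomial in $x_1,\dots,x_g$, then (a) for every $n\in\mathbb N$, $$\bigcap_{d\ge\delta}\hat{\mathfrak L}{}_p^\Gamma(n,d)=\hat{\mathfrak L}{}_p^\Gamma(n)=\Gamma\text{-}\mathrm{conv}(\mathcal D_p^\infty)(n);$$ (b) for every $d\ge\delta$ there is a $\Gamma$-pencil $L_d^\Gamma$ (in the variables $x$ and finitely many auxiliary variables $y$) such that $\hat{\mathfrak L}{}_p^\Gamma(\cdot,d)=(\hat{\mathfrak L}{}_p^\Gamma(n,d))_n$ is the projection $\operatorname{proj}_x$ of the positivity domain of $L^\Gamma_d$. Hence, the free $\Gamma$-spectrahedrops $\hat{\mathfrak L}{}_p^\Gamma(\cdot,d)$ give increasingly finer outer approximations of the $\Gamma$-convex hull of $\mathcal D_p^\infty$.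
   Context: Polynomials. $\langle x\rangle$ is the set of words in noncommuting variables $x_1,\dots,x_g$ (empty word $\emptyset$, length $|\alpha|$), with involution reversing words, $x_j^*=x_j$; $\mathbb C\langle x\rangle$ is the free algebra with the induced conjugate-linear involution, and $q$ is symmetric if $q^*=q$. $\Gamma(X)=(\gamma_1(X),\dots,\gamma_r(X))$. A $\mu\times\mu$ matrix-valued polynomial is $p=\sum_\alpha p_\alpha\alpha$ (finite sum, $p_\alpha\in M_\mu(\mathbb C)$), symmetric if $p_{\alpha^*}=p_\alpha^*$, with $p(X)=\sum_\alpha p_\alpha\otimes\alpha(X)$. $p$ is Archimedean if for some $k>0$ there are finitely many matrix-valued polynomials $s_j,t_j$ (columns; $t_j$ of size $\mu\times1$) with $k^2-\sum_{i=1}^gx_i^2=\sum_js_j^*s_j+\sum_jt_j^*p\,t_j$. $\mathcal D_p^\infty$ is the graded set of all $g$-tuples $X$ of bounded self-adjoint operators on a finite-dimensional or separable infinite-dimensional Hilbert space with $p(X)\succeq0$. A $g$-tuple $X$ of self-adjoint $n\times n$ matrices lies in $\Gamma\text{-}\mathrm{conv}(\mathcal D_p^\infty)(n)$ iff there are $Y\in\mathcal D_p^\infty$, acting on $\mathcal H$, and an isometry $V:\mathbb C^n\to\mathcal H$ with $X=V^*YV$ and $V^*\Gamma(Y)V=\Gamma(V^*YV)$. Moments. Write $\gamma_j=\sum_k\gamma_{j,k}m_{j,k}$ with $\gamma_{j,k}\in\mathbb C$ and words $m_{j,k}$. Consider families $Y=(Y_\alpha)$ in $M_n(\mathbb C)$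 satisfying (M): $Y_\emptyset=I$, $Y_{\alpha^*}=Y_\alpha^*$, and $\sum_k\gamma_{j,k}Y_{m_{j,k}}=\gamma_j(Y_{x_1},\dots,Y_{x_g})$ for $1\le j\le r$. Set $H(Y)=(Y_{\alpha^*\beta})_{\alpha,\beta}$, $H_d(Y)=(Y_{\alpha^*\beta})_{|\alpha|,|\beta|\le d}$, $H_p^{\Uparrow}(Y)_{\alpha,\beta}=\sum_\gamma p_\gamma\otimes Y_{\alpha^*\gamma\beta}$, and $H_{p,d}^{\Uparrow}(Y)=(H_p^{\Uparrow}(Y)_{\alpha,\beta})_{|\alpha|,|\beta|\le d}$. Then: - $\mathfrak L_p^\Gamma(n)$ is the set of families $(Y_\alpha)_{\alpha\in\langle x\rangle}$ in $M_n(\mathbb C)$ satisfying (M), $H(Y)\succeq0$ and $H_p^{\Uparrow}(Y)\succeq0$ (tested on finitely supported vectors); - for $d\ge\delta$, $\mathfrak L_p^\Gamma(n,d)$ is the set of families $(Y_\alpha)_{|\alpha|\le2d+\deg p+1}$ in $M_n(\mathbb C)$ satisfying (M), $H_{d+\lceil\frac12\deg p\rceil}(Y)\succeq0$ and $H_{p,d}^{\Uparrow}(Y)\succeq0$. With $\hat Y=(Y_{x_1},\dots,Y_{x_g})$, put $\hat{\mathfrak L}{}_p^\Gamma(n)=\{\hat Y:Y\in\mathfrak L_p^\Gamma(n)\}$ and $\hat{\mathfrak L}{}_p^\Gamma(n,d)=\{\hat Y:Y\in\mathfrak L_p^\Gamma(n,d)\}$. Pencils. A $\Gamma$-pencil with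 auxiliary symmetric variables $y_1,\dots,y_h$ is $L^\Gamma(x,y)=A_0+\sum_{j=1}^rA_j\gamma_j(x)+\sum_{k=1}^hB_ky_k$ with self-adjoint matrices $A_j,B_k$ of a common finite size. Its projected positivity domain (a free $\Gamma$-spectrahedrop) is $\operatorname{proj}_x=(\{X\in\mathbb S_n^g:\exists\,Y\in\mathbb S_n^h,\ A_0\otimes I+\sum_jA_j\otimes\gamma_j(X)+\sum_kB_k\otimes Y_k\succeq0\})_{n\in\mathbb N}$, where $\mathbb S_n$ denotes self-adjoint $n\times n$ matrices. *)

theory Defs
  imports
    "HOL-Analysis.Abstract_Metric_Spaces"
    "Jordan_Normal_Form.VS_Connect"
    "Jordan_Normal_Form.Schur_Decomposition"
begin

text \<open>
  Indices start at 0: the variables are \<open>x_0, \<dots>, x_(g-1)\<close>.  Throughout, \<open>0 \<le> z\<close> for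
  complex \<open>z\<close> is the order of \<open>HOL-Library.Complex_Order\<close>, i.e. \<open>z\<close> is real and nonnegative.
\<close>

section \<open>Matrices\<close>

definition msum :: "nat \<Rightarrow> nat \<Rightarrow> ('i \<Rightarrow> complex mat) \<Rightarrow> 'i set \<Rightarrow> complex mat" where
  "msum m n f S = mat m n (\<lambda>ij. \<Sum>s\<in>S. f s $$ ij)"

definition kron :: "complex mat \<Rightarrow> complex mat \<Rightarrow> complex mat" where
  "kron A B = mat (dim_row A * dim_row B) (dim_col A * dim_col B)
     (\<lambda>(i, j). A $$ (i div dim_row B, j div dim_col B) * B $$ (i mod dim_row B, j mod dim_col B))"

definition sa_mats :: "nat \<Rightarrow> complex mat set" where
  "sa_mats n = {A \<in> carrier_mat n n. mat_adjoint A = A}"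

definition sa_tuples :: "nat \<Rightarrow> nat \<Rightarrow> complex mat list set" where
  "sa_tuples g n = {X. length X = g \<and> set X \<subseteq> sa_mats n}"

definition psd :: "nat \<Rightarrow> complex mat \<Rightarrow> bool" where
  "psd n A \<longleftrightarrow> A \<in> carrier_mat n n \<and> (\<forall>v\<in>carrier_vec n. 0 \<le> (A *\<^sub>v v) \<bullet>c v)"

text \<open>
  Positivity of a block matrix with \<open>N \<times> N\<close> blocks \<open>K \<alpha> \<beta>\<close>, \<open>\<alpha>, \<beta> \<in> I\<close>, tested on finitely
  supported vectors; for finite \<open>I\<close> this is the usual positive semidefiniteness.
\<close>
definition block_psd :: "'i set \<Rightarrow> nat \<Rightarrow> ('i \<Rightarrow> 'i \<Rightarrow> complex mat) \<Rightarrow> bool" where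
  "block_psd I N K \<longleftrightarrow>
     (\<forall>F v. finite F \<and> F \<subseteq> I \<and> (\<forall>\<alpha>\<in>F. v \<alpha> \<in> carrier_vec N) \<longrightarrow>
        0 \<le> (\<Sum>\<alpha>\<in>F. \<Sum>\<beta>\<in>F. (K \<alpha> \<beta> *\<^sub>v v \<beta>) \<bullet>c v \<alpha>))"


section \<open>Noncommutative polynomials\<close>

type_synonym ncword = "nat list"

definition words :: "nat \<Rightarrow> ncword set" where
  "words g = lists {..<g}"

definition words_upto :: "nat \<Rightarrow> nat \<Rightarrow> ncword set" where
  "words_upto g d = {\<alpha> \<in> words g. length \<alpha> \<le> d}"

text \<open>A polynomial is its coefficient function; the involution on words is \<^const>\<open>rev\<close>.\<close>

type_synonym ncpoly = "ncword \<Rightarrow> complex"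

definition supp :: "ncpoly \<Rightarrow> ncword set" where
  "supp q = {w. q w \<noteq> 0}"

definition is_ncpoly :: "nat \<Rightarrow> ncpoly \<Rightarrow> bool" where
  "is_ncpoly g q \<longleftrightarrow> finite (supp q) \<and> supp q \<subseteq> words g"

definition symmetric_ncpoly :: "ncpoly \<Rightarrow> bool" where
  "symmetric_ncpoly q \<longleftrightarrow> (\<forall>w. q (rev w) = cnj (q w))"

definition ncvar :: "nat \<Rightarrow> ncpoly" where
  "ncvar j = (\<lambda>w. if w = [j] then 1 else 0)"

definition ncdeg :: "ncpoly \<Rightarrow> nat" where
  "ncdeg q = Max (insert 0 (length ` supp q))"

definition word_mat :: "nat \<Rightarrow> complex mat list \<Rightarrow> ncword \<Rightarrow> complex mat" where
  "word_mat n X w = foldr (\<lambda>i M. X ! i * M) w (1\<^sub>m n)"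

definition eval_mat :: "nat \<Rightarrow> complex mat list \<Rightarrow> ncpoly \<Rightarrow> complex mat" where
  "eval_mat n X q = msum n n (\<lambda>w. q w \<cdot>\<^sub>m word_mat n X w) (supp q)"

type_synonym ncmpoly = "ncword \<Rightarrow> complex mat"

definition msupp :: "nat \<Rightarrow> nat \<Rightarrow> ncmpoly \<Rightarrow> ncword set" where
  "msupp m n p = {w. p w \<noteq> 0\<^sub>m m n}"

definition is_ncmpoly :: "nat \<Rightarrow> nat \<Rightarrow> nat \<Rightarrow> ncmpoly \<Rightarrow> bool" where
  "is_ncmpoly g m n p \<longleftrightarrow>
     (\<forall>w. p w \<in> carrier_mat m n) \<and> finite (msupp m n p) \<and> msupp m n p \<subseteq> words g"

definition symmetric_ncmpoly :: "ncmpoly \<Rightarrow> bool" where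
  "symmetric_ncmpoly p \<longleftrightarrow> (\<forall>w. p (rev w) = mat_adjoint (p w))"

definition ncmdeg :: "nat \<Rightarrow> ncmpoly \<Rightarrow> nat" where
  "ncmdeg \<mu> p = Max (insert 0 (length ` msupp \<mu> \<mu> p))"

definition ncm_star :: "ncmpoly \<Rightarrow> ncmpoly" where
  "ncm_star p = (\<lambda>w. mat_adjoint (p (rev w)))"

text \<open>The coefficient of the product at \<open>w\<close> sums over all factorizations of \<open>w\<close>.\<close>
definition ncm_mult :: "nat \<Rightarrow> nat \<Rightarrow> ncmpoly \<Rightarrow> ncmpoly \<Rightarrow> ncmpoly" where
  "ncm_mult m n p q = (\<lambda>w. msum m n (\<lambda>k. p (take k w) * q (drop k w)) {..length w})"

definition ball_poly :: "nat \<Rightarrow> real \<Rightarrow> ncpoly" where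
  "ball_poly g k = (\<lambda>w. complex_of_real (k\<^sup>2) * of_bool (w = []) - (\<Sum>i<g. of_bool (w = [i, i])))"

text \<open>
  The columns \<open>s\<close> may have any height \<open>\<nu>\<close>, recorded in the list \<open>S\<close>; the identity of scalar
  polynomials is compared coefficientwise.
\<close>
definition archimedean :: "nat \<Rightarrow> nat \<Rightarrow> ncmpoly \<Rightarrow> bool" where
  "archimedean g \<mu> p \<longleftrightarrow>
     (\<exists>k > 0. \<exists>(S :: (nat \<times> ncmpoly) list) (T :: ncmpoly list).
        (\<forall>(\<nu>, s) \<in> set S. is_ncmpoly g \<nu> 1 s) \<and>
        (\<forall>t \<in> set T. is_ncmpoly g \<mu> 1 t) \<and>
        (\<forall>w. ball_poly g k w =
           (\<Sum>(\<nu>, s)\<leftarrow>S. ncm_mult 1 1 (ncm_star s) s w $$ (0, 0)) +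
           (\<Sum>t\<leftarrow>T. ncm_mult 1 1 (ncm_star t) (ncm_mult \<mu> 1 p t) w $$ (0, 0))))"


section \<open>Hilbert spaces and operators\<close>

text \<open>
  The record extends the modules of \<open>HOL-Algebra\<close>, whose fields \<open>mult\<close> and \<open>one\<close> play no role.
  The inner product is linear in its first argument, as \<open>v \<bullet>c w\<close> is.
\<close>
record 'h hilb = "(complex, 'h) module" +
  ip :: "'h \<Rightarrow> 'h \<Rightarrow> complex"

definition hnorm :: "('h, 'z) hilb_scheme \<Rightarrow> 'h \<Rightarrow> real" where
  "hnorm H x = sqrt (Re (ip H x x))"

text \<open>The value off the carrier makes \<^locale>\<open>Metric_space\<close> applicable, which
  demands nonnegativity and symmetry there too.\<close>
definition hdist :: "('h, 'z) hilb_scheme \<Rightarrow> 'h \<Rightarrow> 'h \<Rightarrow> real" where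
  "hdist H x y =
     (if x \<in> carrier H \<and> y \<in> carrier H then hnorm H (x \<ominus>\<^bsub>H\<^esub> y) else 0)"

locale hilbert_space = vectorspace "class_ring :: complex ring" H
  for H :: "('h, 'z) hilb_scheme" (structure) +
  assumes ip_add: "\<lbrakk>x \<in> carrier H; y \<in> carrier H; z \<in> carrier H\<rbrakk>
      \<Longrightarrow> ip H (x \<oplus> y) z = ip H x z + ip H y z"
    and ip_smult: "\<lbrakk>x \<in> carrier H; z \<in> carrier H\<rbrakk> \<Longrightarrow> ip H (c \<odot> x) z = c * ip H x z"
    and ip_cnj: "\<lbrakk>x \<in> carrier H; y \<in> carrier H\<rbrakk> \<Longrightarrow> ip H y x = cnj (ip H x y)"
    and ip_nonneg: "x \<in> carrier H \<Longrightarrow> 0 \<le> ip H x x"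
    and ip_definite: "\<lbrakk>x \<in> carrier H; ip H x x = 0\<rbrakk> \<Longrightarrow> x = \<zero>"
    and complete: "Metric_space.mcomplete (carrier H) (hdist H)"

text \<open>Separable Hilbert spaces are exactly the finite-dimensional and the separable
  infinite-dimensional ones; the zero space is included.\<close>
definition separable_hilbert_space :: "('h, 'z) hilb_scheme \<Rightarrow> bool" where
  "separable_hilbert_space H \<longleftrightarrow>
     hilbert_space H \<and> separable_space (Metric_space.mtopology (carrier H) (hdist H))"

definition bounded_sa_ops :: "('h, 'z) hilb_scheme \<Rightarrow> ('h \<Rightarrow> 'h) set" where
  "bounded_sa_ops H =
     {T \<in> module_hom (class_ring :: complex ring) H H.
        (\<exists>C. \<forall>x\<in>carrier H. hnorm H (T x) \<le> C * hnorm H x) \<and>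
        (\<forall>x\<in>carrier H. \<forall>y\<in>carrier H. ip H (T x) y = ip H x (T y))}"

definition word_op :: "('h \<Rightarrow> 'h) list \<Rightarrow> ncword \<Rightarrow> 'h \<Rightarrow> 'h" where
  "word_op Y w = foldr (\<lambda>i T. Y ! i \<circ> T) w id"

definition eval_op :: "('h, 'z) hilb_scheme \<Rightarrow> ('h \<Rightarrow> 'h) list \<Rightarrow> ncpoly \<Rightarrow> 'h \<Rightarrow> 'h" where
  "eval_op H Y q x = finsum H (\<lambda>w. q w \<odot>\<^bsub>H\<^esub> word_op Y w x) (supp q)"

text \<open>
  Under the identification of the tensor product of \<open>\<complex>^\<mu>\<close> and \<open>H\<close> with \<open>H^\<mu>\<close>, the operator
  \<open>p(Y)\<close> is the \<open>\<mu> \<times> \<mu>\<close> operator matrix whose \<open>(a, b)\<close> entry evaluates the scalar polynomial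
  \<open>\<lambda>w. p w $$ (a, b)\<close>.
\<close>
definition eval_mop ::
  "('h, 'z) hilb_scheme \<Rightarrow> nat \<Rightarrow> ('h \<Rightarrow> 'h) list \<Rightarrow> ncmpoly \<Rightarrow> (nat \<Rightarrow> 'h) \<Rightarrow> nat \<Rightarrow> 'h" where
  "eval_mop H \<mu> Y p \<xi> a = finsum H (\<lambda>b. eval_op H Y (\<lambda>w. p w $$ (a, b)) (\<xi> b)) {..<\<mu>}"

text \<open>The tuples in the operator positivity domain of \<open>p\<close> that act on \<open>H\<close>.\<close>
definition pos_dom ::
  "nat \<Rightarrow> nat \<Rightarrow> ncmpoly \<Rightarrow> ('h, 'z) hilb_scheme \<Rightarrow> ('h \<Rightarrow> 'h) list set" where
  "pos_dom g \<mu> p H =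
     {Y. length Y = g \<and> set Y \<subseteq> bounded_sa_ops H \<and>
         (\<forall>\<xi> \<in> {..<\<mu>} \<rightarrow> carrier H. 0 \<le> (\<Sum>a<\<mu>. ip H (eval_mop H \<mu> Y p \<xi> a) (\<xi> a)))}"

definition isometry :: "nat \<Rightarrow> ('h, 'z) hilb_scheme \<Rightarrow> (complex vec \<Rightarrow> 'h) \<Rightarrow> bool" where
  "isometry n H V \<longleftrightarrow>
     V \<in> module_hom (class_ring :: complex ring) (module_vec TYPE(complex) n) H \<and>
     (\<forall>u\<in>carrier_vec n. \<forall>v\<in>carrier_vec n. ip H (V u) (V v) = u \<bullet>c v)"

text \<open>The matrix of \<open>V\<^sup>* T V\<close>.\<close>
definition compress ::
  "('h, 'z) hilb_scheme \<Rightarrow> nat \<Rightarrow> (complex vec \<Rightarrow> 'h) \<Rightarrow> ('h \<Rightarrow> 'h) \<Rightarrow> complex mat" where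
  "compress H n V T = mat n n (\<lambda>(i, j). ip H (T (V (unit_vec n j))) (V (unit_vec n i)))"

text \<open>
  The Hilbert space ranges over all separable ones with underlying set in the type
  \<open>nat \<Rightarrow> complex\<close>, with arbitrary vector space structure and inner product.  A separable Hilbert
  space has at most continuum many points, so every one of them has an isomorphic copy of this kind.
\<close>
definition Gamma_conv ::
  "nat \<Rightarrow> ncpoly list \<Rightarrow> nat \<Rightarrow> ncmpoly \<Rightarrow> nat \<Rightarrow> complex mat list set" where
  "Gamma_conv g \<Gamma> \<mu> p n =
     {X \<in> sa_tuples g n.
        \<exists>(H :: (nat \<Rightarrow> complex) hilb) Y V.
          separable_hilbert_space H \<and> Y \<in> pos_dom g \<mu> p H \<and> isometry n H V \<and>
          X = map (compress H n V) Y \<and>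
          (\<forall>\<gamma>\<in>set \<Gamma>. compress H n V (eval_op H Y \<gamma>) = eval_mat n (map (compress H n V) Y) \<gamma>)}"


section \<open>Moment sequences\<close>

definition hat :: "nat \<Rightarrow> ncmpoly \<Rightarrow> complex mat list" where
  "hat g Y = map (\<lambda>i. Y [i]) [0..<g]"

text \<open>Condition (M) for a family indexed by the set of words \<open>I\<close>.\<close>
definition moment_families ::
  "nat \<Rightarrow> ncpoly list \<Rightarrow> nat \<Rightarrow> ncword set \<Rightarrow> (ncword \<Rightarrow> complex mat) set" where
  "moment_families g \<Gamma> n I =
     {Y \<in> I \<rightarrow>\<^sub>E carrier_mat n n.
        Y [] = 1\<^sub>m n \<and> (\<forall>\<alpha>\<in>I. Y (rev \<alpha>) = mat_adjoint (Y \<alpha>)) \<and>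
        (\<forall>\<gamma>\<in>set \<Gamma>. msum n n (\<lambda>m. \<gamma> m \<cdot>\<^sub>m Y m) (supp \<gamma>) = eval_mat n (hat g Y) \<gamma>)}"

definition hankel :: "(ncword \<Rightarrow> complex mat) \<Rightarrow> ncword \<Rightarrow> ncword \<Rightarrow> complex mat" where
  "hankel Y \<alpha> \<beta> = Y (rev \<alpha> @ \<beta>)"

definition loc_hankel ::
  "nat \<Rightarrow> ncmpoly \<Rightarrow> nat \<Rightarrow> (ncword \<Rightarrow> complex mat) \<Rightarrow> ncword \<Rightarrow> ncword \<Rightarrow> complex mat" where
  "loc_hankel \<mu> p n Y \<alpha> \<beta> =
     msum (\<mu> * n) (\<mu> * n) (\<lambda>w. kron (p w) (Y (rev \<alpha> @ w @ \<beta>))) (msupp \<mu> \<mu> p)"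

definition L_inf ::
  "nat \<Rightarrow> ncpoly list \<Rightarrow> nat \<Rightarrow> ncmpoly \<Rightarrow> nat \<Rightarrow> (ncword \<Rightarrow> complex mat) set" where
  "L_inf g \<Gamma> \<mu> p n =
     {Y \<in> moment_families g \<Gamma> n (words g).
        block_psd (words g) n (hankel Y) \<and> block_psd (words g) (\<mu> * n) (loc_hankel \<mu> p n Y)}"

definition L_fin ::
  "nat \<Rightarrow> ncpoly list \<Rightarrow> nat \<Rightarrow> ncmpoly \<Rightarrow> nat \<Rightarrow> nat \<Rightarrow> (ncword \<Rightarrow> complex mat) set" where
  "L_fin g \<Gamma> \<mu> p n d =
     {Y \<in> moment_families g \<Gamma> n (words_upto g (2 * d + ncmdeg \<mu> p + 1)).
        block_psd (words_upto g (d + nat \<lceil>real (ncmdeg \<mu> p) / 2\<rceil>)) n (hankel Y) \<and>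
        block_psd (words_upto g d) (\<mu> * n) (loc_hankel \<mu> p n Y)}"

definition L_inf_hat ::
  "nat \<Rightarrow> ncpoly list \<Rightarrow> nat \<Rightarrow> ncmpoly \<Rightarrow> nat \<Rightarrow> complex mat list set" where
  "L_inf_hat g \<Gamma> \<mu> p n = hat g ` L_inf g \<Gamma> \<mu> p n"

definition L_fin_hat ::
  "nat \<Rightarrow> ncpoly list \<Rightarrow> nat \<Rightarrow> ncmpoly \<Rightarrow> nat \<Rightarrow> nat \<Rightarrow> complex mat list set" where
  "L_fin_hat g \<Gamma> \<mu> p n d = hat g ` L_fin g \<Gamma> \<mu> p n d"


section \<open>Pencils\<close>

text \<open>The coefficients \<open>A_0\<close>, \<open>A_1, \<dots>, A_r\<close> and \<open>B_1, \<dots>, B_h\<close>, of common size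
  \<open>pen_size\<close>.\<close>
record pencil =
  pen_size :: nat
  pen_const :: "complex mat"
  pen_gam :: "complex mat list"
  pen_aux :: "complex mat list"

definition is_Gamma_pencil :: "ncpoly list \<Rightarrow> pencil \<Rightarrow> bool" where
  "is_Gamma_pencil \<Gamma> L \<longleftrightarrow>
     length (pen_gam L) = length \<Gamma> \<and>
     insert (pen_const L) (set (pen_gam L) \<union> set (pen_aux L)) \<subseteq> sa_mats (pen_size L)"

definition pencil_eval ::
  "ncpoly list \<Rightarrow> pencil \<Rightarrow> nat \<Rightarrow> complex mat list \<Rightarrow> complex mat list \<Rightarrow> complex mat" where
  "pencil_eval \<Gamma> L n X Y =
     (let N = pen_size L * n in
       kron (pen_const L) (1\<^sub>m n)
       + msum N N (\<lambda>j. kron (pen_gam L ! j) (eval_mat n X (\<Gamma> ! j))) {..<length \<Gamma>}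
       + msum N N (\<lambda>k. kron (pen_aux L ! k) (Y ! k)) {..<length (pen_aux L)})"

definition proj_x :: "nat \<Rightarrow> ncpoly list \<Rightarrow> pencil \<Rightarrow> nat \<Rightarrow> complex mat list set" where
  "proj_x g \<Gamma> L n =
     {X \<in> sa_tuples g n.
        \<exists>Y \<in> sa_tuples (length (pen_aux L)) n. psd (pen_size L * n) (pencil_eval \<Gamma> L n X Y)}"

end

theory Submission
  imports Defs "HOL-Library.Diagonal_Subsequence"
begin

text \<open>
  Truncations give one inclusion at each level.  Conversely, conjugating the Archimedean identity by
  a word bounds the entries \<open>Y\<^sub>w\<close> of a solution at level \<open>d\<close> by \<open>k\<close> to the power \<open>|w|\<close>
  as soon as \<open>d\<close> exceeds \<open>|w|\<close> by a fixed amount, so a diagonal subsequence of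
  solutions with a common degree-one part converges to a full moment sequence.

  A moment sequence of an operator tuple compressed by an isometry is positive because its Hankel
  matrix is a Gram matrix.  For the converse, the Hankel matrix of a full moment sequence is factored
  by Cholesky's algorithm, which realizes its Hilbert space concretely as a space of square summable
  sequences; left multiplication by the variables is symmetric there, bounded by the Archimedean
  identity, and positivity of the localizing matrix is positivity of \<open>p\<close> at these operators on a
  dense subspace.

  At a fixed level, the moments are expressed by their real and imaginary parts, which are the
  auxiliary variables of the pencil, and each equation becomes a pair of opposite inequalities.
\<close>

section \<open>Positive kernels\<close>

text \<open>\<open>Gamma_conv\<close> only admits Hilbert spaces whose points are functions from
  \<open>nat\<close> to \<open>complex\<close>, so a quotient followed by a completion would produce
  points of the wrong type. A triangular factorization avoids both: its rows already are sequences,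
  vectors of norm zero become zero rows, and discarding the coordinates with zero pivot makes every
  remaining unit vector a finite combination of rows. The Archimedean identity controls the sum of
  all squares \<open>x_i^2\<close> at once; a single variable is bounded because the other squares
  contribute nonnegative terms. At a finite level the identity applies only to words that stay in
  range after multiplication by the weights, which costs a fixed number of letters. The nonlinear
  side of (M) is evaluated at the degree-one part alone. In the limit argument this part is
  constant, so (M) is a fixed linear equation; in the pencil it is exactly the term that a pencil in
  \<Gamma> may contain, and all other unknowns occur affinely. Matrix positivity is restated
  throughout for scalar kernels, where every change of index set is an instance of
  \<open>pos_on_pullback\<close>.\<close>

text \<open>The order on complex numbers forces the value of the form to be real, so Hermitian
  symmetry is a consequence (\<open>pos_on_hermitian\<close>) and is not built in.\<close>

definition pos_on :: "'i set \<Rightarrow> ('i \<Rightarrow> 'i \<Rightarrow> complex) \<Rightarrow> bool" where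
  "pos_on I M \<longleftrightarrow>
     (\<forall>F v. finite F \<and> F \<subseteq> I \<longrightarrow> 0 \<le> (\<Sum>s\<in>F. \<Sum>t\<in>F. M s t * v t * cnj (v s)))"

lemma pos_onD:
  "pos_on I M \<Longrightarrow> finite F \<Longrightarrow> F \<subseteq> I \<Longrightarrow> 0 \<le> (\<Sum>s\<in>F. \<Sum>t\<in>F. M s t * v t * cnj (v s))"
  unfolding pos_on_def by blast

lemma pos_on_subset: "pos_on I M \<Longrightarrow> J \<subseteq> I \<Longrightarrow> pos_on J M"
  unfolding pos_on_def by (meson subset_trans)

lemma pos_on_cong:
  assumes "\<And>s t. s \<in> I \<Longrightarrow> t \<in> I \<Longrightarrow> M s t = M' s t"
  shows "pos_on I M = pos_on I M'"
proof -
  have "(\<Sum>s\<in>F. \<Sum>t\<in>F. M s t * v t * cnj (v s)) = (\<Sum>s\<in>F. \<Sum>t\<in>F. M' s t * v t * cnj (v s))"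
    if "F \<subseteq> I" for F v
    using that assms by (intro sum.cong refl) (simp add: subset_iff)
  then show ?thesis by (auto simp: pos_on_def)
qed

text \<open>The test vector is pushed forward along \<open>f\<close>, adding the coefficients on
  each fibre. Since \<open>f\<close> may identify indices, this also covers repeated test vectors,
  as in \<open>pos_on_pair\<close>, and pairs of words whose concatenations coincide.\<close>

lemma pos_on_pullback:
  assumes "pos_on I M" "f ` T \<subseteq> I"
  shows "pos_on T (\<lambda>s t. M (f s) (f t))"
  unfolding pos_on_def
proof (intro allI impI, elim conjE)
  fix F :: "'b set" and v :: "'b \<Rightarrow> complex"
  assume F: "finite F" "F \<subseteq> T"
  define w where "w y = (\<Sum>x\<in>{x\<in>F. f x = y}. v x)" for y
  have "(\<Sum>s\<in>f`F. \<Sum>t\<in>f`F. M s t * w t * cnj (w s))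
      = (\<Sum>s\<in>f`F. \<Sum>t\<in>f`F. \<Sum>y\<in>{x\<in>F. f x = t}. M s (f y) * v y * cnj (w s))"
    by (intro sum.cong refl, subst w_def) (auto simp: sum_distrib_left sum_distrib_right intro!: sum.cong)
  also have "\<dots> = (\<Sum>s\<in>f`F. \<Sum>y\<in>F. M s (f y) * v y * cnj (w s))"
    by (intro sum.cong refl sum.image_gen[symmetric] F)
  also have "\<dots> = (\<Sum>y\<in>F. \<Sum>s\<in>f`F. M s (f y) * v y * cnj (w s))"
    by (rule sum.swap)
  also have "\<dots> = (\<Sum>y\<in>F. \<Sum>s\<in>f`F. \<Sum>x\<in>{x\<in>F. f x = s}. M (f x) (f y) * v y * cnj (v x))"
    by (intro sum.cong refl) (simp add: w_def sum_distrib_left)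
  also have "\<dots> = (\<Sum>y\<in>F. \<Sum>x\<in>F. M (f x) (f y) * v y * cnj (v x))"
    by (intro sum.cong refl sum.image_gen[symmetric] F)
  also have "\<dots> = (\<Sum>s\<in>F. \<Sum>t\<in>F. M (f s) (f t) * v t * cnj (v s))"
    by (rule sum.swap)
  finally show "0 \<le> (\<Sum>s\<in>F. \<Sum>t\<in>F. M (f s) (f t) * v t * cnj (v s))"
    using pos_onD[OF assms(1), of "f ` F" w] F assms(2) by (metis finite_imageI image_mono subset_trans)
qed

text \<open>Moves a kernel to a full index type, the setting of the factorization; the added indices
  stand for zero vectors.\<close>

lemma pos_on_zero_extend:
  assumes "pos_on I M"
  shows "pos_on UNIV (\<lambda>s t. if s \<in> I \<and> t \<in> I then M s t else 0)"
  unfolding pos_on_def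
proof (intro allI impI, elim conjE)
  fix F :: "'a set" and v :: "'a \<Rightarrow> complex"
  assume F: "finite F"
  have "0 \<le> (\<Sum>s\<in>F \<inter> I. \<Sum>t\<in>F \<inter> I. M s t * v t * cnj (v s))"
    by (rule pos_onD[OF assms]) (use F in auto)
  also have "\<dots> = (\<Sum>s\<in>F \<inter> I. \<Sum>t\<in>F. (if s \<in> I \<and> t \<in> I then M s t else 0) * v t * cnj (v s))"
    by (intro sum.cong refl sum.mono_neutral_cong_left) (use F in auto)
  also have "\<dots> = (\<Sum>s\<in>F. \<Sum>t\<in>F. (if s \<in> I \<and> t \<in> I then M s t else 0) * v t * cnj (v s))"
    by (intro sum.mono_neutral_left) (use F in auto)
  finally show "0 \<le> (\<Sum>s\<in>F. \<Sum>t\<in>F. (if s \<in> I \<and> t \<in> I then M s t else 0) * v t * cnj (v s))" .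
qed

lemma pos_on_finite_iff:
  assumes "finite I"
  shows "pos_on I M \<longleftrightarrow> (\<forall>v. 0 \<le> (\<Sum>s\<in>I. \<Sum>t\<in>I. M s t * v t * cnj (v s)))"
proof
  show "pos_on I M \<Longrightarrow> \<forall>v. 0 \<le> (\<Sum>s\<in>I. \<Sum>t\<in>I. M s t * v t * cnj (v s))"
    using assms by (auto intro: pos_onD)
next
  assume *: "\<forall>v. 0 \<le> (\<Sum>s\<in>I. \<Sum>t\<in>I. M s t * v t * cnj (v s))"
  show "pos_on I M"
    unfolding pos_on_def
  proof (intro allI impI, elim conjE)
    fix F :: "'a set" and v :: "'a \<Rightarrow> complex"
    assume F: "finite F" "F \<subseteq> I"
    define w where "w s = (if s \<in> F then v s else 0)" for s
    have "(\<Sum>s\<in>F. \<Sum>t\<in>F. M s t * v t * cnj (v s)) = (\<Sum>s\<in>F. \<Sum>t\<in>I. M s t * w t * cnj (w s))"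
      by (intro sum.cong refl sum.mono_neutral_cong_left) (use F assms in \<open>auto simp: w_def\<close>)
    also have "\<dots> = (\<Sum>s\<in>I. \<Sum>t\<in>I. M s t * w t * cnj (w s))"
      by (intro sum.mono_neutral_left) (use F assms in \<open>auto simp: w_def\<close>)
    finally show "0 \<le> (\<Sum>s\<in>F. \<Sum>t\<in>F. M s t * v t * cnj (v s))" using * by simp
  qed
qed

lemma pos_on_diag:
  assumes "pos_on I M" "s \<in> I"
  shows "0 \<le> M s s"
  using pos_onD[OF assms(1), of "{s}" "\<lambda>_. 1"] assms(2) by simp

lemma pos_on_pair:
  assumes "pos_on I M" "s \<in> I" "t \<in> I"
  shows "0 \<le> M s s * x * cnj x + M s t * y * cnj x + M t s * x * cnj y + M t t * y * cnj y"
proof -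
  \<comment> \<open>Indexing by Booleans keeps the two slots apart even when
    \<open>s = t\<close>.\<close>
  have "pos_on UNIV (\<lambda>a b. M (if a then s else t) (if b then s else t))"
    by (rule pos_on_pullback[OF assms(1)]) (use assms in auto)
  from pos_onD[OF this, of "{True,False}" "\<lambda>a. if a then x else y"]
  show ?thesis by (simp add: algebra_simps)
qed

text \<open>Polarization: at the vectors (1, 1) and (1, i) the form has imaginary part zero, which
  yields the imaginary and the real part of the identity respectively.\<close>

lemma pos_on_hermitian:
  assumes "pos_on I M" "s \<in> I" "t \<in> I"
  shows "M t s = cnj (M s t)"
proof -
  have r: "Im (M s s) = 0" "Im (M t t) = 0"
    using pos_on_diag[OF assms(1)] assms(2,3) by (auto simp: less_eq_complex_def)
  have "Im (M s t) + Im (M t s) = 0"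
    using pos_on_pair[OF assms, of 1 1] r by (simp add: less_eq_complex_def)
  moreover have "Re (M s t) = Re (M t s)"
    using pos_on_pair[OF assms, of 1 \<i>] r by (simp add: less_eq_complex_def)
  ultimately show ?thesis by (simp add: complex_eq_iff)
qed

lemma pos_on_Cauchy_Schwarz:
  assumes "pos_on I M" "s \<in> I" "t \<in> I"
  shows "(cmod (M s t))\<^sup>2 \<le> Re (M s s) * Re (M t t)"
proof -
  define a where "a = Re (M s s)" define b where "b = M s t" define d where "d = Re (M t t)"
  have a: "M s s = of_real a" "a \<ge> 0" and d: "M t t = of_real d" "d \<ge> 0"
    using pos_on_diag[OF assms(1)] assms(2,3) by (auto simp: a_def d_def less_eq_complex_def complex_eq_iff)
  have h: "M t s = cnj b" using pos_on_hermitian[OF assms] by (simp add: b_def)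
  \<comment> \<open>The test vector \<open>(x b, y)\<close> with real \<open>x\<close> and
    \<open>y\<close> absorbs the phase of the off-diagonal entry and leaves a real quadratic
    form.\<close>
  have q: "0 \<le> a * x\<^sup>2 * (cmod b)\<^sup>2 + 2 * x * y * (cmod b)\<^sup>2 + d * y\<^sup>2" for x y :: real
  proof -
    have "0 \<le> M s s * (x * b) * cnj (x * b) + M s t * y * cnj (x * b)
       + M t s * (x * b) * cnj (of_real y) + M t t * y * cnj (of_real y)"
      by (rule pos_on_pair[OF assms])
    also have "\<dots> = of_real (a * x\<^sup>2 * (cmod b)\<^sup>2 + 2 * x * y * (cmod b)\<^sup>2 + d * y\<^sup>2)"
      unfolding a(1) d(1) h b_def[symmetric]
      by (simp add: algebra_simps power2_eq_square complex_norm_square[unfolded power2_eq_square, symmetric] flip: of_real_power of_real_mult)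
        (simp add: complex_eq_iff cmod_def algebra_simps power2_eq_square)
    finally show ?thesis by (simp add: less_eq_complex_def)
  qed
  show ?thesis
  proof (cases "d = 0")
    case True
    show ?thesis
    proof (cases "b = 0")
      case False
      then have "0 < (cmod b)\<^sup>2" by simp
      \<comment> \<open>With \<open>d = 0\<close> the form is affine in \<open>y\<close>, so a
        sufficiently negative \<open>y\<close> contradicts positivity unless \<open>b = 0\<close>;
        the choice \<open>-(a+1)\<close> gives \<open>a - 2 (a + 1) < 0\<close>.\<close>
      moreover have "0 \<le> (cmod b)\<^sup>2 * (a - 2 * (a + 1))"
        using q[of 1 "-(a+1)"] True by (simp add: algebra_simps)
      ultimately have False using a(2) by (smt (verit) mult_pos_neg)
      then show ?thesis ..
    qed (use True b_def in \<open>auto simp: d_def[symmetric]\<close>)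
  next
    case False
    then have "d > 0" using d by simp
    \<comment> \<open>For \<open>x = d\<close> the form is minimal at
      \<open>y = -|b|^2\<close>.\<close>
    have "0 \<le> d * (a * d - (cmod b)\<^sup>2) * (cmod b)\<^sup>2"
      using q[of d "- (cmod b)\<^sup>2"] by (simp add: algebra_simps power2_eq_square)
    then show ?thesis
      using \<open>d > 0\<close> a(2) by (cases "b = 0")
        (auto simp: zero_le_mult_iff a_def[symmetric] d_def[symmetric] b_def[symmetric])
  qed
qed

text \<open>Positivity is demanded only eventually on each finite set, because the kernels of a
  truncated problem are positive on index ranges that grow with the level.\<close>

lemma pos_on_limit:
  fixes M :: "'i \<Rightarrow> 'i \<Rightarrow> complex"
  assumes lim: "\<And>s t. s \<in> I \<Longrightarrow> t \<in> I \<Longrightarrow> (\<lambda>k. N k s t) \<longlonglongrightarrow> M s t"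
    and pos: "\<And>F. finite F \<Longrightarrow> F \<subseteq> I \<Longrightarrow> eventually (\<lambda>k. pos_on F (N k)) sequentially"
  shows "pos_on I M"
  unfolding pos_on_def
proof (intro allI impI, elim conjE)
  fix F :: "'i set" and v :: "'i \<Rightarrow> complex"
  assume F: "finite F" "F \<subseteq> I"
  let ?q = "\<lambda>M. (\<Sum>s\<in>F. \<Sum>t\<in>F. M s t * v t * cnj (v s))"
  have lq: "(\<lambda>k. ?q (N k)) \<longlonglongrightarrow> ?q M"
    by (intro tendsto_intros lim) (use F in auto)
  have ev: "eventually (\<lambda>k. 0 \<le> ?q (N k)) sequentially"
    using pos[OF F] by eventually_elim (rule pos_onD[OF _ F(1) order_refl])
  have "0 \<le> Re (?q M)"
    by (rule tendsto_lowerbound[OF tendsto_Re[OF lq]])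
      (use ev in \<open>auto elim!: eventually_mono simp: less_eq_complex_def\<close>)
  moreover have "Im (?q M) = 0"
  proof (rule LIMSEQ_unique[OF tendsto_Im[OF lq]])
    show "(\<lambda>k. Im (?q (N k))) \<longlonglongrightarrow> 0"
      by (rule tendsto_eventually) (use ev in \<open>auto elim!: eventually_mono simp: less_eq_complex_def\<close>)
  qed
  ultimately show "0 \<le> ?q M" by (simp add: less_eq_complex_def)
qed

lemma pos_on_Plus:
  assumes "finite A" "finite B"
    and "\<And>a b. a \<in> A \<Longrightarrow> b \<in> B \<Longrightarrow> M (Inl a) (Inr b) = 0"
    and "\<And>a b. a \<in> A \<Longrightarrow> b \<in> B \<Longrightarrow> M (Inr b) (Inl a) = 0"
  shows "pos_on (A <+> B) M \<longleftrightarrow>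
    pos_on A (\<lambda>s t. M (Inl s) (Inl t)) \<and> pos_on B (\<lambda>s t. M (Inr s) (Inr t))"
proof
  assume "pos_on (A <+> B) M"
  then show "pos_on A (\<lambda>s t. M (Inl s) (Inl t)) \<and> pos_on B (\<lambda>s t. M (Inr s) (Inr t))"
    by (auto intro!: pos_on_pullback[of "A <+> B" M])
next
  assume *: "pos_on A (\<lambda>s t. M (Inl s) (Inl t)) \<and> pos_on B (\<lambda>s t. M (Inr s) (Inr t))"
  show "pos_on (A <+> B) M"
    unfolding pos_on_finite_iff[OF finite_Plus[OF assms(1,2)]]
  proof
    fix v
    have "(\<Sum>s\<in>A <+> B. \<Sum>t\<in>A <+> B. M s t * v t * cnj (v s))
      = (\<Sum>s\<in>A. \<Sum>t\<in>A. M (Inl s) (Inl t) * v (Inl t) * cnj (v (Inl s)))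
      + (\<Sum>s\<in>B. \<Sum>t\<in>B. M (Inr s) (Inr t) * v (Inr t) * cnj (v (Inr s)))"
      using assms by (simp add: sum.Plus)
    also have "0 \<le> \<dots>"
      by (intro add_nonneg_nonneg pos_onD[OF conjunct1[OF *]] pos_onD[OF conjunct2[OF *]])
        (use assms in auto)
    finally show "0 \<le> (\<Sum>s\<in>A <+> B. \<Sum>t\<in>A <+> B. M s t * v t * cnj (v s))" .
  qed
qed

section \<open>Schur complements and triangular factorization\<close>

text \<open>Completing the square: the given vector is extended by the multiple of the
  \<open>k\<close>-th one that minimizes the form. For a zero pivot, division by zero gives 0 and
  the kernel is unchanged.\<close>

lemma pos_on_Schur_complement:
  assumes "pos_on UNIV K"
  shows "pos_on UNIV (\<lambda>s t. K s t - K s k * K k t / K k k)"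
proof (cases "K k k = 0")
  case True
  then show ?thesis using assms by simp
next
  case False
  note herm = pos_on_hermitian[OF assms UNIV_I UNIV_I]
  show ?thesis unfolding pos_on_def
  proof (intro allI impI, elim conjE)
    fix F :: "'a set" and v :: "'a \<Rightarrow> complex"
    assume F: "finite F"
    define b where "b = (\<Sum>t\<in>F. K k t * v t)"
    \<comment> \<open>\<open>None\<close> is an extra copy of \<open>k\<close>, so that
      \<open>k\<close> may also belong to \<open>F\<close>; its coefficient
      \<open>- b / K k k\<close> is the minimizer.\<close>
    define f where "f x = (case x of None \<Rightarrow> k | Some s \<Rightarrow> s)" for x
    define w where "w x = (case x of None \<Rightarrow> - b / K k k | Some s \<Rightarrow> v s)" for x
    have cb: "(\<Sum>s\<in>F. K s k * cnj (v s)) = cnj b"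
      unfolding b_def cnj_sum by (intro sum.cong refl) (simp add: herm[of k])
    have ck: "cnj (K k k) = K k k" by (metis herm)
    have "pos_on UNIV (\<lambda>x y. K (f x) (f y))" by (rule pos_on_pullback[OF assms]) auto
    then have "0 \<le> (\<Sum>x\<in>insert None (Some ` F). \<Sum>y\<in>insert None (Some ` F). K (f x) (f y) * w y * cnj (w x))"
      by (rule pos_onD) (use F in auto)
    also have "\<dots> = K k k * (- b / K k k) * cnj (- b / K k k)
       + (\<Sum>t\<in>F. K k t * v t * cnj (- b / K k k)) + (\<Sum>s\<in>F. K s k * (- b / K k k) * cnj (v s))
       + (\<Sum>s\<in>F. \<Sum>t\<in>F. K s t * v t * cnj (v s))"
      using F by (simp add: sum.reindex f_def w_def sum.distrib sum_subtractf sum_negf)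
    also have "(\<Sum>t\<in>F. K k t * v t * cnj (- b / K k k)) = b * cnj (- b / K k k)"
      by (subst (2) b_def) (simp only: sum_distrib_right)
    also have "(\<Sum>s\<in>F. K s k * (- b / K k k) * cnj (v s)) = (- b / K k k) * cnj b"
      unfolding cb[symmetric] sum_distrib_left by (intro sum.cong refl) simp
    also have "K k k * (- b / K k k) * cnj (- b / K k k) + b * cnj (- b / K k k) + (- b / K k k) * cnj b
         + (\<Sum>s\<in>F. \<Sum>t\<in>F. K s t * v t * cnj (v s))
       = (\<Sum>s\<in>F. \<Sum>t\<in>F. K s t * v t * cnj (v s)) - cnj b * b / K k k"
      using False by (simp add: ck)
    also have "cnj b * b / K k k = (\<Sum>s\<in>F. \<Sum>t\<in>F. K s k * K k t / K k k * v t * cnj (v s))"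
      unfolding cb[symmetric] unfolding b_def sum_product sum_divide_distrib
      by (intro sum.cong refl) (simp add: mult_ac)
    finally show "0 \<le> (\<Sum>s\<in>F. \<Sum>t\<in>F. (K s t - K s k * K k t / K k k) * v t * cnj (v s))"
      by (simp add: sum_subtractf left_diff_distrib)
  qed
qed

text \<open>Cholesky factorization: iterated Schur complements, dividing by a zero pivot being harmless
  since then the whole row vanishes.\<close>

definition schur_step :: "nat \<Rightarrow> (nat \<Rightarrow> nat \<Rightarrow> complex) \<Rightarrow> nat \<Rightarrow> nat \<Rightarrow> complex" where
  "schur_step k K s t = K s t - K s k * K k t / K k k"

primrec schur_iter :: "(nat \<Rightarrow> nat \<Rightarrow> complex) \<Rightarrow> nat \<Rightarrow> nat \<Rightarrow> nat \<Rightarrow> complex" where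
  "schur_iter K 0 = K"
| "schur_iter K (Suc k) = schur_step k (schur_iter K k)"

lemma pos_on_schur_iter: "pos_on UNIV K \<Longrightarrow> pos_on UNIV (schur_iter K k)"
  by (induction k) (simp_all add: pos_on_Schur_complement schur_step_def[abs_def])

text \<open>Step \<open>k\<close> clears row \<open>k\<close>, by subtraction if the pivot is
  nonzero and by Cauchy-Schwarz otherwise. A row cleared earlier stays zero, since both terms of
  \<open>schur_step\<close> contain a factor from it.\<close>

lemma schur_iter_row_zero:
  assumes "pos_on UNIV K" "l < k"
  shows "schur_iter K k l t = 0"
  using assms(2)
proof (induction k arbitrary: t)
  case (Suc k)
  let ?S = "schur_iter K k"
  note p = pos_on_schur_iter[OF assms(1), of k]
  show ?case
  proof (cases "l = k")
    case True
    have "?S k t = 0" if "?S k k = 0"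
      using pos_on_Cauchy_Schwarz[OF p, of k t] that by simp
    then show ?thesis using True by (simp add: schur_step_def)
  next
    case False
    then have "l < k" using Suc.prems by simp
    from Suc.IH[OF this] show ?thesis by (simp add: schur_step_def)
  qed
qed simp

lemma schur_iter_sum:
  "K s t = schur_iter K m s t + (\<Sum>l<m. schur_iter K l s l * schur_iter K l l t / schur_iter K l l l)"
  by (induction m) (simp_all add: schur_step_def)

text \<open>The rows of \<open>R\<close> are Gram vectors for \<open>K\<close>; the conjugate falls
  on the row of \<open>s\<close>, which matches an inner product linear in its first argument. That
  a column with zero pivot vanishes is what allows such coordinates to be dropped in
  \<open>triangular_span\<close>.\<close>

theorem Cholesky:
  assumes K: "pos_on UNIV K"
  obtains R :: "nat \<Rightarrow> nat \<Rightarrow> complex" where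
    "\<And>m k. m < k \<Longrightarrow> R m k = 0"
    "\<And>m k. R k k = 0 \<Longrightarrow> R m k = 0"
    "\<And>s t. K s t = (\<Sum>l\<le>s. R t l * cnj (R s l))"
proof
  let ?S = "schur_iter K"
  define R where "R t l = ?S l l t / of_real (sqrt (Re (?S l l l)))" for t l
  note p = pos_on_schur_iter[OF K]
  have h: "?S l s t = cnj (?S l t s)" for l s t using pos_on_hermitian[OF p] by blast
  have d: "0 \<le> Re (?S l l l)" "Im (?S l l l) = 0" for l
    using pos_on_diag[OF p] by (auto simp: less_eq_complex_def)
  show "R m k = 0" if "m < k" for m k
    using schur_iter_row_zero[OF K that, of k] h[of k k m] by (simp add: R_def)
  show "R m k = 0" if "R k k = 0" for m k
  proof -
    have "Re (?S k k k) = 0"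
      using that d[of k] by (auto simp: R_def complex_eq_iff)
    then show ?thesis by (simp add: R_def)
  qed
  have RR: "R t l * cnj (R s l) = ?S l s l * ?S l l t / ?S l l l" for s t l
  proof -
    have "complex_of_real (sqrt (Re (?S l l l))) * of_real (sqrt (Re (?S l l l))) = ?S l l l"
      using d[of l] by (simp add: complex_eq_iff flip: of_real_mult)
    then show ?thesis by (simp add: R_def h[of l s l])
  qed
  \<comment> \<open>After \<open>Suc s\<close> steps row \<open>s\<close> of the remainder is
    cleared, so the eliminated terms already add up to \<open>K s t\<close>.\<close>
  show "K s t = (\<Sum>l\<le>s. R t l * cnj (R s l))" for s t
    using schur_iter_sum[of K s t "Suc s"] schur_iter_row_zero[OF K, of s "Suc s" t]
    by (simp add: RR lessThan_Suc_atMost del: sum.lessThan_Suc schur_iter.simps)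
qed

text \<open>Forward substitution: row \<open>k\<close> minus its components along the unit vectors
  of the earlier nonzero pivots, divided by the pivot. In a column with zero pivot there is nothing
  to eliminate.\<close>

lemma triangular_span:
  fixes R :: "nat \<Rightarrow> nat \<Rightarrow> complex"
  assumes tri: "\<And>m k. m < k \<Longrightarrow> R m k = 0" and zero: "\<And>m k. R k k = 0 \<Longrightarrow> R m k = 0"
    and "R k k \<noteq> 0"
  shows "\<exists>c. \<forall>l. (\<Sum>m\<le>k. c m * R m l) = (if l = k then 1 else 0)"
  using assms(3)
proof (induction k rule: less_induct)
  case (less k)
  have "\<exists>c. \<forall>j. j < k \<longrightarrow> R j j \<noteq> 0 \<longrightarrow> (\<forall>l. (\<Sum>m\<le>j. c j m * R m l) = (if l = j then 1 else 0))"
    using less.IH by (intro choice) blast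
  then obtain c where c: "\<And>j l. j < k \<Longrightarrow> R j j \<noteq> 0 \<Longrightarrow> (\<Sum>m\<le>j. c j m * R m l) = (if l = j then 1 else 0)"
    by blast
  define c' where "c' m = (if m = k then 1 else - (\<Sum>j\<in>{m..<k}. R k j * c j m)) / R k k" for m
  have "(\<Sum>m\<le>k. c' m * R m l) = (if l = k then 1 else 0)" for l
  proof -
    have "(\<Sum>m<k. (\<Sum>j\<in>{m..<k}. R k j * c j m) * R m l) = (\<Sum>m<k. \<Sum>j<k. if m \<le> j then R k j * (c j m * R m l) else 0)"
      by (intro sum.cong refl, unfold sum_distrib_right, rule sum.mono_neutral_cong_left) (auto simp: mult_ac)
    also have "\<dots> = (\<Sum>j<k. \<Sum>m<k. if m \<le> j then R k j * (c j m * R m l) else 0)"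
      by (rule sum.swap)
    also have "\<dots> = (\<Sum>j<k. R k j * (\<Sum>m\<le>j. c j m * R m l))"
      by (intro sum.cong refl, unfold sum_distrib_left, rule sum.mono_neutral_cong_right) auto
    also have "\<dots> = (\<Sum>j<k. R k j * (if l = j then 1 else 0))"
    proof (intro sum.cong refl)
      fix j assume "j \<in> {..<k}"
      then show "R k j * (\<Sum>m\<le>j. c j m * R m l) = R k j * (if l = j then 1 else 0)"
        using c[of j l] zero[of j k] by (cases "R j j = 0") auto
    qed
    also have "\<dots> = (if l < k then R k l else 0)"
      by (simp add: if_distrib[of "\<lambda>x. _ * x"] sum.delta' cong: if_cong)
    finally have "(\<Sum>m<k. c' m * R m l) = - (if l < k then R k l else 0) / R k k"
      by (simp add: c'_def sum_negf flip: sum_divide_distrib)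
    then have "(\<Sum>m\<le>k. c' m * R m l) = (R k l - (if l < k then R k l else 0)) / R k k"
      by (simp add: c'_def diff_divide_distrib flip: lessThan_Suc_atMost)
    also have "\<dots> = (if l = k then 1 else 0)"
      using less.prems tri[of k l] by auto
    finally show ?thesis .
  qed
  then show ?case by blast
qed

section \<open>Square summable sequences\<close>

text \<open>\<open>J\<close> will be the set of nonzero pivots of a factorization: the sequences
  vanishing off \<open>J\<close> are those that finite combinations of its rows approximate.\<close>

definition sqsum :: "nat set \<Rightarrow> (nat \<Rightarrow> complex) set" where
  "sqsum J = {x. (\<forall>k. k \<notin> J \<longrightarrow> x k = 0) \<and> summable (\<lambda>k. (cmod (x k))\<^sup>2)}"

definition ell2 :: "nat set \<Rightarrow> (nat \<Rightarrow> complex) hilb" where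
  "ell2 J = \<lparr>carrier = sqsum J, monoid.mult = (\<lambda>x y k. 0), one = (\<lambda>k. 0), zero = (\<lambda>k. 0),
     add = (\<lambda>x y k. x k + y k), module.smult = (\<lambda>c x k. c * x k),
     ip = (\<lambda>x y. \<Sum>k. x k * cnj (y k))\<rparr>"

lemma ell2_simps [simp]:
  "carrier (ell2 J) = sqsum J" "zero (ell2 J) = (\<lambda>k. 0)"
  "add (ell2 J) x y = (\<lambda>k. x k + y k)" "module.smult (ell2 J) c x = (\<lambda>k. c * x k)"
  "ip (ell2 J) x y = (\<Sum>k. x k * cnj (y k))"
  by (simp_all add: ell2_def)

lemma sqsumI: "(\<And>k. k \<notin> J \<Longrightarrow> x k = 0) \<Longrightarrow> summable (\<lambda>k. (cmod (x k))\<^sup>2) \<Longrightarrow> x \<in> sqsum J"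
  by (simp add: sqsum_def)

lemma sqsum_summable: "x \<in> sqsum J \<Longrightarrow> summable (\<lambda>k. (cmod (x k))\<^sup>2)"
  by (simp add: sqsum_def)

lemma sqsum_zero: "(\<lambda>k. 0) \<in> sqsum J"
  by (simp add: sqsum_def)

lemma sqsum_summable_mult:
  assumes "x \<in> sqsum J" "y \<in> sqsum J'"
  shows "summable (\<lambda>k. norm (x k * cnj (y k)))"
proof (rule summable_comparison_test')
  show "summable (\<lambda>k. (cmod (x k))\<^sup>2 + (cmod (y k))\<^sup>2)"
    using assms by (intro summable_add sqsum_summable)
  show "norm (norm (x k * cnj (y k))) \<le> (cmod (x k))\<^sup>2 + (cmod (y k))\<^sup>2" for k
  proof -
    have "2 * (cmod (x k) * cmod (y k)) \<le> (cmod (x k))\<^sup>2 + (cmod (y k))\<^sup>2"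
      using sum_squares_bound[of "cmod (x k)" "cmod (y k)"] by simp
    moreover have "0 \<le> cmod (x k) * cmod (y k)" by simp
    moreover have "norm (norm (x k * cnj (y k))) = cmod (x k) * cmod (y k)" by (simp add: norm_mult)
    ultimately show ?thesis by linarith
  qed
qed

lemma sqsum_smult:
  assumes "x \<in> sqsum J" shows "(\<lambda>k. c * x k) \<in> sqsum J"
proof (rule sqsumI)
  show "summable (\<lambda>k. (cmod (c * x k))\<^sup>2)"
    using summable_mult[OF sqsum_summable[OF assms], of "(cmod c)\<^sup>2"]
    by (simp add: norm_mult power_mult_distrib)
qed (use assms in \<open>simp add: sqsum_def\<close>)

lemma sqsum_add:
  assumes "x \<in> sqsum J" "y \<in> sqsum J"
  shows "(\<lambda>k. x k + y k) \<in> sqsum J"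
proof (rule sqsumI)
  show "summable (\<lambda>k. (cmod (x k + y k))\<^sup>2)"
  proof (rule summable_comparison_test')
    show "summable (\<lambda>k. 2 * (cmod (x k))\<^sup>2 + 2 * (cmod (y k))\<^sup>2)"
      using assms by (intro summable_add summable_mult sqsum_summable)
    show "norm ((cmod (x k + y k))\<^sup>2) \<le> 2 * (cmod (x k))\<^sup>2 + 2 * (cmod (y k))\<^sup>2" for k
    proof -
      have "(cmod (x k + y k))\<^sup>2 \<le> (cmod (x k) + cmod (y k))\<^sup>2"
        by (intro power_mono norm_triangle_ineq) simp
      also have "\<dots> \<le> 2 * (cmod (x k))\<^sup>2 + 2 * (cmod (y k))\<^sup>2"
        using sum_squares_bound[of "cmod (x k)" "cmod (y k)"] by (simp add: power2_sum)
      finally show ?thesis by simp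
    qed
  qed
qed (use assms in \<open>simp add: sqsum_def\<close>)

lemma sqsum_diff:
  assumes "x \<in> sqsum J" "y \<in> sqsum J"
  shows "(\<lambda>k. x k - y k) \<in> sqsum J"
  using sqsum_add[OF assms(1) sqsum_smult[OF assms(2), of "-1"]] by simp

lemma sqsum_finite_support:
  assumes "\<And>k. k \<notin> J \<Longrightarrow> x k = 0" "\<And>k. k > N \<Longrightarrow> x k = 0"
  shows "x \<in> sqsum J"
  using assms by (intro sqsumI summable_finite[of "{..N}"]) auto

lemma ell2_vectorspace: "vectorspace (class_ring :: complex ring) (ell2 J)"
proof -
  have ag: "abelian_group (ell2 J)"
  proof (rule abelian_groupI)
    fix x assume "x \<in> carrier (ell2 J)"
    then show "\<exists>y\<in>carrier (ell2 J). y \<oplus>\<^bsub>ell2 J\<^esub> x = \<zero>\<^bsub>ell2 J\<^esub>"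
      using sqsum_smult[of x J "-1"] by (intro bexI[of _ "\<lambda>k. - x k"]) auto
  qed (auto simp: sqsum_add sqsum_zero algebra_simps)
  have "cring (class_ring :: complex ring)" by (rule class_cring.cring_axioms)
  then have "module (class_ring :: complex ring) (ell2 J)"
    using ag by (rule moduleI) (auto simp: sqsum_smult algebra_simps)
  then show ?thesis unfolding vectorspace_def using class_field by blast
qed

lemma ell2_minus [simp]:
  assumes "x \<in> sqsum J" "y \<in> sqsum J"
  shows "x \<ominus>\<^bsub>ell2 J\<^esub> y = (\<lambda>k. x k - y k)"
proof -
  interpret vectorspace "class_ring :: complex ring" "ell2 J" by (rule ell2_vectorspace)
  have "\<ominus>\<^bsub>ell2 J\<^esub> y = (\<lambda>k. - y k)"
    using sqsum_smult[OF assms(2), of "-1"] assms(2)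
    by (intro M.minus_equality) auto
  then show ?thesis by (simp add: a_minus_def)
qed

definition sqnorm :: "(nat \<Rightarrow> complex) \<Rightarrow> real" where
  "sqnorm x = (\<Sum>k. (cmod (x k))\<^sup>2)"

lemma ell2_ip_self:
  assumes "x \<in> sqsum J"
  shows "ip (ell2 J) x x = of_real (sqnorm x)"
proof -
  have "x k * cnj (x k) = of_real ((cmod (x k))\<^sup>2)" for k
    by (simp only: complex_norm_square)
  then show ?thesis
    unfolding sqnorm_def using suminf_of_real[OF sqsum_summable[OF assms], where ?'a = complex] by simp
qed

lemma sqnorm_nonneg: "x \<in> sqsum J \<Longrightarrow> 0 \<le> sqnorm x"
  unfolding sqnorm_def by (intro suminf_nonneg sqsum_summable) auto

lemma hnorm_ell2:
  assumes "x \<in> sqsum J"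
  shows "hnorm (ell2 J) x = sqrt (sqnorm x)"
  by (simp add: hnorm_def ell2_ip_self[OF assms] del: ell2_simps)

lemma hdist_ell2:
  assumes "x \<in> sqsum J" "y \<in> sqsum J"
  shows "hdist (ell2 J) x y = sqrt (sqnorm (\<lambda>k. x k - y k))"
  using assms by (simp add: hdist_def hnorm_ell2 sqsum_diff)

lemma sum_le_sqnorm:
  assumes "x \<in> sqsum J" "finite F"
  shows "(\<Sum>k\<in>F. (cmod (x k))\<^sup>2) \<le> sqnorm x"
  unfolding sqnorm_def by (intro sum_le_suminf sqsum_summable[OF assms(1)] assms) auto

lemma sqnorm_le:
  assumes "x \<in> sqsum J" "\<And>m. (\<Sum>k<m. (cmod (x k))\<^sup>2) \<le> B"
  shows "sqnorm x \<le> B"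
  unfolding sqnorm_def by (intro suminf_le_const sqsum_summable[OF assms(1)] assms(2))

text \<open>The axioms of \<^locale>\<open>hilbert_space\<close> other than completeness; they already give a metric.\<close>

locale pre_hilbert = vectorspace "class_ring :: complex ring" H
  for H :: "('h, 'z) hilb_scheme" (structure) +
  assumes ip_add: "\<lbrakk>x \<in> carrier H; y \<in> carrier H; z \<in> carrier H\<rbrakk>
      \<Longrightarrow> ip H (x \<oplus> y) z = ip H x z + ip H y z"
    and ip_smult: "\<lbrakk>x \<in> carrier H; z \<in> carrier H\<rbrakk> \<Longrightarrow> ip H (c \<odot> x) z = c * ip H x z"
    and ip_cnj: "\<lbrakk>x \<in> carrier H; y \<in> carrier H\<rbrakk> \<Longrightarrow> ip H y x = cnj (ip H x y)"
    and ip_nonneg: "x \<in> carrier H \<Longrightarrow> 0 \<le> ip H x x"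
    and ip_definite: "\<lbrakk>x \<in> carrier H; ip H x x = 0\<rbrakk> \<Longrightarrow> x = \<zero>"

lemma ell2_pre_hilbert: "pre_hilbert (ell2 J)"
proof -
  interpret vectorspace "class_ring :: complex ring" "ell2 J" by (rule ell2_vectorspace)
  show ?thesis
  proof
    fix x y z c
    assume x: "x \<in> carrier (ell2 J)" and z: "z \<in> carrier (ell2 J)"
    note sx = summable_norm_cancel[OF sqsum_summable_mult[of x J]]
    show "ip (ell2 J) (c \<odot>\<^bsub>ell2 J\<^esub> x) z = c * ip (ell2 J) x z"
      using sx[of z J] x z by (simp add: suminf_mult[symmetric] mult.assoc)
    assume y: "y \<in> carrier (ell2 J)"
    show "ip (ell2 J) (x \<oplus>\<^bsub>ell2 J\<^esub> y) z = ip (ell2 J) x z + ip (ell2 J) y z"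
      using summable_norm_cancel[OF sqsum_summable_mult[of y J z J]] sx[of z J] x y z
      by (simp add: suminf_add distrib_right)
  next
    fix x y
    assume x: "x \<in> carrier (ell2 J)" and y: "y \<in> carrier (ell2 J)"
    have "summable (\<lambda>k. x k * cnj (y k))"
      using summable_norm_cancel[OF sqsum_summable_mult[of x J y J]] x y by simp
    then have "(\<lambda>k. cnj (x k * cnj (y k))) sums cnj (\<Sum>k. x k * cnj (y k))"
      by (intro bounded_linear.sums[OF bounded_linear_cnj] summable_sums)
    then show "ip (ell2 J) y x = cnj (ip (ell2 J) x y)"
      by (simp add: sums_iff mult.commute)
  next
    fix x
    assume x: "x \<in> carrier (ell2 J)"
    then show "0 \<le> ip (ell2 J) x x"
      by (simp add: ell2_ip_self sqnorm_nonneg less_eq_complex_def del: ell2_simps(5))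
    assume "ip (ell2 J) x x = 0"
    then have "sqnorm x = 0" using x by (simp add: ell2_ip_self del: ell2_simps(5))
    then have "(cmod (x k))\<^sup>2 = 0" for k
      unfolding sqnorm_def using x by (subst (asm) suminf_eq_zero_iff) (auto intro: sqsum_summable)
    then show "x = \<zero>\<^bsub>ell2 J\<^esub>" by auto
  qed
qed

section \<open>Elementary geometry of the inner product\<close>

context pre_hilbert begin

lemma ip_add_right:
  "\<lbrakk>x \<in> carrier H; y \<in> carrier H; z \<in> carrier H\<rbrakk> \<Longrightarrow> ip H z (x \<oplus> y) = ip H z x + ip H z y"
  by (metis M.a_closed complex_cnj_add ip_add ip_cnj)

lemma ip_smult_right:
  "\<lbrakk>x \<in> carrier H; z \<in> carrier H\<rbrakk> \<Longrightarrow> ip H z (c \<odot> x) = cnj c * ip H z x"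
proof -
  assume a: "x \<in> carrier H" "z \<in> carrier H"
  have "c \<odot> x \<in> carrier H" using a by (intro smult_closed) auto
  then show ?thesis using a by (metis complex_cnj_mult ip_cnj ip_smult)
qed

lemma ip_zero [simp]:
  assumes "z \<in> carrier H" shows "ip H \<zero> z = 0" "ip H z \<zero> = 0"
proof -
  have "ip H (\<zero> \<oplus> \<zero>) z = ip H \<zero> z + ip H \<zero> z" using assms by (intro ip_add) auto
  then show "ip H \<zero> z = 0" by simp
  then show "ip H z \<zero> = 0" using assms ip_cnj[of "\<zero>" z] by simp
qed

lemma ip_finsum:
  assumes "f \<in> A \<rightarrow> carrier H" "z \<in> carrier H"
  shows "ip H (finsum H f A) z = (\<Sum>a\<in>A. ip H (f a) z)"
  using assms
proof (induction A rule: infinite_finite_induct)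
  case (insert a A)
  then have "finsum H f A \<in> carrier H" by (intro M.finsum_closed) auto
  with insert show ?case by (subst M.finsum_insert) (auto simp: ip_add)
qed (auto simp: M.finsum_infinite)

lemma ip_finsum_right:
  assumes "f \<in> A \<rightarrow> carrier H" "z \<in> carrier H"
  shows "ip H z (finsum H f A) = (\<Sum>a\<in>A. ip H z (f a))"
proof -
  have "finsum H f A \<in> carrier H" using assms by (intro M.finsum_closed)
  then have "ip H z (finsum H f A) = cnj (ip H (finsum H f A) z)" using assms ip_cnj by blast
  also have "\<dots> = (\<Sum>a\<in>A. cnj (ip H (f a) z))"
    using assms by (simp add: ip_finsum)
  also have "\<dots> = (\<Sum>a\<in>A. ip H z (f a))"
    using assms by (intro sum.cong refl) (metis PiE ip_cnj)
  finally show ?thesis .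
qed

lemma ip_self_real: "x \<in> carrier H \<Longrightarrow> ip H x x = of_real (Re (ip H x x))"
  using ip_nonneg[of x] by (simp add: less_eq_complex_def complex_eq_iff)

lemma hnorm_nonneg: "x \<in> carrier H \<Longrightarrow> 0 \<le> hnorm H x"
  using ip_nonneg[of x] by (simp add: hnorm_def less_eq_complex_def)

lemma hnorm_square: "x \<in> carrier H \<Longrightarrow> (hnorm H x)\<^sup>2 = Re (ip H x x)"
  using ip_nonneg[of x] by (simp add: hnorm_def less_eq_complex_def)

lemma Cauchy_Schwarz:
  assumes x: "x \<in> carrier H" and y: "y \<in> carrier H"
  shows "cmod (ip H x y) \<le> hnorm H x * hnorm H y"
proof -
  define a b d where "a = Re (ip H x x)" and "b = ip H x y" and "d = Re (ip H y y)"
  have a: "ip H x x = of_real a" "0 \<le> a" and d: "ip H y y = of_real d" "0 \<le> d"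
    using ip_nonneg[OF x] ip_nonneg[OF y] by (auto simp: a_def d_def less_eq_complex_def complex_eq_iff)
  have yx: "ip H y x = cnj b" using ip_cnj[OF x y] by (simp add: b_def)
  have "(cmod b)\<^sup>2 \<le> a * d"
  proof (cases "d = 0")
    case True
    then have "y = \<zero>" using ip_definite[OF y] d by simp
    then show ?thesis using x a d by (simp add: b_def)
  next
    case False
    \<comment> \<open>This is \<open>d\<close> times the component of \<open>x\<close> orthogonal to
      \<open>y\<close>, written without division.\<close>
    let ?z = "of_real d \<odot> x \<oplus> (- b) \<odot> y"
    have c: "of_real d \<odot> x \<in> carrier H" "(- b) \<odot> y \<in> carrier H"
      using x y by (auto intro!: smult_closed)
    have "ip H ?z ?z = of_real (d * (a * d - (cmod b)\<^sup>2))"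
      using c x y by (simp add: ip_add ip_smult ip_add_right ip_smult_right a d yx b_def[symmetric]
          complex_norm_square[symmetric] algebra_simps flip: of_real_power)
    then have "0 \<le> d * (a * d - (cmod b)\<^sup>2)"
      using ip_nonneg[of ?z] c by (simp add: less_eq_complex_def)
    then show ?thesis using False d(2) by (simp add: zero_le_mult_iff)
  qed
  then show ?thesis
    unfolding hnorm_def a_def[symmetric] d_def[symmetric] b_def[symmetric]
    by (simp add: real_le_rsqrt flip: real_sqrt_mult)
qed

lemma hnorm_triangle:
  assumes x: "x \<in> carrier H" and y: "y \<in> carrier H"
  shows "hnorm H (x \<oplus> y) \<le> hnorm H x + hnorm H y"
proof (rule power2_le_imp_le)
  have "Re (ip H x y) \<le> hnorm H x * hnorm H y"
    using Cauchy_Schwarz[OF x y] complex_Re_le_cmod order_trans by blast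
  moreover have "Re (ip H y x) = Re (ip H x y)" using ip_cnj[OF x y] by simp
  ultimately show "(hnorm H (x \<oplus> y))\<^sup>2 \<le> (hnorm H x + hnorm H y)\<^sup>2"
    using x y by (simp add: hnorm_square ip_add ip_add_right power2_sum)
qed (simp add: x y hnorm_nonneg)

lemma Metric_space_hdist: "Metric_space (carrier H) (hdist H)"
proof
  fix x y z
  show "0 \<le> hdist H x y" by (simp add: hdist_def hnorm_nonneg)
  have neg: "ip H (u \<ominus> v) (u \<ominus> v) = ip H (v \<ominus> u) (v \<ominus> u)" if "u \<in> carrier H" "v \<in> carrier H" for u v
  proof -
    have "u \<ominus> v = (-1) \<odot> (v \<ominus> u)"
    proof -
      have "(-1) \<odot> (v \<ominus> u) = \<ominus> (v \<ominus> u)"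
        using that smult_l_minus[of 1 "v \<ominus> u"] smult_one[of "v \<ominus> u"] by (simp add: class_ring_simps)
      then show ?thesis using that by (simp add: M.minus_add M.minus_minus a_minus_def M.a_comm)
    qed
    then show ?thesis using that by (simp add: ip_smult ip_smult_right)
  qed
  then show "hdist H x y = hdist H y x" by (auto simp: hdist_def hnorm_def)
  assume x: "x \<in> carrier H" and y: "y \<in> carrier H"
  show "hdist H x y = 0 \<longleftrightarrow> x = y"
  proof
    assume "x = y"
    then have "hdist H x y = hnorm H (y \<ominus> y)" using y by (simp add: hdist_def)
    also have "y \<ominus> y = \<zero>" using y by (simp add: a_minus_def M.r_neg)
    finally show "hdist H x y = 0" by (simp add: hnorm_def)
  next
    assume "hdist H x y = 0"
    then have "ip H (x \<ominus> y) (x \<ominus> y) = 0"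
      using x y ip_self_real[of "x \<ominus> y"] by (simp add: hdist_def hnorm_def)
    then have "x \<ominus> y = \<zero>" using x y by (intro ip_definite) auto
    then show "x = y" using x y M.minus_equality[of x "\<ominus> y"] by (simp add: a_minus_def M.minus_minus)
  qed
  assume z: "z \<in> carrier H"
  have "x \<ominus> z = (x \<ominus> y) \<oplus> (y \<ominus> z)"
    using x y z by (simp add: a_minus_def M.a_ac M.r_neg1 M.r_neg2)
  then show "hdist H x z \<le> hdist H x y + hdist H y z"
    using x y z by (simp add: hdist_def hnorm_triangle)
qed

end

sublocale hilbert_space \<subseteq> pre_hilbert
  by unfold_locales (fact ip_add ip_smult ip_cnj ip_nonneg ip_definite)+

section \<open>Completeness and separability of \<open>ell2\<close>\<close>

lemma ell2_complete: "Metric_space.mcomplete (carrier (ell2 J)) (hdist (ell2 J))"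
proof -
  interpret pre_hilbert "ell2 J" by (rule ell2_pre_hilbert)
  interpret MS: Metric_space "carrier (ell2 J)" "hdist (ell2 J)" by (rule Metric_space_hdist)
  show ?thesis unfolding MS.mcomplete_def
  proof (intro allI impI)
    fix X assume "MS.MCauchy X"
    then have X: "\<And>n. X n \<in> sqsum J"
      and C: "\<And>e. e > 0 \<Longrightarrow> \<exists>N. \<forall>n n'. N \<le> n \<longrightarrow> N \<le> n' \<longrightarrow> hdist (ell2 J) (X n) (X n') < e"
      unfolding MS.MCauchy_def by auto
    have C2: "\<exists>N. \<forall>n\<ge>N. \<forall>n'\<ge>N. sqnorm (\<lambda>k. X n k - X n' k) < e\<^sup>2" if "e > 0" for e
    proof -
      obtain N where N: "\<And>n n'. N \<le> n \<Longrightarrow> N \<le> n' \<Longrightarrow> hdist (ell2 J) (X n) (X n') < e"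
        using C[OF \<open>e > 0\<close>] by blast
      have "sqnorm (\<lambda>k. X n k - X n' k) < e\<^sup>2" if "n \<ge> N" "n' \<ge> N" for n n'
        using N[OF that] sqnorm_nonneg[OF sqsum_diff[OF X X], of n n'] \<open>e > 0\<close>
        by (simp add: hdist_ell2[OF X X] real_sqrt_less_iff[symmetric, of _ "e\<^sup>2"] del: real_sqrt_less_iff)
      then show ?thesis by blast
    qed
    have "Cauchy (\<lambda>n. X n k)" for k
    proof (rule metric_CauchyI)
      fix e :: real assume "e > 0"
      then obtain N where N: "\<And>n n'. n \<ge> N \<Longrightarrow> n' \<ge> N \<Longrightarrow> sqnorm (\<lambda>k. X n k - X n' k) < e\<^sup>2"
        using C2 by blast
      have "dist (X n k) (X n' k) < e" if "n \<ge> N" "n' \<ge> N" for n n'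
      proof (rule power_less_imp_less_base)
        show "(dist (X n k) (X n' k))\<^sup>2 < e\<^sup>2"
          using N[OF that] sum_le_sqnorm[OF sqsum_diff[OF X X], of "{k}" n n'] by (simp add: dist_norm)
      qed (use \<open>e > 0\<close> in simp)
      then show "\<exists>N. \<forall>m\<ge>N. \<forall>n\<ge>N. dist (X m k) (X n k) < e" by blast
    qed
    then have "\<exists>l. (\<lambda>n. X n k) \<longlonglongrightarrow> l" for k using Cauchy_convergent_iff convergent_def by blast
    then obtain y where y: "\<And>k. (\<lambda>n. X n k) \<longlonglongrightarrow> y k" by metis
    \<comment> \<open>The Cauchy estimate is kept on finite partial sums while \<open>n'\<close>
      tends to infinity; this one bound yields both the summability and the norm estimate for
      \<open>X n - y\<close>.\<close>
    have part: "(\<Sum>k<m. (cmod (X n k - y k))\<^sup>2) \<le> e\<^sup>2"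
      if N: "\<And>n n'. n \<ge> N \<Longrightarrow> n' \<ge> N \<Longrightarrow> sqnorm (\<lambda>k. X n k - X n' k) < e\<^sup>2" and "n \<ge> N" for N n m e
    proof (rule tendsto_upperbound)
      show "(\<lambda>n'. \<Sum>k<m. (cmod (X n k - X n' k))\<^sup>2) \<longlonglongrightarrow> (\<Sum>k<m. (cmod (X n k - y k))\<^sup>2)"
        by (intro tendsto_intros y)
      show "eventually (\<lambda>n'. (\<Sum>k<m. (cmod (X n k - X n' k))\<^sup>2) \<le> e\<^sup>2) sequentially"
        unfolding eventually_sequentially
      proof (intro exI[of _ N] allI impI)
        fix n' assume "n' \<ge> N"
        then show "(\<Sum>k<m. (cmod (X n k - X n' k))\<^sup>2) \<le> e\<^sup>2"
          using N[OF \<open>n \<ge> N\<close>, of n'] sum_le_sqnorm[OF sqsum_diff[OF X X], of "{..<m}" n n'] by simp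
      qed
    qed simp
    have yJ: "y k = 0" if "k \<notin> J" for k
      using LIMSEQ_unique[OF y[of k], of 0] X that by (simp add: sqsum_def)
    have dJ: "(\<lambda>k. X n k - y k) \<in> sqsum J \<and> sqnorm (\<lambda>k. X n k - y k) \<le> e\<^sup>2"
      if N: "\<And>n n'. n \<ge> N \<Longrightarrow> n' \<ge> N \<Longrightarrow> sqnorm (\<lambda>k. X n k - X n' k) < e\<^sup>2" and "n \<ge> N" for N n e
    proof -
      have "(\<lambda>k. X n k - y k) \<in> sqsum J"
      proof (rule sqsumI)
        show "summable (\<lambda>k. (cmod (X n k - y k))\<^sup>2)"
        proof (rule bounded_imp_summable[of _ "e\<^sup>2"])
          show "(\<Sum>k\<le>m. (cmod (X n k - y k))\<^sup>2) \<le> e\<^sup>2" for m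
            using part[OF N \<open>n \<ge> N\<close>, of "Suc m"] by (simp only: lessThan_Suc_atMost)
        qed simp
      qed (use X yJ in \<open>auto simp: sqsum_def\<close>)
      then show ?thesis using sqnorm_le part[OF N \<open>n \<ge> N\<close>] by blast
    qed
    \<comment> \<open>\<open>y\<close> is the difference of \<open>X N\<close> and
      \<open>X N - y\<close>, both square summable.\<close>
    have y_in: "y \<in> sqsum J"
    proof -
      obtain N where N: "\<And>n n'. n \<ge> N \<Longrightarrow> n' \<ge> N \<Longrightarrow> sqnorm (\<lambda>k. X n k - X n' k) < 1\<^sup>2"
        using C2[of 1] by auto
      from dJ[OF N, of N] sqsum_diff[OF X[of N]] show ?thesis by fastforce
    qed
    have "limitin MS.mtopology X y sequentially"
      unfolding MS.limitin_metric
    proof (intro conjI allI impI)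
      show "y \<in> carrier (ell2 J)" using y_in by simp
      fix e :: real assume "e > 0"
      \<comment> \<open>The limit preserves only weak inequalities, hence
        \<open>e/2\<close>.\<close>
      then obtain N where N: "\<And>n n'. n \<ge> N \<Longrightarrow> n' \<ge> N \<Longrightarrow> sqnorm (\<lambda>k. X n k - X n' k) < (e/2)\<^sup>2"
        using C2[of "e/2"] by auto
      have "hdist (ell2 J) (X n) y < e" if "n \<ge> N" for n
      proof -
        have "sqrt (sqnorm (\<lambda>k. X n k - y k)) \<le> sqrt ((e/2)\<^sup>2)"
          using dJ[OF N that] by (intro real_sqrt_le_mono) blast
        then show ?thesis using \<open>e > 0\<close> by (simp add: hdist_ell2[OF X y_in])
      qed
      then show "\<forall>\<^sub>F n in sequentially. X n \<in> carrier (ell2 J) \<and> hdist (ell2 J) (X n) y < e"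
        unfolding eventually_sequentially using X by auto
    qed
    then show "\<exists>x. limitin MS.mtopology X x sequentially" by blast
  qed
qed

definition trunc :: "nat \<Rightarrow> (nat \<Rightarrow> complex) \<Rightarrow> nat \<Rightarrow> complex" where
  "trunc N x k = (if k < N then x k else 0)"

lemma trunc_sqsum: "x \<in> sqsum J \<Longrightarrow> trunc N x \<in> sqsum J"
  by (rule sqsum_finite_support[of _ _ N]) (auto simp: trunc_def sqsum_def)

lemma trunc_tendsto:
  assumes "x \<in> sqsum J"
  shows "(\<lambda>N. sqnorm (\<lambda>k. x k - trunc N x k)) \<longlonglongrightarrow> 0"
proof -
  have s: "summable (\<lambda>k. (cmod (x k))\<^sup>2)" by (rule sqsum_summable[OF assms])
  have "sqnorm (\<lambda>k. x k - trunc N x k) = sqnorm x - (\<Sum>k<N. (cmod (x k))\<^sup>2)" for N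
  proof -
    let ?f = "\<lambda>k. (cmod (x k - trunc N x k))\<^sup>2"
    have "(\<Sum>k. ?f k) = (\<Sum>k. ?f (k + N)) + (\<Sum>k<N. ?f k)"
      by (rule suminf_split_initial_segment)
        (use sqsum_summable[OF sqsum_diff[OF assms trunc_sqsum[OF assms]]] in simp)
    also have "(\<Sum>k<N. ?f k) = 0" by (simp add: trunc_def)
    also have "(\<Sum>k. ?f (k + N)) = (\<Sum>k. (cmod (x (k + N)))\<^sup>2)" by (simp add: trunc_def)
    finally show ?thesis
      using suminf_split_initial_segment[OF s, of N] by (simp add: sqnorm_def)
  qed
  moreover have "(\<lambda>N. sqnorm x - (\<Sum>k<N. (cmod (x k))\<^sup>2)) \<longlonglongrightarrow> sqnorm x - sqnorm x"
    unfolding sqnorm_def by (intro tendsto_intros summable_LIMSEQ s)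
  ultimately show ?thesis by simp
qed

lemma Gaussian_rational_approx:
  assumes "e > 0"
  shows "\<exists>q r :: rat. cmod (z - Complex (of_rat q) (of_rat r)) < e"
proof -
  obtain q where q: "Re z - e/2 < of_rat q" "of_rat q < Re z + e/2"
    using of_rat_dense[of "Re z - e/2" "Re z + e/2"] assms by auto
  obtain r where r: "Im z - e/2 < of_rat r" "of_rat r < Im z + e/2"
    using of_rat_dense[of "Im z - e/2" "Im z + e/2"] assms by auto
  have "cmod (z - Complex (of_rat q) (of_rat r)) \<le> \<bar>Re z - of_rat q\<bar> + \<bar>Im z - of_rat r\<bar>"
    using cmod_le[of "z - Complex (of_rat q) (of_rat r)"] by simp
  also have "\<dots> < e" using q r by linarith
  finally show ?thesis by blast
qed

lemma ell2_separable:
  "separable_space (Metric_space.mtopology (carrier (ell2 J)) (hdist (ell2 J)))"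
proof -
  interpret pre_hilbert "ell2 J" by (rule ell2_pre_hilbert)
  interpret MS: Metric_space "carrier (ell2 J)" "hdist (ell2 J)" by (rule Metric_space_hdist)
  \<comment> \<open>Finite lists of pairs of rationals encode the Gaussian rational sequences of
    finite support, so countability of the dense set comes from the list type.\<close>
  define h where "h l k = (if k < length l \<and> k \<in> J
      then Complex (of_rat (fst (l ! k))) (of_rat (snd (l ! k))) else 0)" for l k
  define C where "C = range h"
  have h: "h l \<in> sqsum J" for l
    by (rule sqsum_finite_support[of _ _ "length l"]) (auto simp: h_def)
  have "\<exists>y\<in>C. hdist (ell2 J) x y < e" if x: "x \<in> sqsum J" and "e > 0" for x e
  proof -
    obtain N where N: "sqnorm (\<lambda>k. x k - trunc N x k) < (e/2)\<^sup>2"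
      using order_tendstoD(2)[OF trunc_tendsto[OF x], of "(e/2)\<^sup>2"] \<open>e > 0\<close>
      by (auto simp: eventually_sequentially)
    \<comment> \<open>At most \<open>N\<close> coordinates with error below \<open>e'\<close>
      contribute at most \<open>N e'^2\<close>, which is at most \<open>(e/2)^2\<close>; the extra 1
      keeps the denominator positive.\<close>
    define e' where "e' = e / (2 * (real N + 1))"
    have "e' > 0" using \<open>e > 0\<close> by (simp add: e'_def)
    then have "\<exists>q r :: rat. cmod (x k - Complex (of_rat q) (of_rat r)) < e'" for k
      by (rule Gaussian_rational_approx)
    then obtain q r where qr: "\<And>k. cmod (x k - Complex (of_rat (q k)) (of_rat (r k))) < e'"
      by metis
    define l where "l = map (\<lambda>k. (q k, r k)) [0..<N]"
    have hl: "h l k = (if k < N \<and> k \<in> J then Complex (of_rat (q k)) (of_rat (r k)) else 0)" for k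
      by (simp add: h_def l_def)
    have t: "trunc N x \<in> sqsum J" by (rule trunc_sqsum[OF x])
    have "sqnorm (\<lambda>k. trunc N x k - h l k) \<le> real N * e'\<^sup>2"
    proof (rule sqnorm_le[OF sqsum_diff[OF t h]])
      fix m
      have "(\<Sum>k<m. (cmod (trunc N x k - h l k))\<^sup>2) \<le> (\<Sum>k<m. if k < N then e'\<^sup>2 else 0)"
        using qr \<open>e' > 0\<close> x
        by (intro sum_mono) (auto simp: trunc_def hl sqsum_def intro!: power_mono less_imp_le)
      also have "\<dots> = real (card ({..<m} \<inter> {..<N})) * e'\<^sup>2"
        by (simp add: sum.If_cases lessThan_def Int_def)
      also have "\<dots> \<le> real N * e'\<^sup>2"
        using card_mono[of "{..<N}" "{..<m} \<inter> {..<N}"] by (intro mult_right_mono) auto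
      finally show "(\<Sum>k<m. (cmod (trunc N x k - h l k))\<^sup>2) \<le> real N * e'\<^sup>2" .
    qed
    also have "\<dots> \<le> ((real N + 1) * e')\<^sup>2"
      using \<open>e' > 0\<close> by (simp add: power2_eq_square algebra_simps)
    also have "(real N + 1) * e' = e / 2" by (simp add: e'_def field_simps)
    finally have "hdist (ell2 J) (trunc N x) (h l) \<le> e/2"
      using \<open>e > 0\<close> real_sqrt_le_mono[of _ "(e/2)\<^sup>2"] by (fastforce simp: hdist_ell2[OF t h])
    moreover have "hdist (ell2 J) x (trunc N x) < e/2"
      using real_sqrt_less_mono[OF N] \<open>e > 0\<close> by (simp add: hdist_ell2[OF x t])
    ultimately have "hdist (ell2 J) x (h l) < e"
      using MS.triangle[of x "trunc N x" "h l"] x t h by simp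
    then show ?thesis by (auto simp: C_def)
  qed
  then have "MS.mtopology closure_of C = carrier (ell2 J)"
    using h unfolding MS.metric_closure_of MS.in_mball by (auto simp: C_def)
  moreover have "countable C" "C \<subseteq> carrier (ell2 J)" using h by (auto simp: C_def)
  ultimately show ?thesis unfolding separable_space_def MS.topspace_mtopology by blast
qed

theorem ell2_hilbert: "separable_hilbert_space (ell2 J)"
proof -
  interpret pre_hilbert "ell2 J" by (rule ell2_pre_hilbert)
  show ?thesis
    unfolding separable_hilbert_space_def
    by (intro conjI ell2_separable hilbert_space.intro ell2_vectorspace hilbert_space_axioms.intro
        ip_add ip_smult ip_cnj ip_nonneg ip_definite ell2_complete)
qed

section \<open>Hankel and localizing kernels\<close>

lemma append_in_words [simp]: "\<alpha> @ \<beta> \<in> words g \<longleftrightarrow> \<alpha> \<in> words g \<and> \<beta> \<in> words g"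
  by (auto simp: words_def)

lemma rev_in_words [simp]: "rev \<alpha> \<in> words g \<longleftrightarrow> \<alpha> \<in> words g"
  by (auto simp: words_def)

lemma Nil_in_words [simp]: "[] \<in> words g"
  by (simp add: words_def)

lemma Cons_in_words [simp]: "i # \<alpha> \<in> words g \<longleftrightarrow> i < g \<and> \<alpha> \<in> words g"
  by (auto simp: words_def)

lemma finite_words_upto: "finite (words_upto g d)"
proof -
  have "words_upto g d = {xs. set xs \<subseteq> {..<g} \<and> length xs \<le> d}"
    by (auto simp: words_upto_def words_def)
  then show ?thesis by (simp add: finite_lists_length_le)
qed

lemma words_upto_subset: "words_upto g d \<subseteq> words g"
  by (auto simp: words_upto_def)

lemma mat_adjoint_dims [simp]:
  "dim_row (mat_adjoint A) = dim_col A" "dim_col (mat_adjoint A) = dim_row A"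
  by (simp_all add: mat_adjoint_def)

lemma mat_adjoint_index [simp]:
  "i < dim_col A \<Longrightarrow> j < dim_row A \<Longrightarrow> mat_adjoint A $$ (i, j) = cnj (A $$ (j, i))"
  by (simp add: mat_adjoint_def mat_of_rows_index)

lemma msum_dims [simp]: "dim_row (msum m n f S) = m" "dim_col (msum m n f S) = n"
  by (simp_all add: msum_def)

lemma msum_carrier [simp]: "msum m n f S \<in> carrier_mat m n"
  by (simp add: msum_def)

lemma msum_index [simp]:
  "i < m \<Longrightarrow> j < n \<Longrightarrow> msum m n f S $$ (i, j) = (\<Sum>s\<in>S. f s $$ (i, j))"
  by (simp add: msum_def)

lemma kron_dims [simp]:
  "dim_row (kron A B) = dim_row A * dim_row B" "dim_col (kron A B) = dim_col A * dim_col B"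
  by (simp_all add: kron_def)

lemma mult_add_less: "i < m \<Longrightarrow> a < n \<Longrightarrow> i * n + a < m * (n::nat)"
proof -
  assume "i < m" "a < n"
  then have "i * n + a < Suc i * n" by simp
  also have "\<dots> \<le> m * n" using \<open>i < m\<close> by (intro mult_le_mono1) simp
  finally show ?thesis .
qed

lemma kron_index:
  assumes "A \<in> carrier_mat m m" "B \<in> carrier_mat n n" "i < m" "j < m" "a < n" "b < n"
  shows "kron A B $$ (i * n + a, j * n + b) = A $$ (i, j) * B $$ (a, b)"
  using assms by (auto simp: kron_def mult_add_less)

lemma bij_betw_mult_add:
  "bij_betw (\<lambda>(i, a). i * n + a) ({..<m} \<times> {..<n}) {..<m * (n::nat)}"
proof (rule bij_betw_byWitness[where f' = "\<lambda>k. (k div n, k mod n)"])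
  show "(\<lambda>k. (k div n, k mod n)) ` {..<m * n} \<subseteq> {..<m} \<times> {..<n}"
  proof clarsimp
    fix k assume k: "k < m * n"
    then have "n > 0" by (cases n) auto
    then show "k div n < m \<and> k mod n < n" using k by (simp add: less_mult_imp_div_less)
  qed
qed (auto simp: mult_add_less)

lemma pos_on_bij:
  assumes "bij_betw f T I"
  shows "pos_on I M \<longleftrightarrow> pos_on T (\<lambda>s t. M (f s) (f t))"
proof
  show "pos_on I M \<Longrightarrow> pos_on T (\<lambda>s t. M (f s) (f t))"
    by (rule pos_on_pullback) (use assms in \<open>auto simp: bij_betw_def\<close>)
next
  let ?h = "the_inv_into T f"
  assume "pos_on T (\<lambda>s t. M (f s) (f t))"
  then have "pos_on I (\<lambda>s t. M (f (?h s)) (f (?h t)))"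
    by (rule pos_on_pullback) (use bij_betw_the_inv_into[OF assms] in \<open>auto simp: bij_betw_def\<close>)
  then show "pos_on I M"
    by (subst pos_on_cong) (auto simp: f_the_inv_into_f_bij_betw[OF assms])
qed

lemma mult_mat_vec_cscalar:
  assumes "A \<in> carrier_mat n n" "v \<in> carrier_vec n" "u \<in> carrier_vec n"
  shows "(A *\<^sub>v v) \<bullet>c u = (\<Sum>a<n. \<Sum>b<n. A $$ (a, b) * v $ b * cnj (u $ a))"
  using assms by (auto simp: scalar_prod_def sum_distrib_right lessThan_atLeast0 intro!: sum.cong)

lemma psd_iff:
  "psd n A \<longleftrightarrow> A \<in> carrier_mat n n \<and> pos_on {..<n} (\<lambda>a b. A $$ (a, b))"
proof (cases "A \<in> carrier_mat n n")
  case True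
  have "pos_on {..<n} (\<lambda>a b. A $$ (a, b)) \<longleftrightarrow> (\<forall>v\<in>carrier_vec n. 0 \<le> (A *\<^sub>v v) \<bullet>c v)"
  proof -
    have "(\<forall>v\<in>carrier_vec n. 0 \<le> (A *\<^sub>v v) \<bullet>c v) \<longleftrightarrow>
      (\<forall>v\<in>carrier_vec n. 0 \<le> (\<Sum>a<n. \<Sum>b<n. A $$ (a, b) * v $ b * cnj (v $ a)))"
      using mult_mat_vec_cscalar[OF True] by auto
    also have "\<dots> \<longleftrightarrow> (\<forall>v. 0 \<le> (\<Sum>a<n. \<Sum>b<n. A $$ (a, b) * v b * cnj (v a)))"
    proof safe
      fix v :: "nat \<Rightarrow> complex"
      assume "\<forall>v\<in>carrier_vec n. 0 \<le> (\<Sum>a<n. \<Sum>b<n. A $$ (a, b) * v $ b * cnj (v $ a))"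
      from bspec[OF this, of "vec n v"]
      show "0 \<le> (\<Sum>a<n. \<Sum>b<n. A $$ (a, b) * v b * cnj (v a))" by simp
    next
      fix v :: "complex vec"
      assume "\<forall>v. 0 \<le> (\<Sum>a<n. \<Sum>b<n. A $$ (a, b) * v b * cnj (v a))"
      then show "0 \<le> (\<Sum>a<n. \<Sum>b<n. A $$ (a, b) * v $ b * cnj (v $ a))" by blast
    qed
    finally show ?thesis by (simp add: pos_on_finite_iff)
  qed
  then show ?thesis using True by (simp add: psd_def)
qed (simp add: psd_def)

lemma block_psd_iff:
  assumes K: "\<And>\<alpha> \<beta>. \<alpha> \<in> I \<Longrightarrow> \<beta> \<in> I \<Longrightarrow> K \<alpha> \<beta> \<in> carrier_mat N N"
  shows "block_psd I N K \<longleftrightarrow> pos_on (I \<times> {..<N}) (\<lambda>(\<alpha>, a) (\<beta>, b). K \<alpha> \<beta> $$ (a, b))"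
    (is "_ \<longleftrightarrow> pos_on _ ?M")
proof -
  have eq: "(\<Sum>\<alpha>\<in>F. \<Sum>\<beta>\<in>F. (K \<alpha> \<beta> *\<^sub>v v \<beta>) \<bullet>c v \<alpha>)
      = (\<Sum>s\<in>F \<times> {..<N}. \<Sum>t\<in>F \<times> {..<N}. ?M s t * (v (fst t) $ snd t) * cnj (v (fst s) $ snd s))"
    if F: "F \<subseteq> I" "\<forall>\<alpha>\<in>F. v \<alpha> \<in> carrier_vec N" for F v
  proof -
    have "(\<Sum>\<alpha>\<in>F. \<Sum>\<beta>\<in>F. (K \<alpha> \<beta> *\<^sub>v v \<beta>) \<bullet>c v \<alpha>)
      = (\<Sum>\<alpha>\<in>F. \<Sum>\<beta>\<in>F. \<Sum>a<N. \<Sum>b<N. K \<alpha> \<beta> $$ (a, b) * v \<beta> $ b * cnj (v \<alpha> $ a))"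
      using F by (intro sum.cong refl mult_mat_vec_cscalar K) auto
    also have "\<dots> = (\<Sum>\<alpha>\<in>F. \<Sum>a<N. \<Sum>\<beta>\<in>F. \<Sum>b<N. K \<alpha> \<beta> $$ (a, b) * v \<beta> $ b * cnj (v \<alpha> $ a))"
      by (intro sum.cong refl sum.swap)
    finally show ?thesis by (simp add: sum.cartesian_product')
  qed
  show ?thesis
  proof
    assume P: "block_psd I N K"
    show "pos_on (I \<times> {..<N}) ?M" unfolding pos_on_def
    proof (intro allI impI, elim conjE)
      fix F and v :: "'a \<times> nat \<Rightarrow> complex"
      assume F: "finite F" "F \<subseteq> I \<times> {..<N}"
      \<comment> \<open>\<open>F\<close> may contain only some coordinates of an index, whereas
        block vectors carry all of them; the missing ones are filled with zeros.\<close>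
      define G where "G = fst ` F"
      define u where "u \<alpha> = vec N (\<lambda>a. if (\<alpha>, a) \<in> F then v (\<alpha>, a) else 0)" for \<alpha>
      have G: "finite G" "G \<subseteq> I" "\<forall>\<alpha>\<in>G. u \<alpha> \<in> carrier_vec N"
        using F by (auto simp: G_def u_def)
      let ?w = "\<lambda>s. u (fst s) $ snd s"
      have "0 \<le> (\<Sum>s\<in>G \<times> {..<N}. \<Sum>t\<in>G \<times> {..<N}. ?M s t * ?w t * cnj (?w s))"
        unfolding eq[OF G(2,3), symmetric]
        by (rule P[unfolded block_psd_def, rule_format]) (use G in blast)
      also have "\<dots> = (\<Sum>s\<in>F. \<Sum>t\<in>G \<times> {..<N}. ?M s t * ?w t * cnj (?w s))"
        using F G by (intro sum.mono_neutral_right) (auto simp: u_def G_def intro: rev_image_eqI)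
      also have "\<dots> = (\<Sum>s\<in>F. \<Sum>t\<in>F. ?M s t * ?w t * cnj (?w s))"
        using F G by (intro sum.cong refl sum.mono_neutral_right) (auto simp: u_def G_def intro: rev_image_eqI)
      also have "\<dots> = (\<Sum>s\<in>F. \<Sum>t\<in>F. ?M s t * v t * cnj (v s))"
      proof -
        have "?w s = v s" if "s \<in> F" for s using F(2) that by (cases s) (auto simp: u_def)
        then show ?thesis by simp
      qed
      finally show "0 \<le> (\<Sum>s\<in>F. \<Sum>t\<in>F. ?M s t * v t * cnj (v s))" .
    qed
  next
    assume P: "pos_on (I \<times> {..<N}) ?M"
    show "block_psd I N K" unfolding block_psd_def
    proof (intro allI impI, elim conjE)
      fix F and v :: "'a \<Rightarrow> complex vec"
      assume F: "finite F" "F \<subseteq> I" "\<forall>\<alpha>\<in>F. v \<alpha> \<in> carrier_vec N"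
      show "0 \<le> (\<Sum>\<alpha>\<in>F. \<Sum>\<beta>\<in>F. (K \<alpha> \<beta> *\<^sub>v v \<beta>) \<bullet>c v \<alpha>)"
        unfolding eq[OF F(2,3)] by (rule pos_onD[OF P]) (use F in auto)
    qed
  qed
qed

section \<open>Scalar kernels of the moment conditions\<close>

text \<open>The moments enter as scalar functions rather than matrices, since the kernel is also
  formed from inner products (\<open>moments\<close>) and from averaged families
  (\<open>sym_family\<close>).\<close>

definition hankel_kernel ::
  "(ncword \<Rightarrow> nat \<Rightarrow> nat \<Rightarrow> complex) \<Rightarrow> ncword \<times> nat \<Rightarrow> ncword \<times> nat \<Rightarrow> complex" where
  "hankel_kernel y = (\<lambda>(\<alpha>, a) (\<beta>, b). y (rev \<alpha> @ \<beta>) a b)"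

definition loc_kernel ::
  "nat \<Rightarrow> ncmpoly \<Rightarrow> (ncword \<Rightarrow> nat \<Rightarrow> nat \<Rightarrow> complex) \<Rightarrow>
    ncword \<times> nat \<times> nat \<Rightarrow> ncword \<times> nat \<times> nat \<Rightarrow> complex" where
  "loc_kernel \<mu> p y = (\<lambda>(\<alpha>, i, a) (\<beta>, j, b).
     \<Sum>w\<in>msupp \<mu> \<mu> p. p w $$ (i, j) * y (rev \<alpha> @ w @ \<beta>) a b)"

abbreviation entries :: "(ncword \<Rightarrow> complex mat) \<Rightarrow> ncword \<Rightarrow> nat \<Rightarrow> nat \<Rightarrow> complex" where
  "entries Y \<equiv> \<lambda>w a b. Y w $$ (a, b)"

lemma block_psd_hankel_iff:
  assumes "\<And>\<alpha> \<beta>. \<alpha> \<in> I \<Longrightarrow> \<beta> \<in> I \<Longrightarrow> Y (rev \<alpha> @ \<beta>) \<in> carrier_mat n n"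
  shows "block_psd I n (hankel Y) \<longleftrightarrow> pos_on (I \<times> {..<n}) (hankel_kernel (entries Y))"
  using assms by (subst block_psd_iff) (auto simp: hankel_def hankel_kernel_def)

lemma block_psd_loc_hankel_iff:
  assumes Y: "\<And>\<alpha> \<beta> w. \<alpha> \<in> I \<Longrightarrow> \<beta> \<in> I \<Longrightarrow> w \<in> msupp \<mu> \<mu> p \<Longrightarrow> Y (rev \<alpha> @ w @ \<beta>) \<in> carrier_mat n n"
    and p: "is_ncmpoly g \<mu> \<mu> p"
  shows "block_psd I (\<mu> * n) (loc_hankel \<mu> p n Y) \<longleftrightarrow>
    pos_on (I \<times> {..<\<mu>} \<times> {..<n}) (loc_kernel \<mu> p (entries Y))"
proof -
  let ?f = "map_prod id (\<lambda>(i, a). i * n + a) :: ncword \<times> nat \<times> nat \<Rightarrow> ncword \<times> nat"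
  have "bij_betw ?f (I \<times> {..<\<mu>} \<times> {..<n}) (I \<times> {..<\<mu> * n})"
    by (intro bij_betw_map_prod bij_betw_mult_add bij_betw_id)
  note b = pos_on_bij[OF this]
  show ?thesis
  proof (subst block_psd_iff, force simp: loc_hankel_def, subst b, rule pos_on_cong)
    fix s t :: "ncword \<times> nat \<times> nat"
    assume s: "s \<in> I \<times> {..<\<mu>} \<times> {..<n}" and t: "t \<in> I \<times> {..<\<mu>} \<times> {..<n}"
    obtain \<alpha> i a \<beta> j b where st: "s = (\<alpha>, i, a)" "t = (\<beta>, j, b)" by (metis prod_cases3)
    show "(case ?f s of (\<alpha>, a) \<Rightarrow> \<lambda>(\<beta>, b). loc_hankel \<mu> p n Y \<alpha> \<beta> $$ (a, b)) (?f t)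
      = loc_kernel \<mu> p (entries Y) s t"
      using s t p Y unfolding st is_ncmpoly_def
      by (auto simp: loc_hankel_def loc_kernel_def mult_add_less intro!: sum.cong kron_index)
  qed
qed

lemma ncmdeg_ge:
  assumes "is_ncmpoly g \<mu> \<mu> p" "w \<in> msupp \<mu> \<mu> p"
  shows "length w \<le> ncmdeg \<mu> p"
  unfolding ncmdeg_def using assms by (intro Max_ge) (auto simp: is_ncmpoly_def)

lemma ncdeg_ge:
  assumes "is_ncpoly g q" "w \<in> supp q"
  shows "length w \<le> ncdeg q"
  unfolding ncdeg_def using assms by (intro Max_ge) (auto simp: is_ncpoly_def)

lemma moment_families_carrier:
  "Y \<in> moment_families g \<Gamma> n I \<Longrightarrow> w \<in> I \<Longrightarrow> Y w \<in> carrier_mat n n"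
  by (auto simp: moment_families_def)

lemma words_upto_hankel:
  assumes "\<alpha> \<in> words_upto g (d + nat \<lceil>real e / 2\<rceil>)" "\<beta> \<in> words_upto g (d + nat \<lceil>real e / 2\<rceil>)"
  shows "rev \<alpha> @ \<beta> \<in> words_upto g (2 * d + e + 1)"
proof -
  \<comment> \<open>For odd \<open>e\<close> the half degree is rounded up, which accounts for the
    final \<open>+ 1\<close> in the length of the words.\<close>
  have "2 * nat \<lceil>real e / 2\<rceil> \<le> e + 1" by linarith
  then show ?thesis using assms by (auto simp: words_upto_def)
qed

lemma words_upto_loc:
  assumes "is_ncmpoly g \<mu> \<mu> p"
    "\<alpha> \<in> words_upto g d" "\<beta> \<in> words_upto g d" "w \<in> msupp \<mu> \<mu> p"
  shows "rev \<alpha> @ w @ \<beta> \<in> words_upto g (2 * d + ncmdeg \<mu> p + 1)"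
  using assms ncmdeg_ge[OF assms(1,4)] by (auto simp: words_upto_def is_ncmpoly_def)

lemma L_inf_iff:
  assumes p: "is_ncmpoly g \<mu> \<mu> p"
  shows "Y \<in> L_inf g \<Gamma> \<mu> p n \<longleftrightarrow> Y \<in> moment_families g \<Gamma> n (words g) \<and>
    pos_on (words g \<times> {..<n}) (hankel_kernel (entries Y)) \<and>
    pos_on (words g \<times> {..<\<mu>} \<times> {..<n}) (loc_kernel \<mu> p (entries Y))"
proof (cases "Y \<in> moment_families g \<Gamma> n (words g)")
  case True
  note c = moment_families_carrier[OF True]
  have 1: "block_psd (words g) n (hankel Y) \<longleftrightarrow>
    pos_on (words g \<times> {..<n}) (hankel_kernel (entries Y))"
    by (rule block_psd_hankel_iff) (simp add: c)
  have 2: "block_psd (words g) (\<mu> * n) (loc_hankel \<mu> p n Y) \<longleftrightarrow>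
    pos_on (words g \<times> {..<\<mu>} \<times> {..<n}) (loc_kernel \<mu> p (entries Y))"
    by (rule block_psd_loc_hankel_iff[OF _ p]) (use p c in \<open>auto simp: is_ncmpoly_def\<close>)
  show ?thesis using True by (simp add: L_inf_def 1 2)
qed (simp add: L_inf_def)

lemma L_fin_iff:
  assumes p: "is_ncmpoly g \<mu> \<mu> p"
  shows "Y \<in> L_fin g \<Gamma> \<mu> p n d \<longleftrightarrow>
    Y \<in> moment_families g \<Gamma> n (words_upto g (2 * d + ncmdeg \<mu> p + 1)) \<and>
    pos_on (words_upto g (d + nat \<lceil>real (ncmdeg \<mu> p) / 2\<rceil>) \<times> {..<n}) (hankel_kernel (entries Y)) \<and>
    pos_on (words_upto g d \<times> {..<\<mu>} \<times> {..<n}) (loc_kernel \<mu> p (entries Y))"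
proof (cases "Y \<in> moment_families g \<Gamma> n (words_upto g (2 * d + ncmdeg \<mu> p + 1))")
  case True
  note c = moment_families_carrier[OF True]
  have 1: "block_psd (words_upto g (d + nat \<lceil>real (ncmdeg \<mu> p) / 2\<rceil>)) n (hankel Y) \<longleftrightarrow>
    pos_on (words_upto g (d + nat \<lceil>real (ncmdeg \<mu> p) / 2\<rceil>) \<times> {..<n}) (hankel_kernel (entries Y))"
    by (rule block_psd_hankel_iff) (rule c[OF words_upto_hankel])
  have 2: "block_psd (words_upto g d) (\<mu> * n) (loc_hankel \<mu> p n Y) \<longleftrightarrow>
    pos_on (words_upto g d \<times> {..<\<mu>} \<times> {..<n}) (loc_kernel \<mu> p (entries Y))"
    by (rule block_psd_loc_hankel_iff[OF _ p]) (rule c[OF words_upto_loc[OF p]])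
  show ?thesis using True by (simp add: L_fin_def 1 2)
qed (simp add: L_fin_def)

lemma moment_families_restrict:
  assumes Y: "Y \<in> moment_families g \<Gamma> n I" and "J \<subseteq> I" and rev: "\<And>\<alpha>. \<alpha> \<in> J \<Longrightarrow> rev \<alpha> \<in> J"
    and nil: "[] \<in> J" and var: "\<And>i. i < g \<Longrightarrow> [i] \<in> J"
    and supp: "\<And>\<gamma>. \<gamma> \<in> set \<Gamma> \<Longrightarrow> supp \<gamma> \<subseteq> J"
  shows "restrict Y J \<in> moment_families g \<Gamma> n J" "hat g (restrict Y J) = hat g Y"
proof -
  show h: "hat g (restrict Y J) = hat g Y" using var by (simp add: hat_def)
  have "msum n n (\<lambda>m. \<gamma> m \<cdot>\<^sub>m restrict Y J m) (supp \<gamma>) = msum n n (\<lambda>m. \<gamma> m \<cdot>\<^sub>m Y m) (supp \<gamma>)"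
    if "\<gamma> \<in> set \<Gamma>" for \<gamma>
    unfolding msum_def using supp[OF that] by (intro cong_mat refl sum.cong) auto
  with Y h show "restrict Y J \<in> moment_families g \<Gamma> n J"
    using assms(2) rev nil by (auto simp: moment_families_def)
qed

lemma hankel_kernel_cong:
  assumes "\<And>\<alpha> \<beta>. \<alpha> \<in> I \<Longrightarrow> \<beta> \<in> I \<Longrightarrow> y (rev \<alpha> @ \<beta>) = y' (rev \<alpha> @ \<beta>)"
  shows "pos_on (I \<times> A) (hankel_kernel y) = pos_on (I \<times> A) (hankel_kernel y')"
  using assms by (intro pos_on_cong) (auto simp: hankel_kernel_def)

lemma loc_kernel_cong:
  assumes "\<And>\<alpha> \<beta> w. \<alpha> \<in> I \<Longrightarrow> \<beta> \<in> I \<Longrightarrow> w \<in> msupp \<mu> \<mu> p \<Longrightarrow> y (rev \<alpha> @ w @ \<beta>) = y' (rev \<alpha> @ w @ \<beta>)"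
  shows "pos_on (I \<times> A) (loc_kernel \<mu> p y) = pos_on (I \<times> A) (loc_kernel \<mu> p y')"
  using assms by (intro pos_on_cong) (auto simp: loc_kernel_def)

text \<open>Common to the truncation of a full family and to lowering the level of a finite one; the
  two differ only in \<open>I\<close>. The degree bound keeps the supports of the polynomials in
  \<Gamma> inside the smaller index set, so that (M) survives the restriction.\<close>

lemma L_fin_restrict:
  assumes p: "is_ncmpoly g \<mu> \<mu> p" and \<Gamma>: "\<And>\<gamma>. \<gamma> \<in> set \<Gamma> \<Longrightarrow> is_ncpoly g \<gamma> \<and> ncdeg \<gamma> \<le> d"
    and Y: "Y \<in> moment_families g \<Gamma> n I"
    and I: "words_upto g (2 * d + ncmdeg \<mu> p + 1) \<subseteq> I"
    and "pos_on (words_upto g (d + nat \<lceil>real (ncmdeg \<mu> p) / 2\<rceil>) \<times> {..<n}) (hankel_kernel (entries Y))"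
    and "pos_on (words_upto g d \<times> {..<\<mu>} \<times> {..<n}) (loc_kernel \<mu> p (entries Y))"
  shows "hat g Y \<in> L_fin_hat g \<Gamma> \<mu> p n d"
proof -
  let ?J = "words_upto g (2 * d + ncmdeg \<mu> p + 1)"
  let ?Z = "restrict Y ?J"
  have "supp \<gamma> \<subseteq> ?J" if "\<gamma> \<in> set \<Gamma>" for \<gamma>
    using \<Gamma>[OF that] ncdeg_ge[of g \<gamma>] by (fastforce simp: words_upto_def is_ncpoly_def)
  then have Z: "?Z \<in> moment_families g \<Gamma> n ?J" "hat g ?Z = hat g Y"
    using moment_families_restrict[OF Y I] by (auto simp: words_upto_def)
  have "?Z \<in> L_fin g \<Gamma> \<mu> p n d"
    unfolding L_fin_iff[OF p]
    using Z(1) assms(5,6) words_upto_hankel[of _ g d "ncmdeg \<mu> p"] words_upto_loc[OF p, of _ d]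
    by (subst hankel_kernel_cong[where y' = "entries Y"], simp,
        subst loc_kernel_cong[where y' = "entries Y"]) simp_all
  then show ?thesis using Z(2) unfolding L_fin_hat_def by (metis imageI)
qed

lemma L_inf_hat_subset_L_fin_hat:
  assumes p: "is_ncmpoly g \<mu> \<mu> p" and \<Gamma>: "\<And>\<gamma>. \<gamma> \<in> set \<Gamma> \<Longrightarrow> is_ncpoly g \<gamma> \<and> ncdeg \<gamma> \<le> d"
  shows "L_inf_hat g \<Gamma> \<mu> p n \<subseteq> L_fin_hat g \<Gamma> \<mu> p n d"
proof
  fix X assume "X \<in> L_inf_hat g \<Gamma> \<mu> p n"
  then obtain Y where Y: "X = hat g Y" "Y \<in> L_inf g \<Gamma> \<mu> p n" by (auto simp: L_inf_hat_def)
  note Y2 = Y(2)[unfolded L_inf_iff[OF p]]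
  show "X \<in> L_fin_hat g \<Gamma> \<mu> p n d"
    unfolding Y(1)
    by (rule L_fin_restrict[OF p \<Gamma> conjunct1[OF Y2] words_upto_subset
          pos_on_subset[OF conjunct1[OF conjunct2[OF Y2]]] pos_on_subset[OF conjunct2[OF conjunct2[OF Y2]]]])
      (use words_upto_subset in \<open>auto intro!: Sigma_mono\<close>)
qed

lemma L_fin_hat_antimono:
  assumes p: "is_ncmpoly g \<mu> \<mu> p" and \<Gamma>: "\<And>\<gamma>. \<gamma> \<in> set \<Gamma> \<Longrightarrow> is_ncpoly g \<gamma> \<and> ncdeg \<gamma> \<le> d"
    and "d \<le> d'"
  shows "L_fin_hat g \<Gamma> \<mu> p n d' \<subseteq> L_fin_hat g \<Gamma> \<mu> p n d"
proof
  fix X assume "X \<in> L_fin_hat g \<Gamma> \<mu> p n d'"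
  then obtain Y where Y: "X = hat g Y" "Y \<in> L_fin g \<Gamma> \<mu> p n d'" by (auto simp: L_fin_hat_def)
  note Y2 = Y(2)[unfolded L_fin_iff[OF p]]
  show "X \<in> L_fin_hat g \<Gamma> \<mu> p n d"
    unfolding Y(1)
    by (rule L_fin_restrict[OF p \<Gamma> conjunct1[OF Y2] _
          pos_on_subset[OF conjunct1[OF conjunct2[OF Y2]]] pos_on_subset[OF conjunct2[OF conjunct2[OF Y2]]]])
      (use assms(3) in \<open>auto simp: words_upto_def\<close>)
qed

section \<open>Moments of operator tuples\<close>

locale sa_tuple = pre_hilbert H for H :: "('h, 'z) hilb_scheme" (structure) +
  fixes Y :: "('h \<Rightarrow> 'h) list" and g :: nat
  assumes len: "length Y = g" and sa: "set Y \<subseteq> bounded_sa_ops H"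
begin

lemma nth_sa: "i < g \<Longrightarrow> Y ! i \<in> bounded_sa_ops H"
  using sa len by auto

lemma op_closed: "i < g \<Longrightarrow> x \<in> carrier H \<Longrightarrow> (Y ! i) x \<in> carrier H"
  using nth_sa[of i] by (auto simp: bounded_sa_ops_def module_hom_def)

lemma op_add:
  "i < g \<Longrightarrow> x \<in> carrier H \<Longrightarrow> y \<in> carrier H \<Longrightarrow> (Y ! i) (x \<oplus> y) = (Y ! i) x \<oplus> (Y ! i) y"
  using nth_sa[of i] by (auto simp: bounded_sa_ops_def module_hom_def)

lemma op_smult: "i < g \<Longrightarrow> x \<in> carrier H \<Longrightarrow> (Y ! i) (c \<odot> x) = c \<odot> (Y ! i) x"
  using nth_sa[of i] by (auto simp: bounded_sa_ops_def module_hom_def)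

lemma op_symmetric:
  "i < g \<Longrightarrow> x \<in> carrier H \<Longrightarrow> y \<in> carrier H \<Longrightarrow> ip H ((Y ! i) x) y = ip H x ((Y ! i) y)"
  using nth_sa[of i] by (auto simp: bounded_sa_ops_def)

lemma word_op_Nil [simp]: "word_op Y [] x = x"
  by (simp add: word_op_def)

lemma word_op_Cons [simp]: "word_op Y (i # w) x = (Y ! i) (word_op Y w x)"
  by (simp add: word_op_def)

lemma word_op_append: "word_op Y (u @ w) x = word_op Y u (word_op Y w x)"
  by (induction u) simp_all

lemma word_op_closed: "w \<in> words g \<Longrightarrow> x \<in> carrier H \<Longrightarrow> word_op Y w x \<in> carrier H"
  by (induction w) (auto intro: op_closed)

lemma word_op_add:
  "w \<in> words g \<Longrightarrow> x \<in> carrier H \<Longrightarrow> y \<in> carrier H \<Longrightarrow>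
    word_op Y w (x \<oplus> y) = word_op Y w x \<oplus> word_op Y w y"
  by (induction w) (auto simp: op_add word_op_closed)

lemma word_op_smult:
  "w \<in> words g \<Longrightarrow> x \<in> carrier H \<Longrightarrow> word_op Y w (c \<odot> x) = c \<odot> word_op Y w x"
  by (induction w) (auto simp: op_smult word_op_closed)

lemma word_op_symmetric:
  "w \<in> words g \<Longrightarrow> x \<in> carrier H \<Longrightarrow> y \<in> carrier H \<Longrightarrow>
    ip H (word_op Y w x) y = ip H x (word_op Y (rev w) y)"
  by (induction w arbitrary: y) (auto simp: op_symmetric op_closed word_op_closed word_op_append)

lemma word_op_zero: "w \<in> words g \<Longrightarrow> word_op Y w \<zero> = \<zero>"
  using word_op_add[of w "\<zero>" "\<zero>"] word_op_closed[of w "\<zero>"]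
  by (metis M.add.l_cancel_one M.l_zero M.zero_closed)

lemma word_op_finsum:
  assumes w: "w \<in> words g" and f: "f \<in> A \<rightarrow> carrier H"
  shows "word_op Y w (finsum H f A) = finsum H (\<lambda>a. word_op Y w (f a)) A"
  using f
proof (induction A rule: infinite_finite_induct)
  case (insert a A)
  then have c: "finsum H f A \<in> carrier H" by (intro M.finsum_closed) auto
  have "(\<lambda>a. word_op Y w (f a)) \<in> A \<rightarrow> carrier H" using insert w by (auto intro: word_op_closed)
  then show ?case using insert w c by (simp add: word_op_add word_op_closed)
qed (simp_all add: M.finsum_infinite word_op_zero w)

lemma eval_op_closed:
  assumes "supp q \<subseteq> words g" "x \<in> carrier H"
  shows "eval_op H Y q x \<in> carrier H"
  unfolding eval_op_def using assms
  by (intro M.finsum_closed) (auto intro!: smult_closed word_op_closed)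

lemma ip_eval_op:
  assumes "supp q \<subseteq> words g" "x \<in> carrier H" "z \<in> carrier H"
  shows "ip H (eval_op H Y q x) z = (\<Sum>w\<in>supp q. q w * ip H (word_op Y w x) z)"
proof -
  have c: "word_op Y w x \<in> carrier H" if "w \<in> supp q" for w
    using that assms by (intro word_op_closed) auto
  have "(\<lambda>w. q w \<odot> word_op Y w x) \<in> supp q \<rightarrow> carrier H"
    using c by (auto intro!: smult_closed)
  then show ?thesis
    unfolding eval_op_def using assms(3) c by (subst ip_finsum) (auto simp: ip_smult intro!: sum.cong)
qed

lemma ip_eval_mop:
  assumes p: "is_ncmpoly g \<mu> \<mu> p" and \<xi>: "\<xi> \<in> {..<\<mu>} \<rightarrow> carrier H" and z: "z \<in> carrier H"
    and "i < \<mu>"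
  shows "ip H (eval_mop H \<mu> Y p \<xi> i) z =
    (\<Sum>j<\<mu>. \<Sum>w\<in>msupp \<mu> \<mu> p. p w $$ (i, j) * ip H (word_op Y w (\<xi> j)) z)"
proof -
  have s: "supp (\<lambda>w. p w $$ (i, j)) \<subseteq> msupp \<mu> \<mu> p" if "j < \<mu>" for j
    using that \<open>i < \<mu>\<close> by (auto simp: supp_def msupp_def)
  have m: "msupp \<mu> \<mu> p \<subseteq> words g" "finite (msupp \<mu> \<mu> p)" using p by (auto simp: is_ncmpoly_def)
  have c: "(\<lambda>b. eval_op H Y (\<lambda>w. p w $$ (i, b)) (\<xi> b)) \<in> {..<\<mu>} \<rightarrow> carrier H"
    using s m \<xi> by (auto intro!: eval_op_closed)
  have "ip H (eval_mop H \<mu> Y p \<xi> i) z = (\<Sum>j<\<mu>. ip H (eval_op H Y (\<lambda>w. p w $$ (i, j)) (\<xi> j)) z)"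
    unfolding eval_mop_def by (rule ip_finsum[OF c z])
  also have "\<dots> = (\<Sum>j<\<mu>. \<Sum>w\<in>supp (\<lambda>w. p w $$ (i, j)). p w $$ (i, j) * ip H (word_op Y w (\<xi> j)) z)"
    using s m \<xi> z by (intro sum.cong refl ip_eval_op) auto
  also have "\<dots> = (\<Sum>j<\<mu>. \<Sum>w\<in>msupp \<mu> \<mu> p. p w $$ (i, j) * ip H (word_op Y w (\<xi> j)) z)"
    using s m by (intro sum.cong refl sum.mono_neutral_left) (auto simp: supp_def)
  finally show ?thesis .
qed

text \<open>For \<open>u a = V (unit_vec n a)\<close> these are the entries of the compression of
  the word \<open>w\<close> in \<open>Y\<close>, with \<open>a\<close> and \<open>b\<close> ordered
  as in \<open>compress\<close>. In \<open>GNS\<close> the \<open>u a\<close> are the vectors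
  attached to the empty word.\<close>

definition moments :: "(nat \<Rightarrow> 'h) \<Rightarrow> ncword \<Rightarrow> nat \<Rightarrow> nat \<Rightarrow> complex" where
  "moments u w a b = ip H (word_op Y w (u b)) (u a)"

text \<open>Self-adjointness carries the reversed word to the other side of the inner product; this
  makes the Hankel kernel a Gram kernel and relates the localizing kernel to the form of
  \<open>p(Y)\<close>.\<close>

lemma moments_append:
  assumes "\<alpha> \<in> words g" "w \<in> words g" "u a \<in> carrier H" "u b \<in> carrier H"
  shows "moments u (rev \<alpha> @ w) a b = ip H (word_op Y w (u b)) (word_op Y \<alpha> (u a))"
  using assms by (simp add: moments_def word_op_append word_op_symmetric word_op_closed)

lemma moments_rev:
  assumes "w \<in> words g" "u a \<in> carrier H" "u b \<in> carrier H"
  shows "moments u (rev w) a b = cnj (moments u w b a)"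
  using assms ip_cnj[of "word_op Y w (u a)" "u b"]
  by (simp add: moments_def word_op_symmetric word_op_closed)

lemma pos_on_moments:
  assumes u: "\<And>a. a < n \<Longrightarrow> u a \<in> carrier H"
  shows "pos_on (words g \<times> {..<n}) (hankel_kernel (moments u))"
  unfolding pos_on_def
proof (intro allI impI, elim conjE)
  fix F and v :: "ncword \<times> nat \<Rightarrow> complex"
  assume F: "finite F" "F \<subseteq> words g \<times> {..<n}"
  define e where "e t = word_op Y (fst t) (u (snd t))" for t
  have e: "e t \<in> carrier H" if "t \<in> F" for t
    using that F u by (auto simp: e_def intro!: word_op_closed)
  have c: "(\<lambda>t. v t \<odot> e t) \<in> F \<rightarrow> carrier H" using e by (auto intro!: smult_closed)
  let ?x = "finsum H (\<lambda>t. v t \<odot> e t) F"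
  have x: "?x \<in> carrier H" using c by (rule M.finsum_closed)
  have "ip H ?x ?x = (\<Sum>s\<in>F. \<Sum>t\<in>F. v t * cnj (v s) * ip H (e t) (e s))"
    using c x e by (simp add: ip_finsum_right ip_finsum ip_smult ip_smult_right sum_distrib_left mult_ac)
  also have "\<dots> = (\<Sum>s\<in>F. \<Sum>t\<in>F. hankel_kernel (moments u) s t * v t * cnj (v s))"
  proof (intro sum.cong refl)
    fix s t assume "s \<in> F" "t \<in> F"
    then have "moments u (rev (fst s) @ fst t) (snd s) (snd t) = ip H (e t) (e s)"
      unfolding e_def using F u by (intro moments_append) auto
    then show "v t * cnj (v s) * ip H (e t) (e s) = hankel_kernel (moments u) s t * v t * cnj (v s)"
      by (simp add: hankel_kernel_def case_prod_unfold)
  qed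
  finally show "0 \<le> (\<Sum>s\<in>F. \<Sum>t\<in>F. hankel_kernel (moments u) s t * v t * cnj (v s))"
    using ip_nonneg[OF x] by simp
qed

text \<open>Used in both directions: positivity of \<open>p(Y)\<close> gives a positive localizing
  kernel (\<open>pos_on_loc_moments\<close>), and in \<open>GNS\<close> a positive localizing kernel
  gives positivity of the form on combinations of words applied to the \<open>u a\<close>. Component
  \<open>j\<close> of \<xi> collects the coefficients with row index \<open>j\<close>.\<close>

lemma mop_form_eq:
  fixes v :: "ncword \<times> nat \<times> nat \<Rightarrow> complex"
  assumes u: "\<And>a. a < n \<Longrightarrow> u a \<in> carrier H" and p: "is_ncmpoly g \<mu> \<mu> p"
    and F: "finite F" "F \<subseteq> words g \<times> {..<\<mu>} \<times> {..<n}"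
  defines "\<xi> \<equiv> \<lambda>j. finsum H (\<lambda>t. (if fst (snd t) = j then v t else 0) \<odot> word_op Y (fst t) (u (snd (snd t)))) F"
  shows "(\<Sum>i<\<mu>. ip H (eval_mop H \<mu> Y p \<xi> i) (\<xi> i)) =
    (\<Sum>s\<in>F. \<Sum>t\<in>F. loc_kernel \<mu> p (moments u) s t * v t * cnj (v s))"
    and "\<xi> j \<in> carrier H"
proof -
  define e where "e t = word_op Y (fst t) (u (snd (snd t)))" for t :: "ncword \<times> nat \<times> nat"
  have e: "e t \<in> carrier H" if "t \<in> F" for t
    using that F u by (auto simp: e_def intro!: word_op_closed)
  let ?c = "\<lambda>j t. if fst (snd t) = j then v t else 0"
  have \<xi>: "\<xi> j = finsum H (\<lambda>t. ?c j t \<odot> e t) F" for j by (simp add: \<xi>_def e_def)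
  have c: "(\<lambda>t. ?c j t \<odot> e t) \<in> F \<rightarrow> carrier H" for j using e by (auto intro!: smult_closed)
  show x: "\<xi> j \<in> carrier H" for j unfolding \<xi> using c by (rule M.finsum_closed)
  have m: "msupp \<mu> \<mu> p \<subseteq> words g" using p by (auto simp: is_ncmpoly_def)
  let ?g = "\<lambda>i j s t w. p w $$ (i, j) * ?c j t * cnj (?c i s) * ip H (word_op Y w (e t)) (e s)"
  have W: "ip H (word_op Y w (\<xi> j)) (\<xi> i)
      = (\<Sum>s\<in>F. \<Sum>t\<in>F. ?c j t * cnj (?c i s) * ip H (word_op Y w (e t)) (e s))"
    if w: "w \<in> words g" for w i j
  proof -
    have "word_op Y w (\<xi> j) = finsum H (\<lambda>t. word_op Y w (?c j t \<odot> e t)) F"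
      unfolding \<xi> by (rule word_op_finsum[OF w c])
    also have "\<dots> = finsum H (\<lambda>t. ?c j t \<odot> word_op Y w (e t)) F"
      using e w by (intro M.finsum_cong') (auto simp: word_op_smult word_op_closed intro!: smult_closed)
    finally have 1: "word_op Y w (\<xi> j) = finsum H (\<lambda>t. ?c j t \<odot> word_op Y w (e t)) F" .
    have c': "(\<lambda>t. ?c j t \<odot> word_op Y w (e t)) \<in> F \<rightarrow> carrier H"
      using e w by (auto intro!: smult_closed word_op_closed)
    have 2: "ip H (word_op Y w (\<xi> j)) (e s) = (\<Sum>t\<in>F. ?c j t * ip H (word_op Y w (e t)) (e s))" if "s \<in> F" for s
      unfolding 1 using e w that by (subst ip_finsum[OF c']) (auto simp: ip_smult word_op_closed intro!: sum.cong)
    have "ip H (word_op Y w (\<xi> j)) (\<xi> i) = (\<Sum>s\<in>F. ip H (word_op Y w (\<xi> j)) (?c i s \<odot> e s))"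
      unfolding \<xi>[of i] by (rule ip_finsum_right[OF c word_op_closed[OF w x]])
    also have "\<dots> = (\<Sum>s\<in>F. cnj (?c i s) * ip H (word_op Y w (\<xi> j)) (e s))"
      using e w x by (intro sum.cong refl ip_smult_right word_op_closed) auto
    also have "\<dots> = (\<Sum>s\<in>F. \<Sum>t\<in>F. ?c j t * cnj (?c i s) * ip H (word_op Y w (e t)) (e s))"
      using 2 by (intro sum.cong refl) (simp add: sum_distrib_left mult_ac)
    finally show ?thesis .
  qed
  have "(\<Sum>i<\<mu>. ip H (eval_mop H \<mu> Y p \<xi> i) (\<xi> i))
    = (\<Sum>i<\<mu>. \<Sum>j<\<mu>. \<Sum>w\<in>msupp \<mu> \<mu> p. p w $$ (i, j) *
        (\<Sum>s\<in>F. \<Sum>t\<in>F. ?c j t * cnj (?c i s) * ip H (word_op Y w (e t)) (e s)))"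
    using x m by (intro sum.cong refl) (auto simp: ip_eval_mop[OF p] W subset_iff intro!: sum.cong)
  also have "\<dots> = (\<Sum>i<\<mu>. \<Sum>j<\<mu>. \<Sum>w\<in>msupp \<mu> \<mu> p. \<Sum>s\<in>F. \<Sum>t\<in>F. ?g i j s t w)"
    by (simp add: sum_distrib_left mult.assoc)
  \<comment> \<open>The next equalities only exchange sums, until \<open>s\<close> and
    \<open>t\<close> stand in front.\<close>
  also have "\<dots> = (\<Sum>i<\<mu>. \<Sum>j<\<mu>. \<Sum>s\<in>F. \<Sum>w\<in>msupp \<mu> \<mu> p. \<Sum>t\<in>F. ?g i j s t w)"
    by (intro sum.cong refl sum.swap)
  also have "\<dots> = (\<Sum>i<\<mu>. \<Sum>j<\<mu>. \<Sum>s\<in>F. \<Sum>t\<in>F. \<Sum>w\<in>msupp \<mu> \<mu> p. ?g i j s t w)"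
    by (intro sum.cong refl sum.swap)
  also have "\<dots> = (\<Sum>i<\<mu>. \<Sum>s\<in>F. \<Sum>j<\<mu>. \<Sum>t\<in>F. \<Sum>w\<in>msupp \<mu> \<mu> p. ?g i j s t w)"
    by (intro sum.cong refl sum.swap)
  also have "\<dots> = (\<Sum>i<\<mu>. \<Sum>s\<in>F. \<Sum>t\<in>F. \<Sum>j<\<mu>. \<Sum>w\<in>msupp \<mu> \<mu> p. ?g i j s t w)"
    by (intro sum.cong refl sum.swap)
  also have "\<dots> = (\<Sum>s\<in>F. \<Sum>i<\<mu>. \<Sum>t\<in>F. \<Sum>j<\<mu>. \<Sum>w\<in>msupp \<mu> \<mu> p. ?g i j s t w)"
    by (rule sum.swap)
  also have "\<dots> = (\<Sum>s\<in>F. \<Sum>t\<in>F. \<Sum>i<\<mu>. \<Sum>j<\<mu>. \<Sum>w\<in>msupp \<mu> \<mu> p. ?g i j s t w)"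
    by (intro sum.cong refl sum.swap)
  also have "\<dots> = (\<Sum>s\<in>F. \<Sum>t\<in>F. loc_kernel \<mu> p (moments u) s t * v t * cnj (v s))"
  proof (intro sum.cong refl)
    fix s t assume st: "s \<in> F" "t \<in> F"
    define i0 where "i0 = fst (snd s)"
    define j0 where "j0 = fst (snd t)"
    have ij: "i0 < \<mu>" "j0 < \<mu>" using st F by (auto simp: i0_def j0_def)
    \<comment> \<open>The coefficients vanish unless \<open>i\<close> and \<open>j\<close> are the
      row indices carried by \<open>s\<close> and \<open>t\<close>, so these two sums
      collapse.\<close>
    have "(\<Sum>i<\<mu>. \<Sum>j<\<mu>. \<Sum>w\<in>msupp \<mu> \<mu> p. ?g i j s t w)
      = (\<Sum>i<\<mu>. if i0 = i then (\<Sum>j<\<mu>. if j0 = j then (\<Sum>w\<in>msupp \<mu> \<mu> p.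
        p w $$ (i, j) * v t * cnj (v s) * ip H (word_op Y w (e t)) (e s)) else 0) else 0)"
    proof -
      have "(\<Sum>w\<in>msupp \<mu> \<mu> p. p w $$ (i, j) * ?c j t * cnj (?c i s) * ip H (word_op Y w (e t)) (e s))
        = (if i0 = i then if j0 = j then (\<Sum>w\<in>msupp \<mu> \<mu> p.
        p w $$ (i, j) * v t * cnj (v s) * ip H (word_op Y w (e t)) (e s)) else 0 else 0)" for i j
        by (simp add: i0_def j0_def)
      then show ?thesis by (intro sum.cong refl) simp
    qed
    also have "\<dots> = (\<Sum>w\<in>msupp \<mu> \<mu> p. p w $$ (i0, j0) * v t * cnj (v s) * ip H (word_op Y w (e t)) (e s))"
      using ij by simp
    also have "\<dots> = (\<Sum>w\<in>msupp \<mu> \<mu> p. p w $$ (i0, j0) * moments u (rev (fst s) @ w @ fst t) (snd (snd s)) (snd (snd t)) * v t * cnj (v s))"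
    proof (intro sum.cong refl)
      fix w assume w: "w \<in> msupp \<mu> \<mu> p"
      have "moments u (rev (fst s) @ (w @ fst t)) (snd (snd s)) (snd (snd t))
         = ip H (word_op Y (w @ fst t) (u (snd (snd t)))) (word_op Y (fst s) (u (snd (snd s))))"
        using st F u m w by (intro moments_append) auto
      then show "p w $$ (i0, j0) * v t * cnj (v s) * ip H (word_op Y w (e t)) (e s)
        = p w $$ (i0, j0) * moments u (rev (fst s) @ w @ fst t) (snd (snd s)) (snd (snd t)) * v t * cnj (v s)"
        by (simp add: e_def word_op_append)
    qed
    also have "\<dots> = loc_kernel \<mu> p (moments u) s t * v t * cnj (v s)"
      by (simp add: loc_kernel_def case_prod_unfold i0_def j0_def sum_distrib_right)
    finally show "(\<Sum>i<\<mu>. \<Sum>j<\<mu>. \<Sum>w\<in>msupp \<mu> \<mu> p. ?g i j s t w)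
      = loc_kernel \<mu> p (moments u) s t * v t * cnj (v s)" .
  qed
  finally show "(\<Sum>i<\<mu>. ip H (eval_mop H \<mu> Y p \<xi> i) (\<xi> i)) =
    (\<Sum>s\<in>F. \<Sum>t\<in>F. loc_kernel \<mu> p (moments u) s t * v t * cnj (v s))" .
qed

lemma pos_on_loc_moments:
  assumes u: "\<And>a. a < n \<Longrightarrow> u a \<in> carrier H" and p: "is_ncmpoly g \<mu> \<mu> p"
    and pos: "\<And>\<xi>. \<xi> \<in> {..<\<mu>} \<rightarrow> carrier H \<Longrightarrow> 0 \<le> (\<Sum>a<\<mu>. ip H (eval_mop H \<mu> Y p \<xi> a) (\<xi> a))"
  shows "pos_on (words g \<times> {..<\<mu>} \<times> {..<n}) (loc_kernel \<mu> p (moments u))"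
  unfolding pos_on_def
proof (intro allI impI, elim conjE)
  fix F and v :: "ncword \<times> nat \<times> nat \<Rightarrow> complex"
  assume F: "finite F" "F \<subseteq> words g \<times> {..<\<mu>} \<times> {..<n}"
  define \<xi> where "\<xi> = (\<lambda>j. finsum H (\<lambda>t. (if fst (snd t) = j then v t else 0) \<odot>
    word_op Y (fst t) (u (snd (snd t)))) F)"
  note e = mop_form_eq[where n = n and u = u and v = v, OF u p F]
  have "0 \<le> (\<Sum>i<\<mu>. ip H (eval_mop H \<mu> Y p \<xi> i) (\<xi> i))"
    by (rule pos) (use e(2) in \<open>auto simp: \<xi>_def\<close>)
  then show "0 \<le> (\<Sum>s\<in>F. \<Sum>t\<in>F. loc_kernel \<mu> p (moments u) s t * v t * cnj (v s))"
    using e(1) by (simp add: \<xi>_def)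
qed

end

lemma Gamma_conv_subset_L_inf_hat:
  assumes p: "is_ncmpoly g \<mu> \<mu> p" and \<Gamma>: "\<And>\<gamma>. \<gamma> \<in> set \<Gamma> \<Longrightarrow> is_ncpoly g \<gamma>"
  shows "Gamma_conv g \<Gamma> \<mu> p n \<subseteq> L_inf_hat g \<Gamma> \<mu> p n"
proof
  fix X assume "X \<in> Gamma_conv g \<Gamma> \<mu> p n"
  then obtain H :: "(nat \<Rightarrow> complex) hilb" and Y V where
    X: "X \<in> sa_tuples g n" and H: "separable_hilbert_space H" and Y: "Y \<in> pos_dom g \<mu> p H"
    and V: "isometry n H V" and XY: "X = map (compress H n V) Y"
    and com: "\<And>\<gamma>. \<gamma> \<in> set \<Gamma> \<Longrightarrow> compress H n V (eval_op H Y \<gamma>) = eval_mat n (map (compress H n V) Y) \<gamma>"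
    unfolding Gamma_conv_def by blast
  interpret hilbert_space H using H by (simp add: separable_hilbert_space_def)
  interpret sa_tuple H Y g
    using Y by unfold_locales (auto simp: pos_dom_def)
  define u where "u a = V (unit_vec n a)" for a
  have u: "u a \<in> carrier H" for a
    using V by (auto simp: u_def isometry_def module_hom_def module_vec_simps)
  define Z where "Z = (\<lambda>w\<in>words g. mat n n (\<lambda>(a, b). moments u w a b))"
  have Zc: "Z w = compress H n V (word_op Y w)" if "w \<in> words g" for w
    using that by (auto simp: Z_def compress_def moments_def u_def)
  have hat: "hat g Z = X"
  proof (rule nth_equalityI)
    fix i assume "i < length (hat g Z)"
    then have i: "i < g" by (simp add: hat_def)
    have "word_op Y [i] = Y ! i" by (simp add: word_op_def)
    then show "hat g Z ! i = X ! i" using i len by (simp add: hat_def XY Zc)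
  qed (simp add: hat_def XY len)
  have "Z \<in> moment_families g \<Gamma> n (words g)"
    unfolding moment_families_def mem_Collect_eq
  proof (intro conjI ballI)
    show "Z \<in> words g \<rightarrow>\<^sub>E carrier_mat n n" by (auto simp: Z_def)
    \<comment> \<open>Normalization at the empty word is the isometry property of
      \<open>V\<close>.\<close>
    have "moments u [] a b = (if a = b then 1 else 0)" if "a < n" "b < n" for a b
      using V that by (simp add: moments_def isometry_def u_def)
    then show "Z [] = 1\<^sub>m n" by (intro eq_matI) (auto simp: Z_def)
    show "Z (rev \<alpha>) = mat_adjoint (Z \<alpha>)" if "\<alpha> \<in> words g" for \<alpha>
      using that u by (intro eq_matI) (auto simp: Z_def moments_rev)
    fix \<gamma> assume \<gamma>: "\<gamma> \<in> set \<Gamma>"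
    have s: "supp \<gamma> \<subseteq> words g" using \<Gamma>[OF \<gamma>] by (simp add: is_ncpoly_def)
    have "msum n n (\<lambda>m. \<gamma> m \<cdot>\<^sub>m Z m) (supp \<gamma>) = compress H n V (eval_op H Y \<gamma>)"
    proof (rule eq_matI)
      fix a b assume "a < dim_row (compress H n V (eval_op H Y \<gamma>))" "b < dim_col (compress H n V (eval_op H Y \<gamma>))"
      then have ab: "a < n" "b < n" by (auto simp: compress_def)
      have "(\<gamma> m \<cdot>\<^sub>m Z m) $$ (a, b) = \<gamma> m * moments u m a b" if "m \<in> supp \<gamma>" for m
        using that s ab by (auto simp: Z_def)
      then have "msum n n (\<lambda>m. \<gamma> m \<cdot>\<^sub>m Z m) (supp \<gamma>) $$ (a, b) = (\<Sum>m\<in>supp \<gamma>. \<gamma> m * moments u m a b)"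
        using ab by simp
      also have "\<dots> = ip H (eval_op H Y \<gamma> (u b)) (u a)"
        by (simp add: ip_eval_op[OF s u u] moments_def)
      finally show "msum n n (\<lambda>m. \<gamma> m \<cdot>\<^sub>m Z m) (supp \<gamma>) $$ (a, b) = compress H n V (eval_op H Y \<gamma>) $$ (a, b)"
        using ab by (simp add: compress_def u_def)
    qed (simp_all add: compress_def)
    then show "msum n n (\<lambda>m. \<gamma> m \<cdot>\<^sub>m Z m) (supp \<gamma>) = eval_mat n (hat g Z) \<gamma>"
      using com[OF \<gamma>] by (simp add: hat XY)
  qed
  moreover have "pos_on (words g \<times> {..<n}) (hankel_kernel (entries Z))"
    using pos_on_moments[of n u] u
    by (subst pos_on_cong) (auto simp: hankel_kernel_def Z_def)
  moreover have "pos_on (words g \<times> {..<\<mu>} \<times> {..<n}) (loc_kernel \<mu> p (entries Z))"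
  proof (subst pos_on_cong)
    show "pos_on (words g \<times> {..<\<mu>} \<times> {..<n}) (loc_kernel \<mu> p (moments u))"
      by (rule pos_on_loc_moments[OF u p]) (use Y in \<open>simp add: pos_dom_def\<close>)
  qed (use p in \<open>auto simp: loc_kernel_def Z_def is_ncmpoly_def intro!: sum.cong\<close>)
  ultimately have "Z \<in> L_inf g \<Gamma> \<mu> p n" by (simp add: L_inf_iff[OF p])
  then show "X \<in> L_inf_hat g \<Gamma> \<mu> p n" using hat by (auto simp: L_inf_hat_def)
qed

section \<open>The Archimedean inequality\<close>

text \<open>A coefficient of a product sums over all cuts \<open>(w, k)\<close> of \<open>w\<close>.
  The pair \<open>(u, v)\<close> corresponds to the cut of \<open>u @ v\<close> at
  \<open>length u\<close>, and every cut not of this kind has a zero term by the support condition.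
  \<phi> plays the part of a linear functional on polynomials.\<close>

lemma sum_convolution:
  fixes G :: "'a list \<Rightarrow> 'a list \<Rightarrow> complex"
  assumes "finite A" "finite B" "finite W" and W: "\<And>u v. u \<in> A \<Longrightarrow> v \<in> B \<Longrightarrow> u @ v \<in> W"
    and G: "\<And>u v. G u v \<noteq> 0 \<Longrightarrow> u \<in> A \<and> v \<in> B"
  shows "(\<Sum>w\<in>W. (\<Sum>k\<le>length w. G (take k w) (drop k w)) * \<phi> w)
    = (\<Sum>u\<in>A. \<Sum>v\<in>B. G u v * \<phi> (u @ v))"
proof -
  let ?P = "SIGMA w:W. {..length w}"
  let ?h = "\<lambda>(u, v). (u @ v, length u)"
  have "(\<Sum>w\<in>W. (\<Sum>k\<le>length w. G (take k w) (drop k w)) * \<phi> w)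
    = (\<Sum>(w, k)\<in>?P. G (take k w) (drop k w) * \<phi> w)"
    using assms(3) by (simp add: sum_distrib_right sum.Sigma)
  also have "\<dots> = (\<Sum>(w, k)\<in>?h ` (A \<times> B). G (take k w) (drop k w) * \<phi> w)"
  proof (rule sum.mono_neutral_right)
    show "finite ?P" using assms(3) by (intro finite_SigmaI) auto
    show "?h ` (A \<times> B) \<subseteq> ?P" using W by auto
    show "\<forall>x\<in>?P - ?h ` (A \<times> B). (case x of (w, k) \<Rightarrow> G (take k w) (drop k w) * \<phi> w) = 0"
    proof clarify
      fix w k assume *: "w \<in> W" "k \<le> length w" "(w, k) \<notin> ?h ` (A \<times> B)"
      have "(w, k) = ?h (take k w, drop k w)" using *(2) by simp
      then have "\<not> (take k w \<in> A \<and> drop k w \<in> B)" using *(3) by blast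
      then have "G (take k w) (drop k w) = 0" using G by blast
      then show "G (take k w) (drop k w) * \<phi> w = 0" by simp
    qed
  qed
  also have "\<dots> = (\<Sum>(u, v)\<in>A \<times> B. G u v * \<phi> (u @ v))"
    by (subst sum.reindex) (auto simp: inj_on_def intro!: sum.cong)
  finally show ?thesis by (simp add: sum.cartesian_product)
qed

lemma ncm_mult_carrier: "ncm_mult m n p q w \<in> carrier_mat m n"
  by (simp add: ncm_mult_def)

lemma ncm_mult_star_index:
  assumes s: "is_ncmpoly g \<nu> 1 s" and q: "\<And>w. q w \<in> carrier_mat \<nu> 1"
  shows "ncm_mult 1 1 (ncm_star s) q w $$ (0, 0) =
    (\<Sum>k\<le>length w. \<Sum>i<\<nu>. cnj (s (rev (take k w)) $$ (i, 0)) * q (drop k w) $$ (i, 0))"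
proof -
  have "(ncm_star s u * q v) $$ (0, 0) = (\<Sum>i<\<nu>. cnj (s (rev u) $$ (i, 0)) * q v $$ (i, 0))" for u v
  proof -
    have "s (rev u) \<in> carrier_mat \<nu> 1" using s by (simp add: is_ncmpoly_def)
    then show ?thesis using q[of v]
      by (auto simp: ncm_star_def scalar_prod_def lessThan_atLeast0 intro!: sum.cong)
  qed
  then show ?thesis by (simp add: ncm_mult_def)
qed

lemma ncm_mult_column_index:
  assumes p: "is_ncmpoly g \<mu> \<mu> p" and t: "is_ncmpoly g \<mu> 1 t" and "i < \<mu>"
  shows "ncm_mult \<mu> 1 p t w $$ (i, 0) =
    (\<Sum>k\<le>length w. \<Sum>j<\<mu>. p (take k w) $$ (i, j) * t (drop k w) $$ (j, 0))"
proof -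
  have "(p u * t v) $$ (i, 0) = (\<Sum>j<\<mu>. p u $$ (i, j) * t v $$ (j, 0))" for u v
  proof -
    have "p u \<in> carrier_mat \<mu> \<mu>" "t v \<in> carrier_mat \<mu> 1" using p t by (auto simp: is_ncmpoly_def)
    then show ?thesis using \<open>i < \<mu>\<close>
      by (auto simp: scalar_prod_def lessThan_atLeast0 intro!: sum.cong)
  qed
  then show ?thesis using \<open>i < \<mu>\<close> by (simp add: ncm_mult_def)
qed

text \<open>The linear functional \<phi> is evaluated on \<open>s^* s\<close>, split along the rows
  of the column \<open>s\<close> so that each row can be treated as a scalar square.\<close>

lemma sum_star_square:
  assumes s: "is_ncmpoly g \<nu> 1 s" and "finite W"
    and W: "\<And>u v. u \<in> msupp \<nu> 1 s \<Longrightarrow> v \<in> msupp \<nu> 1 s \<Longrightarrow> rev u @ v \<in> W"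
  shows "(\<Sum>w\<in>W. ncm_mult 1 1 (ncm_star s) s w $$ (0, 0) * \<phi> w) =
    (\<Sum>i<\<nu>. \<Sum>u\<in>msupp \<nu> 1 s. \<Sum>v\<in>msupp \<nu> 1 s. cnj (s u $$ (i, 0)) * s v $$ (i, 0) * \<phi> (rev u @ v))"
proof -
  let ?S = "msupp \<nu> 1 s"
  have fin: "finite ?S" and c: "\<And>w. s w \<in> carrier_mat \<nu> 1" using s by (auto simp: is_ncmpoly_def)
  have z: "s w $$ (i, 0) = 0" if "w \<notin> ?S" "i < \<nu>" for w i using that by (simp add: msupp_def)
  have "(\<Sum>w\<in>W. ncm_mult 1 1 (ncm_star s) s w $$ (0, 0) * \<phi> w)
    = (\<Sum>u\<in>rev ` ?S. \<Sum>v\<in>?S. (\<Sum>i<\<nu>. cnj (s (rev u) $$ (i, 0)) * s v $$ (i, 0)) * \<phi> (u @ v))"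
    unfolding ncm_mult_star_index[OF s c]
  proof (rule sum_convolution)
    fix u v assume "(\<Sum>i<\<nu>. cnj (s (rev u) $$ (i, 0)) * s v $$ (i, 0)) \<noteq> 0"
    then obtain i where "i < \<nu>" "cnj (s (rev u) $$ (i, 0)) * s v $$ (i, 0) \<noteq> 0"
      by (metis (no_types, lifting) lessThan_iff sum.not_neutral_contains_not_neutral)
    then have "rev u \<in> ?S" "v \<in> ?S" using z by fastforce+
    then show "u \<in> rev ` ?S \<and> v \<in> ?S" by (metis imageI rev_rev_ident)
  qed (use fin assms in auto)
  also have "\<dots> = (\<Sum>u\<in>?S. \<Sum>v\<in>?S. \<Sum>i<\<nu>. cnj (s u $$ (i, 0)) * s v $$ (i, 0) * \<phi> (rev u @ v))"
    by (subst sum.reindex) (simp_all add: sum_distrib_right)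
  also have "\<dots> = (\<Sum>u\<in>?S. \<Sum>i<\<nu>. \<Sum>v\<in>?S. cnj (s u $$ (i, 0)) * s v $$ (i, 0) * \<phi> (rev u @ v))"
    by (intro sum.cong refl sum.swap)
  also have "\<dots> = (\<Sum>i<\<nu>. \<Sum>u\<in>?S. \<Sum>v\<in>?S. cnj (s u $$ (i, 0)) * s v $$ (i, 0) * \<phi> (rev u @ v))"
    by (rule sum.swap)
  finally show ?thesis .
qed

text \<open>The analogue for \<open>t^* p t\<close>, with the convolution lemma applied once to
  \<open>p t\<close> and once to the outer product. The rows stay coupled through the entries of
  \<open>p\<close>, so the sums are arranged in the shape of the localizing form.\<close>

lemma sum_star_weighted_square:
  assumes p: "is_ncmpoly g \<mu> \<mu> p" and t: "is_ncmpoly g \<mu> 1 t" and "finite W"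
    and W: "\<And>u w v. u \<in> msupp \<mu> 1 t \<Longrightarrow> w \<in> msupp \<mu> \<mu> p \<Longrightarrow> v \<in> msupp \<mu> 1 t \<Longrightarrow> rev u @ w @ v \<in> W"
  shows "(\<Sum>w\<in>W. ncm_mult 1 1 (ncm_star t) (ncm_mult \<mu> 1 p t) w $$ (0, 0) * \<phi> w) =
    (\<Sum>u\<in>msupp \<mu> 1 t. \<Sum>i<\<mu>. \<Sum>v\<in>msupp \<mu> 1 t. \<Sum>j<\<mu>. \<Sum>w\<in>msupp \<mu> \<mu> p.
       p w $$ (i, j) * \<phi> (rev u @ w @ v) * t v $$ (j, 0) * cnj (t u $$ (i, 0)))"
proof -
  let ?T = "msupp \<mu> 1 t" and ?P = "msupp \<mu> \<mu> p"
  let ?q = "ncm_mult \<mu> 1 p t"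
  let ?B = "(\<lambda>(w, v). w @ v) ` (?P \<times> ?T)"
  have fin: "finite ?T" "finite ?P" using p t by (auto simp: is_ncmpoly_def)
  have z: "t w $$ (i, 0) = 0" if "w \<notin> ?T" "i < \<mu>" for w i using that by (simp add: msupp_def)
  have zp: "p w $$ (i, j) = 0" if "w \<notin> ?P" "i < \<mu>" "j < \<mu>" for w i j using that by (simp add: msupp_def)
  \<comment> \<open>\<open>?B\<close> contains the support of \<open>p t\<close>; cancellation may
    make that support smaller.\<close>
  have q: "?q v $$ (i, 0) = 0" if "v \<notin> ?B" "i < \<mu>" for v i
  proof -
    have "p (take k v) $$ (i, j) * t (drop k v) $$ (j, 0) = 0" if "j < \<mu>" for j k
    proof -
      have "\<not> (take k v \<in> ?P \<and> drop k v \<in> ?T)"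
      proof
        assume "take k v \<in> ?P \<and> drop k v \<in> ?T"
        then have "(\<lambda>(w, v). w @ v) (take k v, drop k v) \<in> ?B" by blast
        then show False using \<open>v \<notin> ?B\<close> by simp
      qed
      then show ?thesis using z zp that \<open>i < \<mu>\<close> by fastforce
    qed
    then show ?thesis
      unfolding ncm_mult_column_index[OF p t \<open>i < \<mu>\<close>] by (intro sum.neutral ballI) simp
  qed
  have inner: "(\<Sum>v\<in>?B. ?q v $$ (i, 0) * \<psi> v) =
      (\<Sum>w\<in>?P. \<Sum>v\<in>?T. (\<Sum>j<\<mu>. p w $$ (i, j) * t v $$ (j, 0)) * \<psi> (w @ v))" if "i < \<mu>" for i \<psi>
    unfolding ncm_mult_column_index[OF p t that]
  proof (rule sum_convolution)
    fix u v assume "(\<Sum>j<\<mu>. p u $$ (i, j) * t v $$ (j, 0)) \<noteq> 0"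
    then obtain j where "j < \<mu>" "p u $$ (i, j) * t v $$ (j, 0) \<noteq> 0"
      by (metis (no_types, lifting) lessThan_iff sum.not_neutral_contains_not_neutral)
    then show "u \<in> ?P \<and> v \<in> ?T" using z zp \<open>i < \<mu>\<close> by fastforce
  qed (use fin in auto)
  have "(\<Sum>w\<in>W. ncm_mult 1 1 (ncm_star t) ?q w $$ (0, 0) * \<phi> w)
    = (\<Sum>u\<in>rev ` ?T. \<Sum>v\<in>?B. (\<Sum>i<\<mu>. cnj (t (rev u) $$ (i, 0)) * ?q v $$ (i, 0)) * \<phi> (u @ v))"
    unfolding ncm_mult_star_index[OF t ncm_mult_carrier]
  proof (rule sum_convolution)
    fix u v assume "(\<Sum>i<\<mu>. cnj (t (rev u) $$ (i, 0)) * ?q v $$ (i, 0)) \<noteq> 0"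
    then obtain i where "i < \<mu>" "cnj (t (rev u) $$ (i, 0)) * ?q v $$ (i, 0) \<noteq> 0"
      by (metis (no_types, lifting) lessThan_iff sum.not_neutral_contains_not_neutral)
    then have "rev u \<in> ?T" "v \<in> ?B" using z q by fastforce+
    then show "u \<in> rev ` ?T \<and> v \<in> ?B" by (metis imageI rev_rev_ident)
  qed (use fin assms in auto)
  also have "\<dots> = (\<Sum>u\<in>?T. \<Sum>v\<in>?B. \<Sum>i<\<mu>. cnj (t u $$ (i, 0)) * (?q v $$ (i, 0) * \<phi> (rev u @ v)))"
    by (subst sum.reindex) (simp_all add: sum_distrib_right mult.assoc)
  also have "\<dots> = (\<Sum>u\<in>?T. \<Sum>i<\<mu>. \<Sum>v\<in>?B. cnj (t u $$ (i, 0)) * (?q v $$ (i, 0) * \<phi> (rev u @ v)))"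
    by (intro sum.cong refl sum.swap)
  also have "\<dots> = (\<Sum>u\<in>?T. \<Sum>i<\<mu>. cnj (t u $$ (i, 0)) *
      (\<Sum>w\<in>?P. \<Sum>v\<in>?T. (\<Sum>j<\<mu>. p w $$ (i, j) * t v $$ (j, 0)) * \<phi> (rev u @ w @ v)))"
    by (intro sum.cong refl) (simp only: sum_distrib_left[symmetric] inner lessThan_iff)
  also have "\<dots> = (\<Sum>u\<in>?T. \<Sum>i<\<mu>. cnj (t u $$ (i, 0)) *
      (\<Sum>v\<in>?T. \<Sum>w\<in>?P. \<Sum>j<\<mu>. p w $$ (i, j) * t v $$ (j, 0) * \<phi> (rev u @ w @ v)))"
    by (subst sum.swap[of _ ?T ?P]) (simp add: sum_distrib_right)
  also have "\<dots> = (\<Sum>u\<in>?T. \<Sum>i<\<mu>. cnj (t u $$ (i, 0)) *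
      (\<Sum>v\<in>?T. \<Sum>j<\<mu>. \<Sum>w\<in>?P. p w $$ (i, j) * t v $$ (j, 0) * \<phi> (rev u @ w @ v)))"
    by (subst sum.swap[of _ "{..<\<mu>}" ?P]) (rule refl)
  also have "\<dots> = (\<Sum>u\<in>?T. \<Sum>i<\<mu>. \<Sum>v\<in>?T. \<Sum>j<\<mu>. \<Sum>w\<in>?P.
       p w $$ (i, j) * \<phi> (rev u @ w @ v) * t v $$ (j, 0) * cnj (t u $$ (i, 0)))"
    by (simp add: sum_distrib_left mult_ac)
  finally show ?thesis .
qed

lemma sum_ball_poly:
  assumes "finite W" "[] \<in> W" "\<And>i. i < g \<Longrightarrow> [i, i] \<in> W"
  shows "(\<Sum>w\<in>W. ball_poly g k w * \<phi> w) = of_real (k\<^sup>2) * \<phi> [] - (\<Sum>i<g. \<phi> [i, i])"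
proof -
  have "(\<Sum>w\<in>W. ball_poly g k w * \<phi> w) =
    (\<Sum>w\<in>W. if w = [] then of_real (k\<^sup>2) * \<phi> w else 0) - (\<Sum>w\<in>W. \<Sum>i<g. if w = [i, i] then \<phi> w else 0)"
  proof -
    have "(\<Sum>i<g. of_bool (w = [i, i])) * \<phi> w = (\<Sum>i<g. if w = [i, i] then \<phi> w else 0)" for w
      unfolding sum_distrib_right by (intro sum.cong refl) auto
    then show ?thesis
      unfolding sum_subtractf[symmetric] ball_poly_def left_diff_distrib
      by (intro sum.cong refl) auto
  qed
  also have "(\<Sum>w\<in>W. \<Sum>i<g. if w = [i, i] then \<phi> w else 0) = (\<Sum>i<g. \<Sum>w\<in>W. if w = [i, i] then \<phi> w else 0)"
    by (rule sum.swap)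
  also have "\<dots> = (\<Sum>i<g. \<phi> [i, i])"
    using assms by (intro sum.cong refl) simp
  finally show ?thesis using assms by simp
qed

section \<open>Conjugation by a finitely supported vector\<close>

text \<open>In operator terms this is the inner product of \<open>w \<xi>\<close> with \<xi>, where
  \<xi> is the combination over \<open>F\<close>, with coefficients \<open>c\<close>, of the words
  \<open>fst z\<close> applied to the vectors numbered \<open>snd z\<close>.\<close>

definition moment_form ::
  "(ncword \<Rightarrow> nat \<Rightarrow> nat \<Rightarrow> complex) \<Rightarrow> (ncword \<times> nat) set \<Rightarrow> (ncword \<times> nat \<Rightarrow> complex) \<Rightarrow> ncword \<Rightarrow> complex" where
  "moment_form y F c w =
     (\<Sum>x\<in>F. \<Sum>z\<in>F. y (rev (fst x) @ w @ fst z) (snd x) (snd z) * c z * cnj (c x))"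

text \<open>This is the squared norm of the scalar polynomial with coefficients \<open>a\<close>
  applied to the vector encoded by \<open>F\<close> and \<open>c\<close>, obtained by pulling the
  Hankel kernel back along concatenation of words.\<close>

lemma star_square_form_nonneg:
  assumes pos: "pos_on (I \<times> {..<n}) (hankel_kernel y)" and "finite S" and F: "finite F"
    and I: "\<And>u x. u \<in> S \<Longrightarrow> x \<in> F \<Longrightarrow> u @ fst x \<in> I \<and> snd x < n"
  shows "0 \<le> (\<Sum>u\<in>S. \<Sum>v\<in>S. cnj (a u) * a v * moment_form y F c (rev u @ v))"
proof -
  let ?f = "\<lambda>(u, x). (u @ fst x, snd x)"
  let ?V = "\<lambda>(u, x). a u * c x"
  have "pos_on (S \<times> F) (\<lambda>s t. hankel_kernel y (?f s) (?f t))"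
    by (rule pos_on_pullback[OF pos]) (use I in auto)
  then have "0 \<le> (\<Sum>s\<in>S \<times> F. \<Sum>t\<in>S \<times> F. hankel_kernel y (?f s) (?f t) * ?V t * cnj (?V s))"
    by (rule pos_onD) (use assms in auto)
  also have "\<dots> = (\<Sum>u\<in>S. \<Sum>x\<in>F. \<Sum>v\<in>S. \<Sum>z\<in>F.
      cnj (a u) * a v * (y (rev (fst x) @ (rev u @ v) @ fst z) (snd x) (snd z) * c z * cnj (c x)))"
    by (simp add: sum.cartesian_product' hankel_kernel_def mult_ac)
  also have "\<dots> = (\<Sum>u\<in>S. \<Sum>v\<in>S. \<Sum>x\<in>F. \<Sum>z\<in>F.
      cnj (a u) * a v * (y (rev (fst x) @ (rev u @ v) @ fst z) (snd x) (snd z) * c z * cnj (c x)))"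
    by (intro sum.cong refl sum.swap)
  finally show ?thesis by (simp add: moment_form_def sum_distrib_left)
qed

text \<open>This is the form of \<open>p\<close> at the tuple whose \<open>i\<close>-th component is
  the polynomial with coefficients \<open>a u i\<close> applied to the vector encoded by
  \<open>F\<close> and \<open>c\<close>.\<close>

lemma star_weighted_square_form_nonneg:
  assumes pos: "pos_on (I \<times> {..<\<mu>} \<times> {..<n}) (loc_kernel \<mu> p y)" and "finite S" and F: "finite F"
    and I: "\<And>u x. u \<in> S \<Longrightarrow> x \<in> F \<Longrightarrow> u @ fst x \<in> I \<and> snd x < n"
  shows "0 \<le> (\<Sum>u\<in>S. \<Sum>i<\<mu>. \<Sum>v\<in>S. \<Sum>j<\<mu>. \<Sum>w\<in>msupp \<mu> \<mu> p.
       p w $$ (i, j) * moment_form y F c (rev u @ w @ v) * a v j * cnj (a u i))"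
proof -
  let ?P = "msupp \<mu> \<mu> p"
  let ?f = "\<lambda>(u, i, x). (u @ fst x, i, snd x)"
  let ?V = "\<lambda>(u, i, x). a u i * c x"
  let ?J = "S \<times> {..<\<mu>} \<times> F"
  let ?g = "\<lambda>u i x v j z w. p w $$ (i, j) *
    (y (rev (fst x) @ (rev u @ w @ v) @ fst z) (snd x) (snd z) * c z * cnj (c x)) * a v j * cnj (a u i)"
  have "pos_on ?J (\<lambda>s t. loc_kernel \<mu> p y (?f s) (?f t))"
    by (rule pos_on_pullback[OF pos]) (use I in auto)
  then have "0 \<le> (\<Sum>s\<in>?J. \<Sum>t\<in>?J. loc_kernel \<mu> p y (?f s) (?f t) * ?V t * cnj (?V s))"
    by (rule pos_onD) (use assms in auto)
  also have "\<dots> = (\<Sum>u\<in>S. \<Sum>i<\<mu>. \<Sum>x\<in>F. \<Sum>v\<in>S. \<Sum>j<\<mu>. \<Sum>z\<in>F. \<Sum>w\<in>?P. ?g u i x v j z w)"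
    by (simp add: sum.cartesian_product' loc_kernel_def sum_distrib_right sum_distrib_left mult_ac)
  also have "\<dots> = (\<Sum>u\<in>S. \<Sum>i<\<mu>. \<Sum>v\<in>S. \<Sum>x\<in>F. \<Sum>j<\<mu>. \<Sum>z\<in>F. \<Sum>w\<in>?P. ?g u i x v j z w)"
    by (intro sum.cong refl sum.swap)
  also have "\<dots> = (\<Sum>u\<in>S. \<Sum>i<\<mu>. \<Sum>v\<in>S. \<Sum>j<\<mu>. \<Sum>x\<in>F. \<Sum>z\<in>F. \<Sum>w\<in>?P. ?g u i x v j z w)"
    by (intro sum.cong refl sum.swap)
  also have "\<dots> = (\<Sum>u\<in>S. \<Sum>i<\<mu>. \<Sum>v\<in>S. \<Sum>j<\<mu>. \<Sum>x\<in>F. \<Sum>w\<in>?P. \<Sum>z\<in>F. ?g u i x v j z w)"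
    by (intro sum.cong refl sum.swap)
  also have "\<dots> = (\<Sum>u\<in>S. \<Sum>i<\<mu>. \<Sum>v\<in>S. \<Sum>j<\<mu>. \<Sum>w\<in>?P. \<Sum>x\<in>F. \<Sum>z\<in>F. ?g u i x v j z w)"
    by (intro sum.cong refl sum.swap)
  finally show ?thesis by (simp add: moment_form_def sum_distrib_left sum_distrib_right)
qed

lemma sum_sum_list: "(\<Sum>w\<in>W. \<Sum>x\<leftarrow>xs. f x w) = (\<Sum>x\<leftarrow>xs. \<Sum>w\<in>W. f x w)"
  for f :: "'a \<Rightarrow> 'b \<Rightarrow> complex"
  by (induction xs) (simp_all add: sum.distrib)

lemma sum_list_mult_right: "(\<Sum>x\<leftarrow>xs. f x) * c = (\<Sum>x\<leftarrow>xs. f x * c)" for c :: complex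
  by (induction xs) (simp_all add: distrib_right)

text \<open>Conjugating the Archimedean identity by a vector supported on \<open>F\<close>; the slack \<open>E\<close> is the
  largest degree of the weights.\<close>

lemma archimedean_form:
  assumes arch: "archimedean g \<mu> p" and p: "is_ncmpoly g \<mu> \<mu> p"
  obtains k :: real and E :: nat where "k > 0"
    "\<And>y n I I' F c. \<lbrakk>pos_on (I \<times> {..<n}) (hankel_kernel y); pos_on (I' \<times> {..<\<mu>} \<times> {..<n}) (loc_kernel \<mu> p y);
       finite F; \<And>x. x \<in> F \<Longrightarrow> snd x < n;
       \<And>u x. \<lbrakk>x \<in> F; u \<in> words_upto g E\<rbrakk> \<Longrightarrow> u @ fst x \<in> I \<inter> I'\<rbrakk> \<Longrightarrow>
       (\<Sum>i<g. moment_form y F c [i, i]) \<le> of_real (k\<^sup>2) * moment_form y F c []"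
proof -
  from arch obtain k S T where k: "k > 0"
    and S: "\<And>\<nu> s. (\<nu>, s) \<in> set S \<Longrightarrow> is_ncmpoly g \<nu> 1 s"
    and T: "\<And>t. t \<in> set T \<Longrightarrow> is_ncmpoly g \<mu> 1 t"
    and id: "\<And>w. ball_poly g k w = (\<Sum>(\<nu>, s)\<leftarrow>S. ncm_mult 1 1 (ncm_star s) s w $$ (0, 0)) +
           (\<Sum>t\<leftarrow>T. ncm_mult 1 1 (ncm_star t) (ncm_mult \<mu> 1 p t) w $$ (0, 0))"
    unfolding archimedean_def by fast
  \<comment> \<open>\<open>A\<close> collects the words of all weights and \<open>E\<close> bounds
    their lengths, so a weight lengthens a word by at most \<open>E\<close>.\<close>
  define A where "A = (\<Union>(\<nu>, s)\<in>set S. msupp \<nu> 1 s) \<union> (\<Union>t\<in>set T. msupp \<mu> 1 t)"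
  define E where "E = Max (insert 0 (length ` A))"
  have finA: "finite A" using S T by (auto simp: A_def is_ncmpoly_def)
  have A: "A \<subseteq> words_upto g E"
  proof
    fix w assume w: "w \<in> A"
    then have "w \<in> words g" using S T by (fastforce simp: A_def is_ncmpoly_def)
    moreover have "length w \<le> E" unfolding E_def using w finA by (intro Max_ge) auto
    ultimately show "w \<in> words_upto g E" by (simp add: words_upto_def)
  qed
  \<comment> \<open>The words in \<open>t^* p t\<close> have length at most
    \<open>2 * E + ncmdeg \<mu> p\<close>; the final 2 accommodates the squares in
    \<open>ball_poly\<close>.\<close>
  define W where "W = words_upto g (2 * E + ncmdeg \<mu> p + 2)"
  have W: "finite W" "[] \<in> W" "\<And>i. i < g \<Longrightarrow> [i, i] \<in> W"
    unfolding W_def by (rule finite_words_upto) (auto simp: words_upto_def)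
  have W1: "rev u @ v \<in> W" if "u \<in> A" "v \<in> A" for u v
  proof -
    have "u \<in> words_upto g E" "v \<in> words_upto g E" using A that by auto
    then show ?thesis by (simp add: W_def words_upto_def)
  qed
  have W2: "rev u @ w @ v \<in> W" if "u \<in> A" "v \<in> A" "w \<in> msupp \<mu> \<mu> p" for u v w
  proof -
    have "length w \<le> ncmdeg \<mu> p" "w \<in> words g" using that p by (auto simp: is_ncmpoly_def intro: ncmdeg_ge)
    moreover have "u \<in> words_upto g E" "v \<in> words_upto g E" using A that by auto
    ultimately show ?thesis by (simp add: W_def words_upto_def)
  qed
  have AS: "msupp \<nu> 1 s \<subseteq> A" if "(\<nu>, s) \<in> set S" for \<nu> s using that by (auto simp: A_def)
  have AT: "msupp \<mu> 1 t \<subseteq> A" if "t \<in> set T" for t using that by (auto simp: A_def)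
  show ?thesis
  proof (rule that[OF k])
    \<comment> \<open>\<open>I\<close> and \<open>I'\<close> are kept apart because at a finite
      level the Hankel matrix may reach further than the localizing matrix.\<close>
    fix y n I I' and F :: "(ncword \<times> nat) set" and c
    assume pos: "pos_on (I \<times> {..<n}) (hankel_kernel y)" "pos_on (I' \<times> {..<\<mu>} \<times> {..<n}) (loc_kernel \<mu> p y)"
      and F: "finite F" "\<And>x. x \<in> F \<Longrightarrow> snd x < n"
      and I: "\<And>u x. \<lbrakk>x \<in> F; u \<in> words_upto g E\<rbrakk> \<Longrightarrow> u @ fst x \<in> I \<inter> I'"
    let ?\<phi> = "moment_form y F c"
    have "of_real (k\<^sup>2) * ?\<phi> [] - (\<Sum>i<g. ?\<phi> [i, i]) = (\<Sum>w\<in>W. ball_poly g k w * ?\<phi> w)"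
      by (rule sum_ball_poly[OF W, symmetric])
    also have "\<dots> = (\<Sum>(\<nu>, s)\<leftarrow>S. \<Sum>w\<in>W. ncm_mult 1 1 (ncm_star s) s w $$ (0, 0) * ?\<phi> w) +
           (\<Sum>t\<leftarrow>T. \<Sum>w\<in>W. ncm_mult 1 1 (ncm_star t) (ncm_mult \<mu> 1 p t) w $$ (0, 0) * ?\<phi> w)"
      by (simp add: id distrib_right sum.distrib sum_list_mult_right sum_sum_list case_prod_unfold)
    also have "0 \<le> \<dots>"
    proof (intro add_nonneg_nonneg sum_list_nonneg)
      fix x assume "x \<in> set (map (\<lambda>(\<nu>, s). \<Sum>w\<in>W. ncm_mult 1 1 (ncm_star s) s w $$ (0, 0) * ?\<phi> w) S)"
      then obtain \<nu> s where s: "(\<nu>, s) \<in> set S"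
        and x: "x = (\<Sum>w\<in>W. ncm_mult 1 1 (ncm_star s) s w $$ (0, 0) * ?\<phi> w)" by auto
      note A' = AS[OF s]
      show "0 \<le> x"
        unfolding x
      proof (subst sum_star_square[OF S[OF s] W(1)])
        show "0 \<le> (\<Sum>i<\<nu>. \<Sum>u\<in>msupp \<nu> 1 s. \<Sum>v\<in>msupp \<nu> 1 s.
            cnj (s u $$ (i, 0)) * s v $$ (i, 0) * ?\<phi> (rev u @ v))"
          by (intro sum_nonneg star_square_form_nonneg[OF pos(1)])
            (use A' A F I finite_subset[OF A' finA] in auto)
      qed (use A' W1 in auto)
    next
      fix x assume "x \<in> set (map (\<lambda>t. \<Sum>w\<in>W. ncm_mult 1 1 (ncm_star t) (ncm_mult \<mu> 1 p t) w $$ (0, 0) * ?\<phi> w) T)"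
      then obtain t where t: "t \<in> set T"
        and x: "x = (\<Sum>w\<in>W. ncm_mult 1 1 (ncm_star t) (ncm_mult \<mu> 1 p t) w $$ (0, 0) * ?\<phi> w)" by auto
      note A' = AT[OF t]
      show "0 \<le> x"
        unfolding x
      proof (subst sum_star_weighted_square[OF p T[OF t] W(1)])
        show "0 \<le> (\<Sum>u\<in>msupp \<mu> 1 t. \<Sum>i<\<mu>. \<Sum>v\<in>msupp \<mu> 1 t. \<Sum>j<\<mu>. \<Sum>w\<in>msupp \<mu> \<mu> p.
           p w $$ (i, j) * ?\<phi> (rev u @ w @ v) * t v $$ (j, 0) * cnj (t u $$ (i, 0)))"
          by (rule star_weighted_square_form_nonneg[OF pos(2)])
            (use A' A F I finite_subset[OF A' finA] in auto)
      qed (blast intro: W2 subsetD[OF A'])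
    qed
    finally show "(\<Sum>i<g. ?\<phi> [i, i]) \<le> of_real (k\<^sup>2) * ?\<phi> []" by simp
  qed
qed

lemma moment_form_square_nonneg:
  assumes "pos_on (I \<times> {..<n}) (hankel_kernel y)" "finite F" "\<And>x. x \<in> F \<Longrightarrow> i # fst x \<in> I \<and> snd x < n"
  shows "0 \<le> moment_form y F c [i, i]"
  using star_square_form_nonneg[OF assms(1), of "{[i]}" F "\<lambda>_. 1" c] assms(2,3) by simp

section \<open>Compactness\<close>

text \<open>By induction the diagonal moment at \<open>w^* w\<close> is at most
  \<open>k^(2 |w|)\<close>: each further letter costs a factor \<open>k^2\<close>, the squares of
  the other letters being nonnegative. Cauchy-Schwarz against the empty word, whose diagonal entries
  are 1, then bounds the moment at \<open>w\<close>.\<close>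

lemma hankel_bound:
  fixes y :: "ncword \<Rightarrow> nat \<Rightarrow> nat \<Rightarrow> complex"
  assumes form: "\<And>F c. \<lbrakk>finite F; \<And>x. x \<in> F \<Longrightarrow> snd x < n;
       \<And>u x. \<lbrakk>x \<in> F; u \<in> words_upto g E\<rbrakk> \<Longrightarrow> u @ fst x \<in> words_upto g d\<rbrakk> \<Longrightarrow>
       (\<Sum>i<g. moment_form y F c [i, i]) \<le> of_real (k\<^sup>2) * moment_form y F c []"
    and pos: "pos_on (words_upto g D \<times> {..<n}) (hankel_kernel y)" and "d \<le> D"
    and one: "\<And>a. a < n \<Longrightarrow> y [] a a = 1" and "0 \<le> k"
    and w: "w \<in> words g" "length w + E \<le> d" and "a < n" "b < n"
  shows "cmod (y w a b) \<le> k ^ length w"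
proof -
  have diag: "Re (y (rev w @ w) b b) \<le> (k\<^sup>2) ^ length w" using w
  proof (induction w)
    case Nil
    then show ?case using one[OF \<open>b < n\<close>] by simp
  next
    case (Cons i w)
    let ?m = "moment_form y {(w, b)} (\<lambda>_. 1)"
    have m: "?m v = y (rev w @ v @ w) b b" for v by (simp add: moment_form_def)
    have nn: "0 \<le> Re (?m [j, j])" if "j < g" for j
      using pos_on_diag[OF pos, of "(j # w, b)"] Cons.prems that \<open>b < n\<close> \<open>d \<le> D\<close>
      by (simp add: m hankel_kernel_def words_upto_def less_eq_complex_def)
    have "Re (?m [i, i]) \<le> (\<Sum>j<g. Re (?m [j, j]))"
      by (rule member_le_sum) (use nn Cons.prems in auto)
    also have "\<dots> \<le> k\<^sup>2 * Re (?m [])"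
    proof -
      have "(\<Sum>i<g. ?m [i, i]) \<le> of_real (k\<^sup>2) * ?m []"
        by (rule form) (use Cons.prems \<open>b < n\<close> in \<open>auto simp: words_upto_def\<close>)
      then show ?thesis by (simp add: less_eq_complex_def)
    qed
    also have "\<dots> \<le> k\<^sup>2 * (k\<^sup>2) ^ length w"
      using Cons by (intro mult_left_mono) (auto simp: m)
    finally show ?case by (simp add: m)
  qed
  have "(cmod (hankel_kernel y ([], a) (w, b)))\<^sup>2
    \<le> Re (hankel_kernel y ([], a) ([], a)) * Re (hankel_kernel y (w, b) (w, b))"
    by (rule pos_on_Cauchy_Schwarz[OF pos]) (use assms in \<open>auto simp: words_upto_def\<close>)
  also have "\<dots> \<le> (k ^ length w)\<^sup>2"
    using diag one[OF \<open>a < n\<close>] by (simp add: hankel_kernel_def power_mult[symmetric] mult.commute)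
  finally have "(cmod (y w a b))\<^sup>2 \<le> (k ^ length w)\<^sup>2" by (simp add: hankel_kernel_def)
  then show ?thesis using \<open>0 \<le> k\<close> by (simp add: power2_le_iff_abs_le)
qed

text \<open>Bolzano-Weierstrass in each of the countably many coordinates, combined by a diagonal
  subsequence.\<close>

lemma diagonal_convergence:
  fixes f :: "nat \<Rightarrow> 'a::countable \<Rightarrow> complex"
  assumes "\<And>t. \<exists>B. \<forall>d. cmod (f d t) \<le> B"
  obtains r :: "nat \<Rightarrow> nat" where "strict_mono r" "\<And>t. convergent (\<lambda>m. f (r m) t)"
proof -
  define P where "P t s \<longleftrightarrow> convergent (\<lambda>m. f (s m) (from_nat t))" for t and s :: "nat \<Rightarrow> nat"
  interpret subseqs P
  proof
    fix t and s :: "nat \<Rightarrow> nat"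
    obtain B where "\<And>d. cmod (f d (from_nat t)) \<le> B" using assms by blast
    then have "bounded (range (\<lambda>m. f (s m) (from_nat t)))" by (intro boundedI[of _ B]) auto
    from bounded_imp_convergent_subsequence[OF this]
    show "\<exists>r'. strict_mono r' \<and> P t (s \<circ> r')"
      by (auto simp: P_def o_def convergent_def)
  qed
  have h: "P t (diagseq \<circ> (+) (Suc t))" for t
  proof (rule diagseq_holds)
    fix r s n assume "strict_mono (r :: nat \<Rightarrow> nat)" "P n s"
    then show "P n (s \<circ> r)"
      using convergent_subseq_convergent[of "\<lambda>m. f (s m) (from_nat n)" r]
      by (simp add: P_def o_def)
  qed
  show ?thesis
  proof (rule that[OF subseq_diagseq])
    fix t
    \<comment> \<open>The diagonal sequence refines the selection made for a given coordinate only
      from some index on, which is enough for convergence.\<close>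
    have "convergent (\<lambda>m. f (diagseq (m + Suc (to_nat t))) t)"
      using h[of "to_nat t"] by (simp add: P_def o_def add.commute)
    then show "convergent (\<lambda>m. f (diagseq m) t)"
      using convergent_ignore_initial_segment[of "\<lambda>m. f (diagseq m) t" "Suc (to_nat t)"] by simp
  qed
qed

lemma finite_words_bounded:
  assumes "finite F" "F \<subseteq> words g \<times> A"
  obtains L where "\<And>d. L \<le> d \<Longrightarrow> F \<subseteq> words_upto g d \<times> A"
proof
  show "F \<subseteq> words_upto g d \<times> A" if "Max (insert 0 ((\<lambda>x. length (fst x)) ` F)) \<le> d" for d
  proof
    fix x assume x: "x \<in> F"
    have "length (fst x) \<le> Max (insert 0 ((\<lambda>x. length (fst x)) ` F))"
      by (rule Max_ge) (use assms x in auto)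
    then show "x \<in> words_upto g d \<times> A" using assms x that by (cases x) (auto simp: words_upto_def)
  qed
qed

lemma Inter_L_fin_hat_subset_L_inf_hat:
  assumes p: "is_ncmpoly g \<mu> \<mu> p" and arch: "archimedean g \<mu> p"
    and \<Gamma>: "\<And>\<gamma>. \<gamma> \<in> set \<Gamma> \<Longrightarrow> is_ncpoly g \<gamma> \<and> ncdeg \<gamma> \<le> \<delta>"
  shows "(\<Inter>d\<in>{\<delta>..}. L_fin_hat g \<Gamma> \<mu> p n d) \<subseteq> L_inf_hat g \<Gamma> \<mu> p n"
proof
  fix X assume X: "X \<in> (\<Inter>d\<in>{\<delta>..}. L_fin_hat g \<Gamma> \<mu> p n d)"
  have "\<exists>Z. Z \<in> L_fin g \<Gamma> \<mu> p n (\<delta> + d) \<and> hat g Z = X" for d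
  proof -
    have "X \<in> L_fin_hat g \<Gamma> \<mu> p n (\<delta> + d)" using X by simp
    then show ?thesis by (auto simp: L_fin_hat_def)
  qed
  then obtain Z where Z: "\<And>d. Z d \<in> L_fin g \<Gamma> \<mu> p n (\<delta> + d)" and ZX: "\<And>d. hat g (Z d) = X"
    by metis
  define D where "D d = \<delta> + d + nat \<lceil>real (ncmdeg \<mu> p) / 2\<rceil>" for d
  define N where "N d = 2 * (\<delta> + d) + ncmdeg \<mu> p + 1" for d
  have mf: "Z d \<in> moment_families g \<Gamma> n (words_upto g (N d))"
    and ph: "pos_on (words_upto g (D d) \<times> {..<n}) (hankel_kernel (entries (Z d)))"
    and pl: "pos_on (words_upto g (\<delta> + d) \<times> {..<\<mu>} \<times> {..<n}) (loc_kernel \<mu> p (entries (Z d)))" for d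
    using Z[of d] unfolding L_fin_iff[OF p] by (simp_all add: D_def N_def)
  have one: "entries (Z d) [] a a = 1" if "a < n" for d a
    using mf[of d] that by (simp add: moment_families_def)
  obtain k :: real and E :: nat where k: "k > 0"
    and form: "\<And>y n I I' F c. \<lbrakk>pos_on (I \<times> {..<n}) (hankel_kernel y); pos_on (I' \<times> {..<\<mu>} \<times> {..<n}) (loc_kernel \<mu> p y);
       finite F; \<And>x. x \<in> F \<Longrightarrow> snd x < n;
       \<And>u x. \<lbrakk>x \<in> F; u \<in> words_upto g E\<rbrakk> \<Longrightarrow> u @ fst x \<in> I \<inter> I'\<rbrakk> \<Longrightarrow>
       (\<Sum>i<g. moment_form y F c [i, i]) \<le> of_real (k\<^sup>2) * moment_form y F c []"
    by (rule archimedean_form[OF arch p]) blast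
  have bound: "cmod (Z d w $$ (a, b)) \<le> k ^ length w"
    if "w \<in> words g" "length w + E \<le> \<delta> + d" "a < n" "b < n" for d w a b
  proof (rule hankel_bound[where y = "entries (Z d)", OF _ ph _ one _ that])
    fix F c
    assume "finite (F :: (ncword \<times> nat) set)" "\<And>x. x \<in> F \<Longrightarrow> snd x < n"
      "\<And>u x. \<lbrakk>x \<in> F; u \<in> words_upto g E\<rbrakk> \<Longrightarrow> u @ fst x \<in> words_upto g (\<delta> + d)"
    moreover have "words_upto g (\<delta> + d) \<subseteq> words_upto g (D d)" by (auto simp: words_upto_def D_def)
    ultimately show "(\<Sum>i<g. moment_form (entries (Z d)) F c [i, i])
        \<le> of_real (k\<^sup>2) * moment_form (entries (Z d)) F c []"
      by (intro form[OF ph pl]) auto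
  qed (use k in \<open>auto simp: D_def\<close>)
  \<comment> \<open>Entries for which the bound is not yet available are set to 0. Each coordinate
    is then bounded over all \<open>d\<close>, and for a valid index only finitely many terms
    change.\<close>
  define f where "f d = (\<lambda>(w, a, b).
    if w \<in> words g \<and> length w + E \<le> \<delta> + d \<and> a < n \<and> b < n then Z d w $$ (a, b) else 0)" for d
  have "\<exists>B. \<forall>d. cmod (f d t) \<le> B" for t
    using bound k by (intro exI[of _ "k ^ length (fst t)"]) (auto simp: f_def split: prod.split)
  then obtain r where r: "strict_mono r" and conv: "\<And>t. convergent (\<lambda>m. f (r m) t)"
    using diagonal_convergence[of f] by blast
  have large: "eventually (\<lambda>m. L \<le> r m) sequentially" for L
    using filterlim_subseq[OF r] by (simp add: filterlim_at_top)
  define y where "y w a b = lim (\<lambda>m. f (r m) (w, a, b))" for w a b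
  have y: "(\<lambda>m. Z (r m) w $$ (a, b)) \<longlonglongrightarrow> y w a b" if "w \<in> words g" "a < n" "b < n" for w a b
  proof (rule Lim_transform_eventually)
    show "(\<lambda>m. f (r m) (w, a, b)) \<longlonglongrightarrow> y w a b"
      using conv[of "(w, a, b)"] by (simp add: y_def convergent_LIMSEQ_iff)
    show "eventually (\<lambda>m. f (r m) (w, a, b) = Z (r m) w $$ (a, b)) sequentially"
      using large[of "length w + E"] by eventually_elim (use that in \<open>auto simp: f_def\<close>)
  qed
  have inN: "eventually (\<lambda>m. w \<in> words_upto g (N (r m))) sequentially" if "w \<in> words g" for w
    using large[of "length w"] by eventually_elim (use that in \<open>auto simp: N_def words_upto_def\<close>)
  define Y where "Y = (\<lambda>w\<in>words g. mat n n (\<lambda>(a, b). y w a b))"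
  have hat: "hat g Y = X"
  proof (rule nth_equalityI)
    show len: "length (hat g Y) = length X" using ZX[of 0] by (auto simp: hat_def)
    fix i assume "i < length (hat g Y)"
    then have i: "i < g" by (simp add: hat_def)
    have Zi: "Z d [i] = X ! i" for d using ZX[of d, symmetric] i by (simp add: hat_def)
    have c: "X ! i \<in> carrier_mat n n"
      using moment_families_carrier[OF mf, of "[i]" 0] i by (simp add: Zi words_upto_def N_def)
    have "y [i] a b = X ! i $$ (a, b)" if "a < n" "b < n" for a b
      using LIMSEQ_unique[OF y[of "[i]" a b]] that i by (simp add: Zi)
    then show "hat g Y ! i = X ! i" using c i by (intro eq_matI) (auto simp: hat_def Y_def)
  qed
  have "Y \<in> moment_families g \<Gamma> n (words g)"
    unfolding moment_families_def mem_Collect_eq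
  proof (intro conjI ballI)
    show "Y \<in> words g \<rightarrow>\<^sub>E carrier_mat n n" by (auto simp: Y_def)
    have "y [] a b = 1\<^sub>m n $$ (a, b)" if "a < n" "b < n" for a b
    proof (rule LIMSEQ_unique[OF y])
      have "Z d [] = 1\<^sub>m n" for d using mf[of d] by (simp add: moment_families_def)
      then show "(\<lambda>m. Z (r m) [] $$ (a, b)) \<longlonglongrightarrow> 1\<^sub>m n $$ (a, b)" by simp
    qed (use that in auto)
    then show "Y [] = 1\<^sub>m n" by (intro eq_matI) (auto simp: Y_def)
    fix w assume w: "w \<in> words g"
    have "y (rev w) a b = cnj (y w b a)" if ab: "a < n" "b < n" for a b
    proof (rule LIMSEQ_unique[OF y])
      have "(\<lambda>m. cnj (Z (r m) w $$ (b, a))) \<longlonglongrightarrow> cnj (y w b a)"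
        using w ab by (intro tendsto_cnj y)
      moreover have "eventually (\<lambda>m. cnj (Z (r m) w $$ (b, a)) = Z (r m) (rev w) $$ (a, b)) sequentially"
        using inN[OF w]
      proof eventually_elim
        case (elim m)
        then have "Z (r m) (rev w) = mat_adjoint (Z (r m) w)" "Z (r m) w \<in> carrier_mat n n"
          using mf[of "r m"] moment_families_carrier[OF mf] by (auto simp: moment_families_def)
        then show ?case using ab by simp
      qed
      ultimately show "(\<lambda>m. Z (r m) (rev w) $$ (a, b)) \<longlonglongrightarrow> cnj (y w b a)"
        by (rule Lim_transform_eventually)
    qed (use w ab in auto)
    then show "Y (rev w) = mat_adjoint (Y w)" using w by (intro eq_matI) (auto simp: Y_def)
  next
    fix \<gamma> assume \<gamma>: "\<gamma> \<in> set \<Gamma>"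
    have s: "supp \<gamma> \<subseteq> words g" using \<Gamma>[OF \<gamma>] by (simp add: is_ncpoly_def)
    \<comment> \<open>The right side is the same matrix for every \<open>d\<close>, because the
      degree-one part is always \<open>X\<close>; (M) therefore passes to the limit as a linear
      equation.\<close>
    have e: "msum n n (\<lambda>m. \<gamma> m \<cdot>\<^sub>m Z d m) (supp \<gamma>) = eval_mat n X \<gamma>" for d
      using mf[of d] \<gamma> by (simp add: moment_families_def ZX)
    have sN: "w \<in> words_upto g (N d)" if "w \<in> supp \<gamma>" for w d
      using ncdeg_ge[of g \<gamma> w] \<Gamma>[OF \<gamma>] that s by (auto simp: N_def words_upto_def)
    have "(\<Sum>w\<in>supp \<gamma>. \<gamma> w * y w a b) = eval_mat n X \<gamma> $$ (a, b)" if ab: "a < n" "b < n" for a b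
    proof (rule LIMSEQ_unique)
      show "(\<lambda>m. \<Sum>w\<in>supp \<gamma>. \<gamma> w * Z (r m) w $$ (a, b)) \<longlonglongrightarrow> (\<Sum>w\<in>supp \<gamma>. \<gamma> w * y w a b)"
        using s ab by (intro tendsto_intros y) auto
      have "(\<Sum>w\<in>supp \<gamma>. \<gamma> w * Z d w $$ (a, b)) = eval_mat n X \<gamma> $$ (a, b)" for d
      proof -
        have "\<gamma> w * Z d w $$ (a, b) = (\<gamma> w \<cdot>\<^sub>m Z d w) $$ (a, b)" if "w \<in> supp \<gamma>" for w
          using moment_families_carrier[OF mf sN[OF that], of d] ab by simp
        then show ?thesis unfolding e[of d, symmetric] using ab by simp
      qed
      then show "(\<lambda>m. \<Sum>w\<in>supp \<gamma>. \<gamma> w * Z (r m) w $$ (a, b)) \<longlonglongrightarrow> eval_mat n X \<gamma> $$ (a, b)" by simp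
    qed
    moreover have "(\<Sum>w\<in>supp \<gamma>. (\<gamma> w \<cdot>\<^sub>m Y w) $$ (a, b)) = (\<Sum>w\<in>supp \<gamma>. \<gamma> w * y w a b)"
      if "a < n" "b < n" for a b
      using that s by (intro sum.cong refl) (auto simp: Y_def)
    ultimately show "msum n n (\<lambda>m. \<gamma> m \<cdot>\<^sub>m Y m) (supp \<gamma>) = eval_mat n (hat g Y) \<gamma>"
      unfolding hat by (intro eq_matI) (auto simp: eval_mat_def)
  qed
  moreover have "pos_on (words g \<times> {..<n}) (hankel_kernel (entries Y))"
  proof (rule pos_on_limit[where N = "\<lambda>m. hankel_kernel (entries (Z (r m)))"])
    fix s t assume "s \<in> words g \<times> {..<n}" "t \<in> words g \<times> {..<n}"
    then show "(\<lambda>m. hankel_kernel (entries (Z (r m))) s t) \<longlonglongrightarrow> hankel_kernel (entries Y) s t"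
      by (auto simp: hankel_kernel_def Y_def intro!: y)
  next
    fix F assume F: "finite F" "F \<subseteq> words g \<times> {..<n}"
    then obtain L where L: "\<And>d. L \<le> d \<Longrightarrow> F \<subseteq> words_upto g d \<times> {..<n}"
      by (rule finite_words_bounded) blast
    show "eventually (\<lambda>m. pos_on F (hankel_kernel (entries (Z (r m))))) sequentially"
      using large[of L]
    proof eventually_elim
      case (elim m)
      then show ?case using L[of "D (r m)"] by (intro pos_on_subset[OF ph]) (auto simp: D_def)
    qed
  qed
  moreover have "pos_on (words g \<times> {..<\<mu>} \<times> {..<n}) (loc_kernel \<mu> p (entries Y))"
  proof (rule pos_on_limit[where N = "\<lambda>m. loc_kernel \<mu> p (entries (Z (r m)))"])
    fix s t assume "s \<in> words g \<times> {..<\<mu>} \<times> {..<n}" "t \<in> words g \<times> {..<\<mu>} \<times> {..<n}"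
    then show "(\<lambda>m. loc_kernel \<mu> p (entries (Z (r m))) s t) \<longlonglongrightarrow> loc_kernel \<mu> p (entries Y) s t"
      using p by (auto simp: loc_kernel_def Y_def is_ncmpoly_def subset_iff intro!: tendsto_intros y)
  next
    fix F assume F: "finite F" "F \<subseteq> words g \<times> {..<\<mu>} \<times> {..<n}"
    then obtain L where L: "\<And>d. L \<le> d \<Longrightarrow> F \<subseteq> words_upto g d \<times> {..<\<mu>} \<times> {..<n}"
      by (rule finite_words_bounded) blast
    show "eventually (\<lambda>m. pos_on F (loc_kernel \<mu> p (entries (Z (r m))))) sequentially"
      using large[of L]
    proof eventually_elim
      case (elim m)
      then show ?case using L[of "\<delta> + r m"] by (intro pos_on_subset[OF pl]) auto
    qed
  qed
  ultimately have "Y \<in> L_inf g \<Gamma> \<mu> p n" by (simp add: L_inf_iff[OF p])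
  then show "X \<in> L_inf_hat g \<Gamma> \<mu> p n" using hat by (auto simp: L_inf_hat_def)
qed

section \<open>Realization by operators\<close>

lemma complex_nonneg_limit:
  fixes f :: "nat \<Rightarrow> complex"
  assumes "f \<longlonglongrightarrow> l" "\<And>n. 0 \<le> f n"
  shows "0 \<le> l"
proof -
  have "0 \<le> Re l"
    by (rule tendsto_lowerbound[OF tendsto_Re[OF assms(1)]])
      (use assms(2) in \<open>auto simp: less_eq_complex_def\<close>)
  moreover have "(\<lambda>n. Im (f n)) = (\<lambda>n. 0)" using assms(2) by (auto simp: less_eq_complex_def)
  then have "Im l = 0" using tendsto_Im[OF assms(1)] LIMSEQ_const_iff by metis
  ultimately show ?thesis by (simp add: less_eq_complex_def)
qed

section \<open>Continuity of inner products and of the form of \<open>p\<close>\<close>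

context pre_hilbert begin

lemma minus_eq_smult: "x \<in> carrier H \<Longrightarrow> y \<in> carrier H \<Longrightarrow> x \<ominus> y = x \<oplus> (-1) \<odot> y"
  using smult_l_minus[of 1 y] smult_one[of y] by (simp add: class_ring_simps a_minus_def)

lemma ip_minus:
  "\<lbrakk>x \<in> carrier H; y \<in> carrier H; z \<in> carrier H\<rbrakk> \<Longrightarrow> ip H (x \<ominus> y) z = ip H x z - ip H y z"
  by (simp add: minus_eq_smult ip_add ip_smult smult_closed)

lemma ip_minus_right:
  "\<lbrakk>x \<in> carrier H; y \<in> carrier H; z \<in> carrier H\<rbrakk> \<Longrightarrow> ip H z (x \<ominus> y) = ip H z x - ip H z y"
  by (simp add: minus_eq_smult ip_add_right ip_smult_right smult_closed)

lemma tendsto_ip: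
  assumes x: "\<And>N. x N \<in> carrier H" "x' \<in> carrier H" and xlim: "(\<lambda>N. hnorm H (x N \<ominus> x')) \<longlonglongrightarrow> 0"
    and z: "\<And>N. z N \<in> carrier H" "z' \<in> carrier H" and zlim: "(\<lambda>N. hnorm H (z N \<ominus> z')) \<longlonglongrightarrow> 0"
  shows "(\<lambda>N. ip H (x N) (z N)) \<longlonglongrightarrow> ip H x' z'"
proof -
  let ?b = "\<lambda>N. hnorm H (x N \<ominus> x') * hnorm H (z N \<ominus> z') + hnorm H (x N \<ominus> x') * hnorm H z'
      + hnorm H x' * hnorm H (z N \<ominus> z')"
  have "?b \<longlonglongrightarrow> 0 * 0 + 0 * hnorm H z' + hnorm H x' * 0"
    by (intro tendsto_intros xlim zlim)
  then have lim: "?b \<longlonglongrightarrow> 0" by simp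
  have le: "norm (ip H (x N) (z N) - ip H x' z') \<le> ?b N" for N
  proof -
    have m: "x N \<ominus> x' \<in> carrier H" "z N \<ominus> z' \<in> carrier H" using x z by auto
    have "ip H (x N) (z N) - ip H x' z'
      = ip H (x N \<ominus> x') (z N \<ominus> z') + ip H (x N \<ominus> x') z' + ip H x' (z N \<ominus> z')"
      using x z m by (simp add: ip_minus ip_minus_right)
    also have "norm \<dots> \<le> norm (ip H (x N \<ominus> x') (z N \<ominus> z')) + norm (ip H (x N \<ominus> x') z')
        + norm (ip H x' (z N \<ominus> z'))"
      by (intro norm_triangle_mono order_refl)
    also have "\<dots> \<le> ?b N" using x z m by (intro add_mono Cauchy_Schwarz)
    finally show ?thesis .
  qed
  have "(\<lambda>N. ip H (x N) (z N) - ip H x' z') \<longlonglongrightarrow> 0"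
    by (rule Lim_null_comparison[OF always_eventually[OF allI[OF le]] lim])
  then show ?thesis by (rule LIM_zero_cancel)
qed

end

context sa_tuple begin

lemma word_op_bounded:
  assumes "w \<in> words g"
  shows "\<exists>C\<ge>0. \<forall>x\<in>carrier H. hnorm H (word_op Y w x) \<le> C * hnorm H x"
  using assms
proof (induction w)
  case Nil
  show ?case by (intro exI[of _ 1]) simp
next
  case (Cons i w)
  then obtain C where C: "C \<ge> 0" "\<And>x. x \<in> carrier H \<Longrightarrow> hnorm H (word_op Y w x) \<le> C * hnorm H x" by auto
  have "i < g" using Cons.prems by simp
  then obtain D where D: "\<And>x. x \<in> carrier H \<Longrightarrow> hnorm H ((Y ! i) x) \<le> D * hnorm H x"
    using nth_sa[of i] by (auto simp: bounded_sa_ops_def)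
  show ?case
  proof (intro exI[of _ "\<bar>D\<bar> * C"] conjI ballI)
    show "0 \<le> \<bar>D\<bar> * C" using C by simp
    fix x assume x: "x \<in> carrier H"
    have wx: "word_op Y w x \<in> carrier H" using Cons.prems x by (intro word_op_closed) auto
    have "hnorm H (word_op Y (i # w) x) \<le> D * hnorm H (word_op Y w x)" using D[OF wx] by simp
    also have "\<dots> \<le> \<bar>D\<bar> * hnorm H (word_op Y w x)" using hnorm_nonneg[OF wx] by (intro mult_right_mono) auto
    also have "\<dots> \<le> \<bar>D\<bar> * (C * hnorm H x)" using C(2)[OF x] by (intro mult_left_mono) auto
    finally show "hnorm H (word_op Y (i # w) x) \<le> \<bar>D\<bar> * C * hnorm H x" by (simp add: mult.assoc)
  qed
qed

lemma word_op_minus: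
  "w \<in> words g \<Longrightarrow> x \<in> carrier H \<Longrightarrow> y \<in> carrier H \<Longrightarrow>
    word_op Y w (x \<ominus> y) = word_op Y w x \<ominus> word_op Y w y"
  by (simp add: minus_eq_smult word_op_add word_op_smult word_op_closed smult_closed)

lemma tendsto_word_op:
  assumes "w \<in> words g" and x: "\<And>N. x N \<in> carrier H" "x' \<in> carrier H"
    and xlim: "(\<lambda>N. hnorm H (x N \<ominus> x')) \<longlonglongrightarrow> 0"
  shows "(\<lambda>N. hnorm H (word_op Y w (x N) \<ominus> word_op Y w x')) \<longlonglongrightarrow> 0"
proof -
  obtain C where C: "C \<ge> 0" "\<And>x. x \<in> carrier H \<Longrightarrow> hnorm H (word_op Y w x) \<le> C * hnorm H x"
    using word_op_bounded[OF assms(1)] by blast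
  have "norm (hnorm H (word_op Y w (x N) \<ominus> word_op Y w x')) \<le> norm (hnorm H (x N \<ominus> x')) * C" for N
  proof -
    have c: "x N \<ominus> x' \<in> carrier H" using x by auto
    have "hnorm H (word_op Y w (x N \<ominus> x')) \<le> C * hnorm H (x N \<ominus> x')" by (rule C(2)[OF c])
    then show ?thesis using assms(1) x c hnorm_nonneg[OF c] hnorm_nonneg[OF word_op_closed[OF assms(1) c]]
      by (simp add: word_op_minus mult.commute)
  qed
  then show ?thesis by (intro tendsto_0_le[OF xlim]) (auto intro!: always_eventually)
qed

text \<open>The form is a finite combination of inner products of words applied to the components,
  and both words and inner products are continuous in the norm.\<close>

lemma mop_form_limit:
  assumes p: "is_ncmpoly g \<mu> \<mu> p" and \<xi>: "\<And>N. \<xi> N \<in> {..<\<mu>} \<rightarrow> carrier H" "\<xi>' \<in> {..<\<mu>} \<rightarrow> carrier H"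
    and lim: "\<And>j. j < \<mu> \<Longrightarrow> (\<lambda>N. hnorm H (\<xi> N j \<ominus> \<xi>' j)) \<longlonglongrightarrow> 0"
    and pos: "\<And>N. 0 \<le> (\<Sum>i<\<mu>. ip H (eval_mop H \<mu> Y p (\<xi> N) i) (\<xi> N i))"
  shows "0 \<le> (\<Sum>i<\<mu>. ip H (eval_mop H \<mu> Y p \<xi>' i) (\<xi>' i))"
proof (rule complex_nonneg_limit[OF _ pos])
  have m: "msupp \<mu> \<mu> p \<subseteq> words g" using p by (simp add: is_ncmpoly_def)
  have e: "(\<Sum>i<\<mu>. ip H (eval_mop H \<mu> Y p \<zeta> i) (\<zeta> i)) =
     (\<Sum>i<\<mu>. \<Sum>j<\<mu>. \<Sum>w\<in>msupp \<mu> \<mu> p. p w $$ (i, j) * ip H (word_op Y w (\<zeta> j)) (\<zeta> i))"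
    if "\<zeta> \<in> {..<\<mu>} \<rightarrow> carrier H" for \<zeta>
    using that by (intro sum.cong refl ip_eval_mop[OF p]) auto
  show "(\<lambda>N. \<Sum>i<\<mu>. ip H (eval_mop H \<mu> Y p (\<xi> N) i) (\<xi> N i)) \<longlonglongrightarrow>
      (\<Sum>i<\<mu>. ip H (eval_mop H \<mu> Y p \<xi>' i) (\<xi>' i))"
    unfolding e[OF \<xi>(1)] e[OF \<xi>(2)]
  proof (intro tendsto_sum tendsto_mult tendsto_const tendsto_ip tendsto_word_op lim)
    fix i j w assume *: "i \<in> {..<\<mu>}" "j \<in> {..<\<mu>}" "w \<in> msupp \<mu> \<mu> p"
    then show w: "w \<in> words g" using m by auto
    show x: "\<xi> N i \<in> carrier H" "\<xi>' i \<in> carrier H" "\<xi> N j \<in> carrier H" "\<xi>' j \<in> carrier H" for N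
      using * \<xi> by (auto simp: Pi_iff)
    show "word_op Y w (\<xi> N j) \<in> carrier H" "word_op Y w (\<xi>' j) \<in> carrier H" for N
      using w x by (auto intro: word_op_closed)
    show "j < \<mu>" "i < \<mu>" using * by auto
  qed
qed

end

section \<open>Bounded self-adjoint operators given by matrices\<close>

lemma finsum_ell2:
  assumes "f \<in> A \<rightarrow> sqsum J"
  shows "finsum (ell2 J) f A = (\<lambda>l. \<Sum>a\<in>A. f a l)"
proof -
  interpret pre_hilbert "ell2 J" by (rule ell2_pre_hilbert)
  show ?thesis using assms
    by (induction A rule: infinite_finite_induct) (auto simp: M.finsum_infinite M.finsum_insert)
qed

lemma ip_finite_support_left:
  assumes "\<And>k. M \<le> k \<Longrightarrow> x k = 0"
  shows "ip (ell2 J) x y = (\<Sum>k<M. x k * cnj (y k))"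
  unfolding ell2_simps by (rule suminf_finite) (use assms in auto)

lemma ip_finite_support_right:
  assumes "\<And>k. M \<le> k \<Longrightarrow> y k = 0"
  shows "ip (ell2 J) x y = (\<Sum>k<M. x k * cnj (y k))"
  unfolding ell2_simps by (rule suminf_finite) (use assms in auto)

lemma trunc_hnorm_tendsto:
  assumes "x \<in> sqsum J"
  shows "(\<lambda>N. hnorm (ell2 J) (trunc N x \<ominus>\<^bsub>ell2 J\<^esub> x)) \<longlonglongrightarrow> 0"
proof -
  have "hnorm (ell2 J) (trunc N x \<ominus>\<^bsub>ell2 J\<^esub> x) = sqrt (sqnorm (\<lambda>k. x k - trunc N x k))" for N
    using assms trunc_sqsum[OF assms, of N]
    by (simp add: hnorm_ell2 sqsum_diff sqnorm_def norm_minus_commute)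
  moreover have "(\<lambda>N. sqrt (sqnorm (\<lambda>k. x k - trunc N x k))) \<longlonglongrightarrow> sqrt 0"
    by (intro tendsto_real_sqrt trunc_tendsto[OF assms])
  ultimately show ?thesis by simp
qed

text \<open>For hermitian \<open>d\<close> this is the operator whose matrix has the columns \<open>d k\<close>; defining it
  through inner products avoids extending it from the finitely supported sequences.\<close>

definition matrix_op :: "nat set \<Rightarrow> (nat \<Rightarrow> nat \<Rightarrow> complex) \<Rightarrow> (nat \<Rightarrow> complex) \<Rightarrow> nat \<Rightarrow> complex" where
  "matrix_op J d x = (\<lambda>k. if k \<in> J then ip (ell2 J) x (d k) else 0)"

text \<open>\<open>bd\<close> controls finite combinations of columns. For a general
  \<open>x\<close>, the first \<open>M\<close> coordinates of the image are estimated by pairing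
  \<open>x\<close> with the combination of columns whose coefficients are these coordinates
  themselves. Self-adjointness is first proved against truncations.\<close>

lemma matrix_op_bounded_sa:
  assumes d: "\<And>k. k \<in> J \<Longrightarrow> d k \<in> sqsum J"
    and herm: "\<And>j k. j \<in> J \<Longrightarrow> k \<in> J \<Longrightarrow> d j k = cnj (d k j)"
    and "0 \<le> C"
    and bd: "\<And>M z. sqnorm (\<lambda>l. \<Sum>k\<in>J \<inter> {..<M}. z k * d k l) \<le> C\<^sup>2 * (\<Sum>k\<in>J \<inter> {..<M}. (cmod (z k))\<^sup>2)"
  shows "matrix_op J d \<in> bounded_sa_ops (ell2 J)"
proof -
  interpret pre_hilbert "ell2 J" by (rule ell2_pre_hilbert)
  let ?T = "matrix_op J d"
  have comb: "(\<lambda>l. \<Sum>k\<in>J \<inter> {..<M}. z k * d k l) \<in> sqsum J"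
    and combfs: "finsum (ell2 J) (\<lambda>k. z k \<odot>\<^bsub>ell2 J\<^esub> d k) (J \<inter> {..<M}) = (\<lambda>l. \<Sum>k\<in>J \<inter> {..<M}. z k * d k l)" for M z
  proof -
    have c: "(\<lambda>k. z k \<odot>\<^bsub>ell2 J\<^esub> d k) \<in> J \<inter> {..<M} \<rightarrow> carrier (ell2 J)"
      using d by (auto intro!: sqsum_smult)
    show e: "finsum (ell2 J) (\<lambda>k. z k \<odot>\<^bsub>ell2 J\<^esub> d k) (J \<inter> {..<M}) = (\<lambda>l. \<Sum>k\<in>J \<inter> {..<M}. z k * d k l)"
      using c by (subst finsum_ell2) auto
    show "(\<lambda>l. \<Sum>k\<in>J \<inter> {..<M}. z k * d k l) \<in> sqsum J"
      using M.finsum_closed[OF c] unfolding e ell2_simps(1) .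
  qed
  have ipcomb: "ip (ell2 J) x (\<lambda>l. \<Sum>k\<in>J \<inter> {..<M}. z k * d k l) = (\<Sum>k\<in>J \<inter> {..<M}. ?T x k * cnj (z k))"
    if x: "x \<in> sqsum J" for x z M
  proof -
    have c: "(\<lambda>k. z k \<odot>\<^bsub>ell2 J\<^esub> d k) \<in> J \<inter> {..<M} \<rightarrow> carrier (ell2 J)"
      using d by (auto intro!: sqsum_smult)
    have "ip (ell2 J) x (\<lambda>l. \<Sum>k\<in>J \<inter> {..<M}. z k * d k l)
      = (\<Sum>k\<in>J \<inter> {..<M}. ip (ell2 J) x (z k \<odot>\<^bsub>ell2 J\<^esub> d k))"
      unfolding combfs[symmetric] using x by (intro ip_finsum_right c) simp
    also have "\<dots> = (\<Sum>k\<in>J \<inter> {..<M}. ?T x k * cnj (z k))"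
      using x d by (intro sum.cong refl, subst ip_smult_right) (auto simp: matrix_op_def simp del: ell2_simps(5))
    finally show ?thesis .
  qed
  \<comment> \<open>On finitely supported sequences the definition by inner products agrees with the
    combination of columns; this is where \<open>herm\<close> enters.\<close>
  have fs: "?T x = (\<lambda>l. \<Sum>k\<in>J \<inter> {..<M}. x k * d k l)" if "x \<in> sqsum J" "\<And>k. M \<le> k \<Longrightarrow> x k = 0" for x M
  proof
    fix l
    show "?T x l = (\<Sum>k\<in>J \<inter> {..<M}. x k * d k l)"
    proof (cases "l \<in> J")
      case True
      have "?T x l = (\<Sum>k<M. x k * cnj (d l k))"
        using True ip_finite_support_left[of M x J "d l", OF that(2)] by (simp add: matrix_op_def)
      also have "\<dots> = (\<Sum>k\<in>J \<inter> {..<M}. x k * cnj (d l k))"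
        using that(1) by (intro sum.mono_neutral_right) (auto simp: sqsum_def)
      also have "\<dots> = (\<Sum>k\<in>J \<inter> {..<M}. x k * d k l)"
        using True by (intro sum.cong refl) (simp add: herm[of _ l])
      finally show ?thesis .
    next
      case False
      then have "d k l = 0" if "k \<in> J" for k using d[OF that] by (simp add: sqsum_def)
      then show ?thesis using False by (simp add: matrix_op_def)
    qed
  qed
  have part: "(\<Sum>k<M. (cmod (?T x k))\<^sup>2) \<le> C\<^sup>2 * sqnorm x" if x: "x \<in> sqsum J" for x M
  proof -
    define q where "q = (\<Sum>k\<in>J \<inter> {..<M}. (cmod (?T x k))\<^sup>2)"
    let ?z = "\<lambda>l. \<Sum>k\<in>J \<inter> {..<M}. ?T x k * d k l"
    have q: "(\<Sum>k<M. (cmod (?T x k))\<^sup>2) = q"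
      unfolding q_def by (intro sum.mono_neutral_right) (auto simp: matrix_op_def)
    have q0: "0 \<le> q" unfolding q_def by (intro sum_nonneg) auto
    \<comment> \<open>Cauchy-Schwarz and \<open>bd\<close> give \<open>q <= |x| C sqrt q\<close>,
      hence \<open>q <= C^2 |x|^2\<close> uniformly in \<open>M\<close>.\<close>
    have "complex_of_real q = ip (ell2 J) x ?z"
      unfolding ipcomb[OF x] q_def by (simp only: of_real_sum complex_norm_square)
    then have "q = cmod (ip (ell2 J) x ?z)" using q0 by (metis norm_of_real abs_of_nonneg)
    also have "\<dots> \<le> hnorm (ell2 J) x * hnorm (ell2 J) ?z"
      using x comb by (intro Cauchy_Schwarz) auto
    also have "\<dots> \<le> sqrt (sqnorm x) * sqrt (C\<^sup>2 * q)"
      using bd[of "?T x" M] x comb sqnorm_nonneg[OF x]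
      by (simp only: hnorm_ell2) (intro mult_left_mono real_sqrt_le_mono, simp_all add: q_def)
    finally have "q \<le> sqrt (C\<^sup>2 * sqnorm x) * sqrt q"
      by (simp add: real_sqrt_mult mult_ac)
    then have "q\<^sup>2 \<le> C\<^sup>2 * sqnorm x * q"
      using q0 sqnorm_nonneg[OF x] power_mono[of q "sqrt (C\<^sup>2 * sqnorm x) * sqrt q" 2]
      by (simp add: power_mult_distrib)
    then show ?thesis unfolding q using q0 sqnorm_nonneg[OF x] \<open>0 \<le> C\<close>
      by (cases "q = 0") (auto simp: power2_eq_square)
  qed
  have T: "?T x \<in> sqsum J" if x: "x \<in> sqsum J" for x
  proof (rule sqsumI)
    show "summable (\<lambda>k. (cmod (?T x k))\<^sup>2)"
    proof (rule bounded_imp_summable[of _ "C\<^sup>2 * sqnorm x"])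
      show "(\<Sum>k\<le>m. (cmod (?T x k))\<^sup>2) \<le> C\<^sup>2 * sqnorm x" for m
        using part[OF x, of "Suc m"] by (simp only: lessThan_Suc_atMost)
    qed simp
  qed (simp add: matrix_op_def)
  have Tadd: "?T (x \<oplus>\<^bsub>ell2 J\<^esub> y) = ?T x \<oplus>\<^bsub>ell2 J\<^esub> ?T y" if "x \<in> sqsum J" "y \<in> sqsum J" for x y
    using that d ip_add[of x y] unfolding matrix_op_def by (intro ext) (simp del: ell2_simps(5) add: ell2_simps(3))
  have Tsm: "?T (c \<odot>\<^bsub>ell2 J\<^esub> x) = c \<odot>\<^bsub>ell2 J\<^esub> ?T x" if "x \<in> sqsum J" for x c
    using that d ip_smult[of x _ c] unfolding matrix_op_def by (intro ext) (simp del: ell2_simps(5))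
  have Tbd: "hnorm (ell2 J) (?T x) \<le> C * hnorm (ell2 J) x" if x: "x \<in> sqsum J" for x
  proof -
    have "sqnorm (?T x) \<le> C\<^sup>2 * sqnorm x" by (rule sqnorm_le[OF T[OF x] part[OF x]])
    then have "sqrt (sqnorm (?T x)) \<le> sqrt (C\<^sup>2 * sqnorm x)" by (rule real_sqrt_le_mono)
    then show ?thesis using \<open>0 \<le> C\<close> by (simp add: hnorm_ell2[OF x] hnorm_ell2[OF T[OF x]] real_sqrt_mult)
  qed
  \<comment> \<open>Against a finitely supported second argument both sides are the same finite sum;
    the general case follows by letting \<open>N\<close> grow.\<close>
  have sym0: "ip (ell2 J) (?T x) (trunc N y) = ip (ell2 J) x (?T (trunc N y))"
    if x: "x \<in> sqsum J" and y: "y \<in> sqsum J" for x y N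
  proof -
    have t: "trunc N y \<in> sqsum J" by (rule trunc_sqsum[OF y])
    have "ip (ell2 J) (?T x) (trunc N y) = (\<Sum>k<N. ?T x k * cnj (trunc N y k))"
      by (rule ip_finite_support_right) (simp add: trunc_def)
    also have "\<dots> = (\<Sum>k\<in>J \<inter> {..<N}. ?T x k * cnj (trunc N y k))"
      by (intro sum.mono_neutral_right) (auto simp: matrix_op_def)
    also have "\<dots> = ip (ell2 J) x (?T (trunc N y))"
      using ipcomb[OF x, of "trunc N y" N] fs[OF t, of N] by (simp add: trunc_def)
    finally show ?thesis .
  qed
  have sym: "ip (ell2 J) (?T x) y = ip (ell2 J) x (?T y)" if x: "x \<in> sqsum J" and y: "y \<in> sqsum J" for x y
  proof (rule LIMSEQ_unique)
    have t: "trunc N y \<in> sqsum J" for N by (rule trunc_sqsum[OF y])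
    note lim = trunc_hnorm_tendsto[OF y]
    have const: "(\<lambda>N. hnorm (ell2 J) (z \<ominus>\<^bsub>ell2 J\<^esub> z)) \<longlonglongrightarrow> 0" if "z \<in> sqsum J" for z
      using that by (simp add: hnorm_def)
    show "(\<lambda>N. ip (ell2 J) (?T x) (trunc N y)) \<longlonglongrightarrow> ip (ell2 J) (?T x) y"
      by (rule tendsto_ip[OF _ _ const _ _ lim]) (use T x y t in auto)
    have Tlim: "(\<lambda>N. hnorm (ell2 J) (?T (trunc N y) \<ominus>\<^bsub>ell2 J\<^esub> ?T y)) \<longlonglongrightarrow> 0"
    proof (rule tendsto_0_le[OF lim])
      have "norm (hnorm (ell2 J) (?T (trunc N y) \<ominus>\<^bsub>ell2 J\<^esub> ?T y))
          \<le> norm (hnorm (ell2 J) (trunc N y \<ominus>\<^bsub>ell2 J\<^esub> y)) * C" for N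
      proof -
        have c: "trunc N y \<ominus>\<^bsub>ell2 J\<^esub> y \<in> sqsum J" using sqsum_diff[OF t y] t y by simp
        have ym: "(-1) \<odot>\<^bsub>ell2 J\<^esub> y \<in> sqsum J" using sqsum_smult[OF y, of "-1"] by simp
        have "?T (trunc N y \<ominus>\<^bsub>ell2 J\<^esub> y) = ?T (trunc N y \<oplus>\<^bsub>ell2 J\<^esub> (-1) \<odot>\<^bsub>ell2 J\<^esub> y)"
          using minus_eq_smult[of "trunc N y" y] t y by simp
        also have "\<dots> = ?T (trunc N y) \<oplus>\<^bsub>ell2 J\<^esub> (-1) \<odot>\<^bsub>ell2 J\<^esub> ?T y"
          unfolding Tadd[OF t ym] Tsm[OF y] ..
        also have "\<dots> = ?T (trunc N y) \<ominus>\<^bsub>ell2 J\<^esub> ?T y"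
          using minus_eq_smult[of "?T (trunc N y)" "?T y"] T t y by simp
        finally have "?T (trunc N y \<ominus>\<^bsub>ell2 J\<^esub> y) = ?T (trunc N y) \<ominus>\<^bsub>ell2 J\<^esub> ?T y" .
        moreover have "0 \<le> hnorm (ell2 J) (?T (trunc N y \<ominus>\<^bsub>ell2 J\<^esub> y))"
          "0 \<le> hnorm (ell2 J) (trunc N y \<ominus>\<^bsub>ell2 J\<^esub> y)"
          using hnorm_nonneg c T[OF c] by simp_all
        ultimately show ?thesis using Tbd[OF c] by (simp add: mult.commute del: ell2_minus)
      qed
      then show "eventually (\<lambda>N. norm (hnorm (ell2 J) (?T (trunc N y) \<ominus>\<^bsub>ell2 J\<^esub> ?T y))
          \<le> norm (hnorm (ell2 J) (trunc N y \<ominus>\<^bsub>ell2 J\<^esub> y)) * C) sequentially"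
        by (intro always_eventually allI)
    qed
    show "(\<lambda>N. ip (ell2 J) (?T x) (trunc N y)) \<longlonglongrightarrow> ip (ell2 J) x (?T y)"
      unfolding sym0[OF x y]
      by (rule tendsto_ip[OF _ _ const _ _ Tlim]) (use T x y t in auto)
  qed
  have "?T \<in> module_hom (class_ring :: complex ring) (ell2 J) (ell2 J)"
    unfolding module_hom_def using T Tadd Tsm by (simp del: ell2_simps(3,4,5)) 
  then show ?thesis
    unfolding bounded_sa_ops_def using Tbd sym by (auto simp del: ell2_simps(5))
qed

section \<open>The Hilbert space of a positive kernel\<close>

lemma sqsum_comb:
  assumes "\<And>t. t \<in> A \<Longrightarrow> u t \<in> sqsum J"
  shows "(\<lambda>l. \<Sum>t\<in>A. b t * u t l) \<in> sqsum J"
  using assms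
proof (induction A rule: infinite_finite_induct)
  case (insert t A)
  then have "(\<lambda>l. b t * u t l + (\<Sum>t\<in>A. b t * u t l)) \<in> sqsum J"
    by (intro sqsum_add sqsum_smult) auto
  with insert show ?case by simp
qed (simp_all add: sqsum_zero)

lemma ell2_ip_comb:
  assumes u: "\<And>t. t \<in> A \<Longrightarrow> u t \<in> sqsum J" and v: "\<And>s. s \<in> B \<Longrightarrow> v s \<in> sqsum J"
  shows "ip (ell2 J) (\<lambda>l. \<Sum>t\<in>A. b t * u t l) (\<lambda>l. \<Sum>s\<in>B. c s * v s l)
    = (\<Sum>s\<in>B. \<Sum>t\<in>A. ip (ell2 J) (u t) (v s) * b t * cnj (c s))"
proof -
  interpret pre_hilbert "ell2 J" by (rule ell2_pre_hilbert)
  have fu: "(\<lambda>t. b t \<odot>\<^bsub>ell2 J\<^esub> u t) \<in> A \<rightarrow> carrier (ell2 J)" using u by (auto intro: sqsum_smult)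
  have fv: "(\<lambda>s. c s \<odot>\<^bsub>ell2 J\<^esub> v s) \<in> B \<rightarrow> carrier (ell2 J)" using v by (auto intro: sqsum_smult)
  have eu: "(\<lambda>l. \<Sum>t\<in>A. b t * u t l) = finsum (ell2 J) (\<lambda>t. b t \<odot>\<^bsub>ell2 J\<^esub> u t) A"
    using fu by (subst finsum_ell2) auto
  have ev: "(\<lambda>l. \<Sum>s\<in>B. c s * v s l) = finsum (ell2 J) (\<lambda>s. c s \<odot>\<^bsub>ell2 J\<^esub> v s) B"
    using fv by (subst finsum_ell2) auto
  have cu: "finsum (ell2 J) (\<lambda>t. b t \<odot>\<^bsub>ell2 J\<^esub> u t) A \<in> carrier (ell2 J)" using fu by (rule M.finsum_closed)
  have "ip (ell2 J) (\<lambda>l. \<Sum>t\<in>A. b t * u t l) (\<lambda>l. \<Sum>s\<in>B. c s * v s l)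
    = (\<Sum>s\<in>B. ip (ell2 J) (finsum (ell2 J) (\<lambda>t. b t \<odot>\<^bsub>ell2 J\<^esub> u t) A) (c s \<odot>\<^bsub>ell2 J\<^esub> v s))"
    unfolding eu ev by (rule ip_finsum_right[OF fv cu])
  also have "\<dots> = (\<Sum>s\<in>B. \<Sum>t\<in>A. ip (ell2 J) (b t \<odot>\<^bsub>ell2 J\<^esub> u t) (c s \<odot>\<^bsub>ell2 J\<^esub> v s))"
    using fv by (intro sum.cong refl ip_finsum[OF fu]) auto
  also have "\<dots> = (\<Sum>s\<in>B. \<Sum>t\<in>A. ip (ell2 J) (u t) (v s) * b t * cnj (c s))"
  proof (intro sum.cong refl)
    fix s t assume "s \<in> B" "t \<in> A"
    then have c: "u t \<in> carrier (ell2 J)" "v s \<in> carrier (ell2 J)" "c s \<odot>\<^bsub>ell2 J\<^esub> v s \<in> carrier (ell2 J)"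
      using u v fv by auto
    show "ip (ell2 J) (b t \<odot>\<^bsub>ell2 J\<^esub> u t) (c s \<odot>\<^bsub>ell2 J\<^esub> v s) = ip (ell2 J) (u t) (v s) * b t * cnj (c s)"
      unfolding ip_smult[OF c(1,3)] ip_smult_right[OF c(2,1)] by simp
  qed
  finally show ?thesis .
qed

text \<open>The Gram vectors are the rows of the triangular factor in the enumeration of the index
  type. The last conclusion is a strong form of density; its restriction to indices with
  \<open>K s s \<noteq> 0\<close> confines the combinations in \<open>GNS\<close> to words over the
  variables and coordinates below \<open>n\<close>.\<close>

lemma Gram_representation:
  fixes K :: "'i::countable \<Rightarrow> 'i \<Rightarrow> complex"
  assumes pos: "pos_on UNIV K"
  obtains J and e :: "'i \<Rightarrow> nat \<Rightarrow> complex" where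
    "\<And>s. e s \<in> sqsum J"
    "\<And>s t. ip (ell2 J) (e t) (e s) = K s t"
    "\<And>k. k \<in> J \<Longrightarrow> \<exists>F c. finite F \<and> F \<subseteq> {s. K s s \<noteq> 0} \<and>
       (\<lambda>l. \<Sum>s\<in>F. c s * e s l) = (\<lambda>l. if l = k then 1 else 0)"
proof -
  let ?D = "range (to_nat :: 'i \<Rightarrow> nat)"
  \<comment> \<open>Numbers that are not codes of an index get a zero row and column.\<close>
  define K' where "K' m m' = (if m \<in> ?D \<and> m' \<in> ?D then K (from_nat m) (from_nat m') else 0)" for m m'
  have "pos_on UNIV K'"
    unfolding K'_def by (rule pos_on_zero_extend, rule pos_on_pullback[OF pos]) simp
  from Cholesky[OF this] obtain R where tri: "\<And>m k. m < k \<Longrightarrow> R m k = 0"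
    and zero: "\<And>m k. R k k = 0 \<Longrightarrow> R m k = 0"
    and K': "\<And>s t. K' s t = (\<Sum>l\<le>s. R t l * cnj (R s l))" by metis
  \<comment> \<open>A diagonal entry is the squared norm of its row, so a row with zero diagonal
    entry vanishes and can be omitted from combinations.\<close>
  have R0: "R m l = 0" if "K' m m = 0" for m l
  proof (cases "l \<le> m")
    case True
    have "of_real (\<Sum>l\<le>m. (cmod (R m l))\<^sup>2) = K' m m"
      unfolding K' of_real_sum complex_norm_square ..
    then have "(\<Sum>l\<le>m. (cmod (R m l))\<^sup>2) = 0" using that by (metis of_real_eq_0_iff)
    then show ?thesis using True by (subst (asm) sum_nonneg_eq_0_iff) auto
  qed (use tri in auto)
  define J where "J = {k. R k k \<noteq> 0}"
  define e where "e s = R (to_nat s)" for s :: 'i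
  have es: "e s \<in> sqsum J" for s
    by (rule sqsum_finite_support[of _ _ "to_nat s"]) (auto simp: e_def J_def tri zero)
  have Ke: "ip (ell2 J) (e t) (e s) = K s t" for s t
  proof -
    have "ip (ell2 J) (e t) (e s) = (\<Sum>k<Suc (to_nat s). e t k * cnj (e s k))"
      by (rule ip_finite_support_right) (simp add: e_def tri)
    also have "\<dots> = K' (to_nat s) (to_nat t)"
      unfolding K' e_def lessThan_Suc_atMost ..
    finally show ?thesis by (simp add: K'_def)
  qed
  have "\<exists>F c. finite F \<and> F \<subseteq> {s. K s s \<noteq> 0} \<and>
       (\<lambda>l. \<Sum>s\<in>F. c s * e s l) = (\<lambda>l. if l = k then 1 else 0)" if "k \<in> J" for k
  proof -
    obtain c where c: "\<And>l. (\<Sum>m\<le>k. c m * R m l) = (if l = k then 1 else 0)"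
      using triangular_span[of R k, OF tri zero] \<open>k \<in> J\<close> unfolding J_def by blast
    let ?F = "{s :: 'i. to_nat s \<le> k \<and> K s s \<noteq> 0}"
    have fin: "finite ?F"
      by (rule finite_subset[OF _ finite_vimageI[OF finite_atMost[of k] inj_to_nat]]) auto
    have "(\<Sum>s\<in>?F. c (to_nat s) * e s l) = (if l = k then 1 else 0)" for l
    proof -
      have "(\<Sum>s\<in>?F. c (to_nat s) * e s l) = (\<Sum>m\<in>to_nat ` ?F. c m * R m l)"
        by (subst sum.reindex) (auto simp: e_def intro: inj_on_subset[OF inj_to_nat])
      also have "\<dots> = (\<Sum>m\<le>k. c m * R m l)"
      proof (rule sum.mono_neutral_left)
        show "\<forall>m\<in>{..k} - to_nat ` ?F. c m * R m l = 0"
        proof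
          fix m assume m: "m \<in> {..k} - to_nat ` ?F"
          have "K' m m = 0"
          proof (cases "m \<in> ?D")
            case True
            then obtain s :: 'i where "m = to_nat s" by blast
            then show ?thesis using m by (auto simp: K'_def)
          qed (simp add: K'_def)
          then show "c m * R m l = 0" by (simp add: R0)
        qed
      qed auto
      finally show ?thesis by (simp add: c)
    qed
    then show ?thesis using fin by (intro exI[of _ ?F] exI[of _ "c \<circ> to_nat"]) auto
  qed
  with es Ke show ?thesis by (rule that)
qed

text \<open>In the Hilbert space of the Hankel kernel the variables act by left multiplication of words;
  the Archimedean inequality makes these operators bounded.\<close>

lemma GNS:
  fixes y :: "ncword \<Rightarrow> nat \<Rightarrow> nat \<Rightarrow> complex"
  assumes p: "is_ncmpoly g \<mu> \<mu> p"
    and y0: "\<And>w a b. \<not> (w \<in> words g \<and> a < n \<and> b < n) \<Longrightarrow> y w a b = 0"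
    and ph: "pos_on (words g \<times> {..<n}) (hankel_kernel y)"
    and pl: "pos_on (words g \<times> {..<\<mu>} \<times> {..<n}) (loc_kernel \<mu> p y)"
    and C: "0 \<le> C"
    and form: "\<And>F c. finite F \<Longrightarrow> F \<subseteq> words g \<times> {..<n} \<Longrightarrow>
      (\<Sum>i<g. moment_form y F c [i, i]) \<le> of_real (C\<^sup>2) * moment_form y F c []"
  obtains J T and u :: "nat \<Rightarrow> nat \<Rightarrow> complex" where
    "T \<in> pos_dom g \<mu> p (ell2 J)" "\<And>a. u a \<in> sqsum J"
    "\<And>w a b. w \<in> words g \<Longrightarrow> ip (ell2 J) (word_op T w (u b)) (u a) = y w a b"
proof -
  let ?I = "words g \<times> {..<n}"
  let ?K = "hankel_kernel y"
  \<comment> \<open>Left multiplication by the letter \<open>i\<close>, on the level of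
    indices.\<close>
  let ?sh = "\<lambda>i (s :: ncword \<times> nat). (i # fst s, snd s)"
  have y0': "y w a b \<noteq> 0 \<Longrightarrow> w \<in> words g \<and> a < n \<and> b < n" for w a b using y0 by blast
  have "pos_on UNIV (\<lambda>s t. if s \<in> ?I \<and> t \<in> ?I then ?K s t else 0)"
    by (rule pos_on_zero_extend[OF ph])
  moreover have "(\<lambda>s t. if s \<in> ?I \<and> t \<in> ?I then ?K s t else 0) = ?K"
    by (intro ext) (auto simp: hankel_kernel_def dest!: y0')
  ultimately have posK: "pos_on UNIV ?K" by simp
  \<comment> \<open>Since \<open>rev (i # \<alpha>) @ \<beta> = rev \<alpha> @ i # \<beta>\<close>,
    left multiplication is symmetric for the kernel.\<close>
  have Ksh: "?K (?sh i s) t = ?K s (?sh i t)" for i s t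
    by (simp add: hankel_kernel_def case_prod_unfold)
  have KI: "{s. ?K s s \<noteq> 0} \<subseteq> ?I" by (auto simp: hankel_kernel_def dest!: y0')
  obtain J and e :: "ncword \<times> nat \<Rightarrow> nat \<Rightarrow> complex" where e: "\<And>s. e s \<in> sqsum J"
    and Ke: "\<And>s t. ip (ell2 J) (e t) (e s) = ?K s t"
    and ex: "\<And>k. k \<in> J \<Longrightarrow> \<exists>F c. finite F \<and> F \<subseteq> {s. ?K s s \<noteq> 0} \<and>
       (\<lambda>l. \<Sum>s\<in>F. c s * e s l) = (\<lambda>l. if l = k then 1 else 0)"
    by (rule Gram_representation[OF posK]) blast
  define \<delta> :: "nat \<Rightarrow> nat \<Rightarrow> complex" where "\<delta> k = (\<lambda>l. if l = k then 1 else 0)" for k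
  \<comment> \<open>One representation of the unit vector by Gram vectors will be fixed for every
    \<open>k\<close> in \<open>J\<close>; its coefficients are zero outside the finite
    support.\<close>
  define P where "P k Fc \<longleftrightarrow> finite (fst Fc) \<and> fst Fc \<subseteq> ?I \<and>
     \<delta> k = (\<lambda>l. \<Sum>s\<in>fst Fc. snd Fc s * e s l) \<and> (\<forall>s. s \<notin> fst Fc \<longrightarrow> snd Fc s = 0)"
    for k and Fc :: "(ncword \<times> nat) set \<times> (ncword \<times> nat \<Rightarrow> complex)"
  have "\<exists>Fc. k \<in> J \<longrightarrow> P k Fc" for k
  proof (cases "k \<in> J")
    case True
    obtain F c where Fc: "finite F" "F \<subseteq> {s. ?K s s \<noteq> 0}" "(\<lambda>l. \<Sum>s\<in>F. c s * e s l) = \<delta> k"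
      using ex[OF True] unfolding \<delta>_def by blast
    have "P k (F, \<lambda>s. if s \<in> F then c s else 0)"
      using Fc(1,2) KI by (auto simp: P_def Fc(3)[symmetric])
    then show ?thesis by blast
  qed simp
  then obtain Fc where Fc: "\<And>k. k \<in> J \<Longrightarrow> P k (Fc k)" using choice[of "\<lambda>k Fc. k \<in> J \<longrightarrow> P k Fc"] by blast
  define F c where "F k = fst (Fc k)" and "c k = snd (Fc k)" for k
  have F: "\<And>k. k \<in> J \<Longrightarrow> finite (F k)" "\<And>k. k \<in> J \<Longrightarrow> F k \<subseteq> ?I"
    and \<delta>: "\<And>k. k \<in> J \<Longrightarrow> \<delta> k = (\<lambda>l. \<Sum>s\<in>F k. c k s * e s l)"
    and c0: "\<And>k s. k \<in> J \<Longrightarrow> s \<notin> F k \<Longrightarrow> c k s = 0"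
    using Fc by (auto simp: P_def F_def c_def)
  define G where "G M = (\<Union>k\<in>J \<inter> {..<M}. F k)" for M
  have G: "finite (G M)" "G M \<subseteq> ?I" for M using F by (auto simp: G_def)
  define b where "b M z s = (\<Sum>k\<in>J \<inter> {..<M}. z k * c k s)" for M z s
  have comb: "(\<lambda>l. \<Sum>k\<in>J \<inter> {..<M}. z k * (\<Sum>s\<in>F k. c k s * f s l)) = (\<lambda>l. \<Sum>s\<in>G M. b M z s * f s l)"
    for M z and f :: "ncword \<times> nat \<Rightarrow> nat \<Rightarrow> complex"
  proof
    fix l
    have "(\<Sum>k\<in>J \<inter> {..<M}. z k * (\<Sum>s\<in>F k. c k s * f s l)) = (\<Sum>k\<in>J \<inter> {..<M}. \<Sum>s\<in>G M. z k * c k s * f s l)"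
    proof (rule sum.cong[OF refl])
      fix k assume k: "k \<in> J \<inter> {..<M}"
      then have "(\<Sum>s\<in>F k. c k s * f s l) = (\<Sum>s\<in>G M. c k s * f s l)"
        using G c0 by (intro sum.mono_neutral_left) (auto simp: G_def)
      then show "z k * (\<Sum>s\<in>F k. c k s * f s l) = (\<Sum>s\<in>G M. z k * c k s * f s l)"
        by (simp add: sum_distrib_left mult.assoc)
    qed
    also have "\<dots> = (\<Sum>s\<in>G M. \<Sum>k\<in>J \<inter> {..<M}. z k * c k s * f s l)" by (rule sum.swap)
    finally show "(\<Sum>k\<in>J \<inter> {..<M}. z k * (\<Sum>s\<in>F k. c k s * f s l)) = (\<Sum>s\<in>G M. b M z s * f s l)"
      by (simp add: b_def sum_distrib_right)
  qed
  have expand: "x = (\<lambda>l. \<Sum>s\<in>G M. b M x s * e s l)" if "x \<in> sqsum J" "\<And>k. M \<le> k \<Longrightarrow> x k = 0" for x M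
  proof -
    have "(\<lambda>l. \<Sum>s\<in>G M. b M x s * e s l) = (\<lambda>l. \<Sum>k\<in>J \<inter> {..<M}. x k * \<delta> k l)"
      unfolding comb[symmetric] using \<delta> by (intro ext sum.cong refl) auto
    also have "\<dots> = (\<lambda>l. if l \<in> J \<inter> {..<M} then x l else 0)"
      by (intro ext) (simp add: \<delta>_def if_distrib[of "\<lambda>t. _ * t"] cong: if_cong)
    also have "\<dots> = x" using that by (intro ext) (auto simp: sqsum_def not_less)
    finally show ?thesis by simp
  qed
  \<comment> \<open>The image of the unit vector under left multiplication by \<open>i\<close>,
    computed from the fixed representation. Independence of that choice is contained in
    \<open>ed\<close>, which determines the pairing with every Gram vector.\<close>
  define d where "d i k = (\<lambda>l. \<Sum>s\<in>F k. c k s * e (?sh i s) l)" for i k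
  have d: "d i k \<in> sqsum J" for i k unfolding d_def by (intro sqsum_comb e)
  have \<delta>s: "\<delta> k \<in> sqsum J" if "k \<in> J" for k unfolding \<delta>[OF that] by (intro sqsum_comb e)
  have ip\<delta>: "ip (ell2 J) x (\<delta> k) = x k" "ip (ell2 J) (\<delta> k) x = cnj (x k)" for x k
    using ip_finite_support_right[of "Suc k" "\<delta> k" J x] ip_finite_support_left[of "Suc k" "\<delta> k" J x]
    by (simp_all add: \<delta>_def)
  \<comment> \<open>Symmetry of the kernel moves the letter over to \<open>e s\<close>; the
    representation then sums back to the unit vector, and pairing with that reads off coordinate
    \<open>k\<close>.\<close>
  have ed: "ip (ell2 J) (e s) (d i k) = e (?sh i s) k" if k: "k \<in> J" for s i k
  proof -
    have "ip (ell2 J) (\<lambda>l. \<Sum>t\<in>{s}. 1 * e t l) (d i k) = (\<Sum>t\<in>F k. \<Sum>s\<in>{s}. ip (ell2 J) (e s) (e (?sh i t)) * 1 * cnj (c k t))"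
      unfolding d_def by (rule ell2_ip_comb) (use e in auto)
    also have "\<dots> = (\<Sum>t\<in>F k. \<Sum>s\<in>{?sh i s}. ip (ell2 J) (e s) (e t) * 1 * cnj (c k t))"
      by (simp add: Ke Ksh del: ell2_simps(5))
    also have "\<dots> = ip (ell2 J) (\<lambda>l. \<Sum>t\<in>{?sh i s}. 1 * e t l) (\<delta> k)"
      unfolding \<delta>[OF k] by (rule ell2_ip_comb[symmetric]) (use e in auto)
    finally show ?thesis by (simp add: ip\<delta> del: ell2_simps(5))
  qed
  have herm: "d i j k = cnj (d i k j)" if j: "j \<in> J" and k: "k \<in> J" for i j k
  proof -
    have "cnj (d i k j) = ip (ell2 J) (\<delta> j) (d i k)" by (simp only: ip\<delta>)
    also have "\<dots> = ip (ell2 J) (\<lambda>l. \<Sum>s\<in>F j. c j s * e s l) (\<lambda>l. \<Sum>t\<in>{()}. 1 * d i k l)"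
      by (simp add: \<delta>[OF j] del: ell2_simps(5))
    also have "\<dots> = (\<Sum>t\<in>{()}. \<Sum>s\<in>F j. ip (ell2 J) (e s) (d i k) * c j s * cnj 1)"
      by (rule ell2_ip_comb) (use e d in auto)
    also have "\<dots> = (\<Sum>s\<in>F j. e (?sh i s) k * c j s)"
      by (simp add: ed[OF k] del: ell2_simps(5))
    finally show ?thesis by (simp add: d_def mult.commute)
  qed
  \<comment> \<open>The squared norm of the combination is the moment form at \<open>[i, i]\<close>,
    while the form at the empty word is the squared norm of \<open>z\<close> cut down to the
    coordinates in \<open>J\<close> below \<open>M\<close>. The Archimedean inequality compares the
    two.\<close>
  have bd: "sqnorm (\<lambda>l. \<Sum>k\<in>J \<inter> {..<M}. z k * d i k l) \<le> C\<^sup>2 * (\<Sum>k\<in>J \<inter> {..<M}. (cmod (z k))\<^sup>2)"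
    if i: "i < g" for i M z
  proof -
    let ?b = "b M z"
    let ?x = "\<lambda>l. \<Sum>k\<in>J \<inter> {..<M}. z k * d i k l"
    have x: "?x = (\<lambda>l. \<Sum>s\<in>G M. ?b s * e (?sh i s) l)"
      unfolding d_def by (rule comb[where f = "\<lambda>s. e (?sh i s)"])
    have xs: "?x \<in> sqsum J" by (intro sqsum_comb d)
    have "of_real (sqnorm ?x) = ip (ell2 J) ?x ?x" by (rule ell2_ip_self[OF xs, symmetric])
    also have "\<dots> = (\<Sum>s\<in>G M. \<Sum>t\<in>G M. ip (ell2 J) (e (?sh i t)) (e (?sh i s)) * ?b t * cnj (?b s))"
      unfolding x by (rule ell2_ip_comb) (use e in auto)
    also have "\<dots> = moment_form y (G M) ?b [i, i]"
      by (simp add: Ke moment_form_def hankel_kernel_def case_prod_unfold del: ell2_simps(5))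
    finally have 1: "of_real (sqnorm ?x) = moment_form y (G M) ?b [i, i]" .
    have nn: "0 \<le> Re (moment_form y (G M) ?b [j, j])" if "j < g" for j
    proof -
      have "0 \<le> moment_form y (G M) ?b [j, j]"
        by (rule moment_form_square_nonneg[OF ph G(1)]) (use G(2)[of M] that in auto)
      then show ?thesis by (simp add: less_eq_complex_def)
    qed
    have "sqnorm ?x = Re (moment_form y (G M) ?b [i, i])" using 1 by (metis Re_complex_of_real)
    also have "\<dots> \<le> (\<Sum>j<g. Re (moment_form y (G M) ?b [j, j]))"
      by (rule member_le_sum) (use nn i in auto)
    also have "\<dots> \<le> C\<^sup>2 * Re (moment_form y (G M) ?b [])"
      using form[OF G(1)[of M] G(2)[of M], of ?b] by (simp add: less_eq_complex_def)
    also have "Re (moment_form y (G M) ?b []) = (\<Sum>k\<in>J \<inter> {..<M}. (cmod (z k))\<^sup>2)"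
    proof -
      define z' where "z' = (\<lambda>l. \<Sum>k\<in>J \<inter> {..<M}. z k * \<delta> k l)"
      have z': "z' = (\<lambda>l. if l \<in> J \<inter> {..<M} then z l else 0)"
        unfolding z'_def by (intro ext) (simp add: \<delta>_def if_distrib[of "\<lambda>t. _ * t"] cong: if_cong)
      have "z' = (\<lambda>l. \<Sum>s\<in>G M. ?b s * e s l)"
        unfolding comb[symmetric] z'_def using \<delta> by (intro ext sum.cong refl) auto
      then have "ip (ell2 J) z' z' = (\<Sum>s\<in>G M. \<Sum>t\<in>G M. ip (ell2 J) (e t) (e s) * ?b t * cnj (?b s))"
        using ell2_ip_comb[of "G M" e J "G M" e ?b ?b] e by simp
      also have "\<dots> = moment_form y (G M) ?b []"
        by (simp add: Ke moment_form_def hankel_kernel_def case_prod_unfold del: ell2_simps(5))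
      finally have "moment_form y (G M) ?b [] = ip (ell2 J) z' z'" by simp
      also have "\<dots> = (\<Sum>k<M. z' k * cnj (z' k))"
        by (rule ip_finite_support_left) (simp add: z')
      also have "\<dots> = (\<Sum>k\<in>J \<inter> {..<M}. of_real ((cmod (z k))\<^sup>2))"
        unfolding complex_norm_square by (intro sum.mono_neutral_cong_right) (auto simp: z')
      finally show ?thesis by simp
    qed
    finally show ?thesis .
  qed
  define T where "T = map (\<lambda>i. matrix_op J (d i)) [0..<g]"
  have Tlen: "length T = g" and Tnth: "\<And>i. i < g \<Longrightarrow> T ! i = matrix_op J (d i)" by (auto simp: T_def)
  have Tsa: "set T \<subseteq> bounded_sa_ops (ell2 J)"
  proof
    fix f assume "f \<in> set T"
    then obtain i where i: "i < g" and f: "f = matrix_op J (d i)" by (auto simp: T_def)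
    show "f \<in> bounded_sa_ops (ell2 J)"
      unfolding f by (rule matrix_op_bounded_sa[OF d herm C bd[OF i]])
  qed
  interpret pre_hilbert "ell2 J" by (rule ell2_pre_hilbert)
  interpret sa_tuple "ell2 J" T g using Tlen Tsa by unfold_locales auto
  \<comment> \<open>By \<open>ed\<close> the coordinates of the image are those of
    \<open>e (?sh i s)\<close>, so the operators act on all Gram vectors by left
    multiplication.\<close>
  have Te: "(T ! i) (e s) = e (?sh i s)" if "i < g" for i s
    using e[of "?sh i s"] by (intro ext) (auto simp: Tnth[OF that] matrix_op_def ed sqsum_def simp del: ell2_simps(5))
  have We: "word_op T w (e s) = e (w @ fst s, snd s)" if "w \<in> words g" for w s
    using that by (induction w) (auto simp: Te)
  define u where "u a = e ([], a)" for a
  have mom: "moments u w a b = y w a b" if "w \<in> words g" for w a b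
    unfolding moments_def u_def We[OF that] Ke by (simp add: hankel_kernel_def)
  \<comment> \<open>Finitely supported tuples are combinations of Gram vectors, where the form
    equals the localizing form. The components from \<mu> on are set to zero so that the two
    descriptions of the tuple agree as functions.\<close>
  have fin_pos: "0 \<le> (\<Sum>i<\<mu>. ip (ell2 J) (eval_mop (ell2 J) \<mu> T p \<zeta> i) (\<zeta> i))"
    if \<zeta>: "\<And>j. \<zeta> j \<in> sqsum J" "\<And>j k. M \<le> k \<Longrightarrow> \<zeta> j k = 0" "\<And>j. \<mu> \<le> j \<Longrightarrow> \<zeta> j = (\<lambda>l. 0)" for M \<zeta>
  proof -
    define F' where "F' = (\<lambda>((w, a), j). (w, j, a)) ` (G M \<times> {..<\<mu>})"
    define v where "v = (\<lambda>(w, j, a). b M (\<zeta> j) (w, a))"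
    have F': "finite F'" "F' \<subseteq> words g \<times> {..<\<mu>} \<times> {..<n}" using G[of M] by (auto simp: F'_def)
    define \<xi> where "\<xi> = (\<lambda>j. finsum (ell2 J) (\<lambda>t. (if fst (snd t) = j then v t else 0) \<odot>\<^bsub>ell2 J\<^esub>
       word_op T (fst t) (u (snd (snd t)))) F')"
    have u: "u a \<in> carrier (ell2 J)" for a by (simp add: u_def e)
    note eq = mop_form_eq[where n = n and u = u and v = v, OF u p F', folded \<xi>_def]
    have "\<xi> j = \<zeta> j" for j
    proof -
      have W: "word_op T (fst t) (u (snd (snd t))) = e (fst t, snd (snd t))" if "t \<in> F'" for t
        using that F' by (auto simp: u_def We)
      have "\<xi> j = (\<lambda>l. \<Sum>t\<in>F'. (if fst (snd t) = j then v t else 0) * e (fst t, snd (snd t)) l)"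
        unfolding \<xi>_def
      proof (subst finsum_ell2)
        show "(\<lambda>t. (if fst (snd t) = j then v t else 0) \<odot>\<^bsub>ell2 J\<^esub> word_op T (fst t) (u (snd (snd t)))) \<in> F' \<rightarrow> sqsum J"
          unfolding ell2_simps(4) by (intro Pi_I, subst W, assumption, intro sqsum_smult e)
      qed (simp add: W)
      also have "\<dots> = (\<lambda>l. \<Sum>((w, a), j')\<in>G M \<times> {..<\<mu>}. if j' = j then b M (\<zeta> j') (w, a) * e (w, a) l else 0)"
        unfolding F'_def by (subst sum.reindex) (auto simp: inj_on_def v_def intro!: sum.cong)
      also have "\<dots> = (\<lambda>l. \<Sum>s\<in>G M. \<Sum>j'<\<mu>. if j' = j then b M (\<zeta> j') s * e s l else 0)"
        unfolding sum.cartesian_product by (intro ext sum.cong refl) (simp add: case_prod_unfold)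
      also have "\<dots> = (\<lambda>l. if j < \<mu> then \<Sum>s\<in>G M. b M (\<zeta> j) s * e s l else 0)"
        by (intro ext) simp
      also have "\<dots> = \<zeta> j"
        using expand[OF \<zeta>(1)[of j] \<zeta>(2)[of _ j]] \<zeta>(3)[of j] by (cases "j < \<mu>") (simp_all add: not_less)
      finally show ?thesis .
    qed
    then have \<xi>\<zeta>: "\<xi> = \<zeta>" by (rule ext)
    have "0 \<le> (\<Sum>s\<in>F'. \<Sum>t\<in>F'. loc_kernel \<mu> p y s t * v t * cnj (v s))"
      by (rule pos_onD[OF pl F'])
    also have "\<dots> = (\<Sum>s\<in>F'. \<Sum>t\<in>F'. loc_kernel \<mu> p (moments u) s t * v t * cnj (v s))"
    proof (intro sum.cong refl arg_cong2[where f = "(*)"])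
      fix s t assume st: "s \<in> F'" "t \<in> F'"
      obtain \<alpha> i a \<beta> j b where "s = (\<alpha>, i, a)" "t = (\<beta>, j, b)" by (metis prod_cases3)
      moreover have "msupp \<mu> \<mu> p \<subseteq> words g" using p by (simp add: is_ncmpoly_def)
      ultimately show "loc_kernel \<mu> p y s t = loc_kernel \<mu> p (moments u) s t"
        using st F'(2) by (auto simp: loc_kernel_def subset_iff mom intro!: sum.cong)
    qed
    finally show ?thesis
      using eq(1) unfolding \<xi>\<zeta>[symmetric] \<xi>_def by simp
  qed
  have "0 \<le> (\<Sum>i<\<mu>. ip (ell2 J) (eval_mop (ell2 J) \<mu> T p \<xi> i) (\<xi> i))"
    if \<xi>: "\<xi> \<in> {..<\<mu>} \<rightarrow> carrier (ell2 J)" for \<xi>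
  proof (rule mop_form_limit[OF p _ \<xi>])
    \<comment> \<open>Truncation approximates an arbitrary tuple in norm by tuples covered by
      \<open>fin_pos\<close>.\<close>
    let ?\<xi> = "\<lambda>N j. if j < \<mu> then trunc N (\<xi> j) else (\<lambda>l. 0)"
    have x: "\<xi> j \<in> sqsum J" if "j < \<mu>" for j using \<xi> that by auto
    show "?\<xi> N \<in> {..<\<mu>} \<rightarrow> carrier (ell2 J)" for N by (auto intro!: trunc_sqsum x)
    show "(\<lambda>N. hnorm (ell2 J) (?\<xi> N j \<ominus>\<^bsub>ell2 J\<^esub> \<xi> j)) \<longlonglongrightarrow> 0" if "j < \<mu>" for j
      using trunc_hnorm_tendsto[OF x[OF that]] that by simp
    show "0 \<le> (\<Sum>i<\<mu>. ip (ell2 J) (eval_mop (ell2 J) \<mu> T p (?\<xi> N) i) (?\<xi> N i))" for N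
    proof (rule fin_pos)
      show "?\<xi> N j k = 0" if "N \<le> k" for j k using that by (simp add: trunc_def)
    qed (auto simp: x sqsum_zero trunc_sqsum)
  qed
  then have "T \<in> pos_dom g \<mu> p (ell2 J)" using Tlen Tsa by (simp add: pos_dom_def)
  then show ?thesis
    by (rule that[of _ _ u]) (use e mom in \<open>auto simp: u_def moments_def simp del: ell2_simps(5)\<close>)
qed

lemma L_inf_hat_subset_Gamma_conv:
  assumes p: "is_ncmpoly g \<mu> \<mu> p" and arch: "archimedean g \<mu> p"
    and \<Gamma>: "\<And>\<gamma>. \<gamma> \<in> set \<Gamma> \<Longrightarrow> is_ncpoly g \<gamma>"
  shows "L_inf_hat g \<Gamma> \<mu> p n \<subseteq> Gamma_conv g \<Gamma> \<mu> p n"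
proof
  fix X assume "X \<in> L_inf_hat g \<Gamma> \<mu> p n"
  then obtain Y where X: "X = hat g Y" and Y: "Y \<in> L_inf g \<Gamma> \<mu> p n" by (auto simp: L_inf_hat_def)
  have mf: "Y \<in> moment_families g \<Gamma> n (words g)"
    and ph: "pos_on (words g \<times> {..<n}) (hankel_kernel (entries Y))"
    and pl: "pos_on (words g \<times> {..<\<mu>} \<times> {..<n}) (loc_kernel \<mu> p (entries Y))"
    using Y unfolding L_inf_iff[OF p] by auto
  \<comment> \<open>\<open>GNS\<close> works on the whole index type, whereas \<open>Y\<close>
    carries information only on \<open>words g\<close> and on entries below \<open>n\<close>; the
    value 0 elsewhere adds only zero Gram vectors.\<close>
  define y where "y w a b = (if w \<in> words g \<and> a < n \<and> b < n then Y w $$ (a, b) else 0)" for w a b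
  have msw: "w \<in> words g" if "w \<in> msupp \<mu> \<mu> p" for w using p that by (auto simp: is_ncmpoly_def)
  have ph': "pos_on (words g \<times> {..<n}) (hankel_kernel y)"
    using ph by (subst pos_on_cong[where M' = "hankel_kernel (entries Y)"]) (auto simp: hankel_kernel_def y_def)
  have pl': "pos_on (words g \<times> {..<\<mu>} \<times> {..<n}) (loc_kernel \<mu> p y)"
    using pl msw by (subst pos_on_cong[where M' = "loc_kernel \<mu> p (entries Y)"])
      (auto simp: loc_kernel_def y_def intro!: sum.cong)
  obtain C :: real and E :: nat where C: "C > 0"
    and form: "\<And>y n I I' F c. \<lbrakk>pos_on (I \<times> {..<n}) (hankel_kernel y); pos_on (I' \<times> {..<\<mu>} \<times> {..<n}) (loc_kernel \<mu> p y);
       finite F; \<And>x. x \<in> F \<Longrightarrow> snd x < n;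
       \<And>u x. \<lbrakk>x \<in> F; u \<in> words_upto g E\<rbrakk> \<Longrightarrow> u @ fst x \<in> I \<inter> I'\<rbrakk> \<Longrightarrow>
       (\<Sum>i<g. moment_form y F c [i, i]) \<le> of_real (C\<^sup>2) * moment_form y F c []"
    by (rule archimedean_form[OF arch p]) blast
  \<comment> \<open>For the full family every word is in range, so the condition involving the slack
    \<open>E\<close> holds automatically.\<close>
  have form': "(\<Sum>i<g. moment_form y F c [i, i]) \<le> of_real (C\<^sup>2) * moment_form y F c []"
    if "finite F" "F \<subseteq> words g \<times> {..<n}" for F c
    by (rule form[OF ph' pl' that(1)]) (use that words_upto_subset in auto)
  obtain J T and u :: "nat \<Rightarrow> nat \<Rightarrow> complex" where T: "T \<in> pos_dom g \<mu> p (ell2 J)"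
    and u: "\<And>a. u a \<in> sqsum J"
    and mom: "\<And>w a b. w \<in> words g \<Longrightarrow> ip (ell2 J) (word_op T w (u b)) (u a) = y w a b"
    by (rule GNS[OF p _ ph' pl' less_imp_le[OF C] form']) (auto simp: y_def)
  interpret pre_hilbert "ell2 J" by (rule ell2_pre_hilbert)
  interpret sa_tuple "ell2 J" T g using T by unfold_locales (auto simp: pos_dom_def)
  \<comment> \<open>The moment at the empty word is the identity, so the \<open>u a\<close> are
    orthonormal and \<open>V\<close> is an isometry.\<close>
  define V where "V v = (\<lambda>l. \<Sum>a<n. v $ a * u a l)" for v :: "complex vec"
  have V: "V v \<in> sqsum J" for v unfolding V_def by (intro sqsum_comb u)
  have Vunit: "V (unit_vec n b) = u b" if "b < n" for b
  proof
    fix l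
    have "V (unit_vec n b) l = (\<Sum>a<n. if a = b then u a l else 0)"
      unfolding V_def by (intro sum.cong refl) (use that in \<open>simp add: unit_vec_def\<close>)
    then show "V (unit_vec n b) l = u b l" using that by simp
  qed
  have c: "Y w \<in> carrier_mat n n" if "w \<in> words g" for w using moment_families_carrier[OF mf that] .
  have one: "Y [] = 1\<^sub>m n" using mf by (simp add: moment_families_def)
  have gram: "ip (ell2 J) (u b) (u a) = (if a = b then 1 else 0)" if "a < n" "b < n" for a b
    using mom[of "[]" b a] that by (simp add: y_def one del: ell2_simps(5))
  have iso: "isometry n (ell2 J) V"
    unfolding isometry_def module_hom_def
  proof (intro conjI ballI CollectI allI impI)
    show "V \<in> carrier (module_vec TYPE(complex) n) \<rightarrow> carrier (ell2 J)" using V by auto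
    fix v w :: "complex vec"
    show "V (v \<oplus>\<^bsub>module_vec TYPE(complex) n\<^esub> w) = V v \<oplus>\<^bsub>ell2 J\<^esub> V w"
      if "v \<in> carrier (module_vec TYPE(complex) n) \<and> w \<in> carrier (module_vec TYPE(complex) n)"
      using that by (auto simp: V_def module_vec_simps distrib_right sum.distrib)
  next
    fix r and v :: "complex vec"
    show "V (r \<odot>\<^bsub>module_vec TYPE(complex) n\<^esub> v) = r \<odot>\<^bsub>ell2 J\<^esub> V v"
      if "r \<in> carrier class_ring \<and> v \<in> carrier (module_vec TYPE(complex) n)"
      using that by (auto simp: V_def module_vec_simps sum_distrib_left mult.assoc)
  next
    fix v w :: "complex vec"
    assume vw: "v \<in> carrier_vec n" "w \<in> carrier_vec n"
    have "ip (ell2 J) (V v) (V w) = (\<Sum>a<n. \<Sum>b<n. ip (ell2 J) (u b) (u a) * v $ b * cnj (w $ a))"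
      unfolding V_def by (rule ell2_ip_comb) (rule u)+
    also have "\<dots> = (\<Sum>a<n. \<Sum>b<n. if a = b then v $ b * cnj (w $ a) else 0)"
      by (intro sum.cong refl) (simp add: gram del: ell2_simps(5))
    also have "\<dots> = v \<bullet>c w" using vw by (simp add: scalar_prod_def lessThan_atLeast0)
    finally show "ip (ell2 J) (V v) (V w) = v \<bullet>c w" .
  qed
  have XT: "X = map (compress (ell2 J) n V) T"
  proof (rule nth_equalityI)
    show l: "length X = length (map (compress (ell2 J) n V) T)" using len by (simp add: X hat_def)
    fix i assume "i < length X"
    then have i: "i < g" by (simp add: X hat_def)
    have "Y [i] = compress (ell2 J) n V (T ! i)"
    proof (rule eq_matI)
      fix a b assume ab: "a < dim_row (compress (ell2 J) n V (T ! i))" "b < dim_col (compress (ell2 J) n V (T ! i))"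
      then have ab: "a < n" "b < n" by (auto simp: compress_def)
      have "ip (ell2 J) ((T ! i) (u b)) (u a) = Y [i] $$ (a, b)"
        using mom[of "[i]" b a] i ab by (simp add: y_def del: ell2_simps(5))
      then show "Y [i] $$ (a, b) = compress (ell2 J) n V (T ! i) $$ (a, b)"
        using ab by (simp add: compress_def Vunit del: ell2_simps(5))
    qed (use c[of "[i]"] i in \<open>auto simp: compress_def\<close>)
    then show "X ! i = map (compress (ell2 J) n V) T ! i" using i len by (simp add: X hat_def)
  qed
  have "X \<in> sa_tuples g n"
  proof -
    have "Y [i] \<in> sa_mats n" if "i < g" for i
    proof -
      have "[i] \<in> words g" using that by simp
      then have "Y (rev [i]) = mat_adjoint (Y [i])" using mf unfolding moment_families_def by blast
      then show ?thesis using c[of "[i]"] that by (simp add: sa_mats_def)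
    qed
    then show ?thesis by (auto simp: sa_tuples_def X hat_def)
  qed
  moreover have "compress (ell2 J) n V (eval_op (ell2 J) T \<gamma>) = eval_mat n X \<gamma>" if \<gamma>: "\<gamma> \<in> set \<Gamma>" for \<gamma>
  proof -
    have s: "supp \<gamma> \<subseteq> words g" using \<Gamma>[OF \<gamma>] by (simp add: is_ncpoly_def)
    have "msum n n (\<lambda>m. \<gamma> m \<cdot>\<^sub>m Y m) (supp \<gamma>) = eval_mat n X \<gamma>"
      using mf \<gamma> by (simp add: moment_families_def X)
    moreover have "compress (ell2 J) n V (eval_op (ell2 J) T \<gamma>) = msum n n (\<lambda>m. \<gamma> m \<cdot>\<^sub>m Y m) (supp \<gamma>)"
    proof (rule eq_matI)
      fix a b assume "a < dim_row (msum n n (\<lambda>m. \<gamma> m \<cdot>\<^sub>m Y m) (supp \<gamma>))" "b < dim_col (msum n n (\<lambda>m. \<gamma> m \<cdot>\<^sub>m Y m) (supp \<gamma>))"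
      then have ab: "a < n" "b < n" by auto
      have "ip (ell2 J) (eval_op (ell2 J) T \<gamma> (u b)) (u a) = (\<Sum>w\<in>supp \<gamma>. \<gamma> w * ip (ell2 J) (word_op T w (u b)) (u a))"
        by (rule ip_eval_op[OF s]) (use u in auto)
      also have "\<dots> = (\<Sum>w\<in>supp \<gamma>. (\<gamma> w \<cdot>\<^sub>m Y w) $$ (a, b))"
      proof (intro sum.cong refl)
        fix w assume w: "w \<in> supp \<gamma>"
        then have "w \<in> words g" using s by auto
        then show "\<gamma> w * ip (ell2 J) (word_op T w (u b)) (u a) = (\<gamma> w \<cdot>\<^sub>m Y w) $$ (a, b)"
          using c[of w] ab by (simp add: mom y_def del: ell2_simps(5))
      qed
      finally show "compress (ell2 J) n V (eval_op (ell2 J) T \<gamma>) $$ (a, b) = msum n n (\<lambda>m. \<gamma> m \<cdot>\<^sub>m Y m) (supp \<gamma>) $$ (a, b)"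
        using ab by (simp add: compress_def Vunit del: ell2_simps(5))
    qed (simp_all add: compress_def)
    ultimately show ?thesis by simp
  qed
  ultimately show "X \<in> Gamma_conv g \<Gamma> \<mu> p n"
    unfolding Gamma_conv_def using ell2_hilbert T iso XT by blast
qed

section \<open>Pencils\<close>

lemma pos_on_zero: "pos_on I (\<lambda>s t. 0)"
  by (simp add: pos_on_def)

text \<open>The block sum sits in the first factor, so the index set is first rearranged into a
  disjoint union of products, to which \<open>pos_on_Plus\<close> applies.\<close>

lemma pos_on_Plus_Times:
  assumes "finite A" "finite B"
    and "\<And>s t a b. s \<in> A \<Longrightarrow> t \<in> B \<Longrightarrow> M (Inl s, a) (Inr t, b) = 0"
    and "\<And>s t a b. s \<in> A \<Longrightarrow> t \<in> B \<Longrightarrow> M (Inr t, a) (Inl s, b) = 0"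
  shows "pos_on ((A <+> B) \<times> {..<n::nat}) M \<longleftrightarrow>
    pos_on (A \<times> {..<n}) (\<lambda>s t. M (map_prod Inl id s) (map_prod Inl id t)) \<and>
    pos_on (B \<times> {..<n}) (\<lambda>s t. M (map_prod Inr id s) (map_prod Inr id t))"
proof -
  let ?f = "case_sum (map_prod Inl id) (map_prod Inr id) :: 'a \<times> nat + 'b \<times> nat \<Rightarrow> ('a + 'b) \<times> nat"
  have "bij_betw ?f ((A \<times> {..<n}) <+> (B \<times> {..<n})) ((A <+> B) \<times> {..<n})"
  proof (rule bij_betw_imageI)
    show "inj_on ?f ((A \<times> {..<n}) <+> (B \<times> {..<n}))" by (auto simp: inj_on_def)
    show "?f ` ((A \<times> {..<n}) <+> (B \<times> {..<n})) = (A <+> B) \<times> {..<n}"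
    proof (intro equalityI subsetI)
      fix x assume "x \<in> (A <+> B) \<times> {..<n}"
      then consider s a where "x = (Inl s, a)" "s \<in> A" "a < n" | t a where "x = (Inr t, a)" "t \<in> B" "a < n"
        by auto
      then show "x \<in> ?f ` ((A \<times> {..<n}) <+> (B \<times> {..<n}))"
      proof cases
        case 1
        then have "x = ?f (Inl (s, a))" by simp
        then show ?thesis using 1 by blast
      next
        case 2
        then have "x = ?f (Inr (t, a))" by simp
        then show ?thesis using 2 by blast
      qed
    qed auto
  qed
  from pos_on_bij[OF this, of M] show ?thesis
    using assms by (subst (asm) pos_on_Plus) auto
qed

text \<open>Opposite semidefinite constraints encode an equation.\<close>

lemma pos_on_signed_iff:
  fixes E :: "'q \<Rightarrow> nat \<Rightarrow> nat \<Rightarrow> complex"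
  shows "pos_on ((Q \<times> (UNIV :: bool set)) \<times> {..<n})
      (\<lambda>(s, a) (t, b). if s = t then (if snd s then 1 else -1) * E (fst s) a b else 0) \<longleftrightarrow>
    (\<forall>q\<in>Q. \<forall>a<n. \<forall>b<n. E q a b = 0)" (is "pos_on ?I ?M \<longleftrightarrow> _")
proof
  assume pos: "pos_on ?I ?M"
  show "\<forall>q\<in>Q. \<forall>a<n. \<forall>b<n. E q a b = 0"
  proof (intro ballI allI impI)
    fix q a b assume q: "q \<in> Q" and ab: "a < n" "b < n"
    have 1: "0 \<le> E q a a"
      using pos_on_diag[OF pos, of "((q, True), a)"] q ab by simp
    have 2: "0 \<le> - E q a a"
      using pos_on_diag[OF pos, of "((q, False), a)"] q ab by simp
    \<comment> \<open>Both signs together annihilate the diagonal; Cauchy-Schwarz for the kernel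
      then annihilates the off-diagonal entries.\<close>
    have "E q a a = 0" using 1 2 by (simp add: less_eq_complex_def complex_eq_iff)
    then have "(cmod (E q a b))\<^sup>2 \<le> 0"
      using pos_on_Cauchy_Schwarz[OF pos, of "((q, True), a)" "((q, True), b)"] q ab by simp
    then show "E q a b = 0" by simp
  qed
next
  assume "\<forall>q\<in>Q. \<forall>a<n. \<forall>b<n. E q a b = 0"
  then have "pos_on ?I ?M = pos_on ?I (\<lambda>s t. 0)"
    by (intro pos_on_cong) auto
  then show "pos_on ?I ?M" by (simp add: pos_on_zero)
qed

lemma eval_mat_carrier: "eval_mat n X q \<in> carrier_mat n n"
  by (simp add: eval_mat_def)

lemma eval_mat_ncvar:
  assumes "X ! j \<in> carrier_mat n n"
  shows "eval_mat n X (ncvar j) = X ! j"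
proof -
  have "supp (ncvar j) = {[j]}" by (auto simp: supp_def ncvar_def)
  then show ?thesis
    using assms by (intro eq_matI) (auto simp: eval_mat_def ncvar_def word_mat_def)
qed

text \<open>The family with real and imaginary parts \<open>U (w, False)\<close> and \<open>U (w, True)\<close>, averaged with the
  adjoint of its value at the reversed word.\<close>

definition sym_family ::
  "(ncword \<times> bool \<Rightarrow> complex mat) \<Rightarrow> ncword \<Rightarrow> nat \<Rightarrow> nat \<Rightarrow> complex" where
  "sym_family U w a b = (U (w, False) $$ (a, b) + U (rev w, False) $$ (a, b)) / 2 +
     \<i> * (U (w, True) $$ (a, b) - U (rev w, True) $$ (a, b)) / 2"

text \<open>What multiplies the variable \<open>U z\<close> in the sum of the terms
  \<open>c w * sym_family U w a b\<close>, once the contributions of a word and of its reversal are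
  collected.\<close>

definition sym_coeff :: "(ncword \<Rightarrow> complex) \<Rightarrow> ncword \<times> bool \<Rightarrow> complex" where
  "sym_coeff c z = (if snd z then \<i> * (c (fst z) - c (rev (fst z))) / 2 else (c (fst z) + c (rev (fst z))) / 2)"

lemma sum_sym_coeff:
  assumes "finite W" and rev: "\<And>w. w \<in> W \<Longrightarrow> rev w \<in> W"
  shows "(\<Sum>z\<in>W \<times> UNIV. sym_coeff c z * U z $$ (a, b)) = (\<Sum>w\<in>W. c w * sym_family U w a b)"
proof -
  have img: "rev ` W = W" using rev by (force simp: image_iff)
  have r: "(\<Sum>w\<in>W. f (rev w)) = (\<Sum>w\<in>W. f w)" for f :: "ncword \<Rightarrow> complex"
    using sum.reindex[of rev W f] by (simp add: img)
  have "(\<Sum>z\<in>W \<times> UNIV. sym_coeff c z * U z $$ (a, b)) =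
    (\<Sum>w\<in>W. (c w + c (rev w)) / 2 * U (w, False) $$ (a, b) + \<i> * (c w - c (rev w)) / 2 * U (w, True) $$ (a, b))"
    by (simp add: sum.cartesian_product' UNIV_bool sym_coeff_def add.commute)
  also have "\<dots> = (\<Sum>w\<in>W. c w * (U (w, False) $$ (a, b) / 2 + \<i> * U (w, True) $$ (a, b) / 2))
     + (\<Sum>w\<in>W. c (rev w) * (U (w, False) $$ (a, b) / 2 - \<i> * U (w, True) $$ (a, b) / 2))"
    unfolding sum.distrib[symmetric] by (intro sum.cong refl) (simp add: algebra_simps add_divide_distrib diff_divide_distrib)
  also have "(\<Sum>w\<in>W. c (rev w) * (U (w, False) $$ (a, b) / 2 - \<i> * U (w, True) $$ (a, b) / 2))
     = (\<Sum>w\<in>W. c w * (U (rev w, False) $$ (a, b) / 2 - \<i> * U (rev w, True) $$ (a, b) / 2))"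
    using r[of "\<lambda>w. c w * (U (rev w, False) $$ (a, b) / 2 - \<i> * U (rev w, True) $$ (a, b) / 2)"] by simp
  also have "(\<Sum>w\<in>W. c w * (U (w, False) $$ (a, b) / 2 + \<i> * U (w, True) $$ (a, b) / 2)) + \<dots>
     = (\<Sum>w\<in>W. c w * sym_family U w a b)"
    unfolding sum.distrib[symmetric]
    by (intro sum.cong refl) (simp add: sym_family_def algebra_simps add_divide_distrib diff_divide_distrib)
  finally show ?thesis .
qed

lemma mat_kernel_sa:
  fixes c :: "'s \<Rightarrow> 's \<Rightarrow> complex"
  assumes "\<And>i j. i < N \<Longrightarrow> j < N \<Longrightarrow> c (e j) (e i) = cnj (c (e i) (e j))"
  shows "mat N N (\<lambda>(i, j). c (e i) (e j)) \<in> sa_mats N"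
  unfolding sa_mats_def by (auto intro!: eq_matI) (metis assms)

section \<open>Affine kernels as pencils\<close>

text \<open>The hypothesis on \<open>cY\<close> pairs a word with its reversal; passing to
  \<open>sym_coeff\<close> turns it into Hermitian symmetry of the coefficient of each single
  auxiliary variable. \<open>U\<close> names these variables by word and part, and \<open>zs\<close>
  arranges them in a list.\<close>

lemma kernel_pencil:
  fixes c0 :: "'s \<Rightarrow> 's \<Rightarrow> complex" and cA :: "nat \<Rightarrow> 's \<Rightarrow> 's \<Rightarrow> complex"
    and cY :: "ncword \<Rightarrow> 's \<Rightarrow> 's \<Rightarrow> complex"
  assumes S: "finite S" and W: "finite W" "\<And>w. w \<in> W \<Longrightarrow> rev w \<in> W"
    and zs: "distinct zs" "set zs = W \<times> UNIV"
    and c0: "\<And>s t. s \<in> S \<Longrightarrow> t \<in> S \<Longrightarrow> c0 t s = cnj (c0 s t)"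
    and cA: "\<And>j s t. s \<in> S \<Longrightarrow> t \<in> S \<Longrightarrow> cA j t s = cnj (cA j s t)"
    and cY: "\<And>w s t. s \<in> S \<Longrightarrow> t \<in> S \<Longrightarrow> cY (rev w) t s = cnj (cY w s t)"
  obtains L where "is_Gamma_pencil \<Gamma> L" "length (pen_aux L) = length zs"
    "\<forall>n X Y U. Y \<in> sa_tuples (length zs) n \<longrightarrow> (\<forall>k < length zs. Y ! k = U (zs ! k)) \<longrightarrow>
      (psd (pen_size L * n) (pencil_eval \<Gamma> L n X Y) \<longleftrightarrow>
      pos_on (S \<times> {..<n}) (\<lambda>(s, a) (t, b). c0 s t * (if a = b then 1 else 0) +
        (\<Sum>j<length \<Gamma>. cA j s t * eval_mat n X (\<Gamma> ! j) $$ (a, b)) +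
        (\<Sum>w\<in>W. cY w s t * sym_family U w a b)))"
proof -
  obtain e where e: "bij_betw e {..<card S} S"
    using ex_bij_betw_nat_finite[OF S] by (auto simp: lessThan_atLeast0)
  have eS: "e i \<in> S" if "i < card S" for i using e that by (auto simp: bij_betw_def)
  let ?N = "card S"
  let ?m = "\<lambda>c. mat ?N ?N (\<lambda>(i, j). c (e i) (e j)) :: complex mat"
  let ?cz = "\<lambda>z s t. sym_coeff (\<lambda>w. cY w s t) z"
  define L where "L = \<lparr>pen_size = ?N, pen_const = ?m c0, pen_gam = map (\<lambda>j. ?m (cA j)) [0..<length \<Gamma>],
     pen_aux = map (\<lambda>z. ?m (?cz z)) zs\<rparr>"
  have zh: "?cz z t s = cnj (?cz z s t)" if "s \<in> S" "t \<in> S" for z s t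
    using cY[OF that, of "fst z"] cY[OF that, of "rev (fst z)"]
    by (auto simp: sym_coeff_def algebra_simps)
  have 1: "is_Gamma_pencil \<Gamma> L"
  proof -
    have "?m c0 \<in> sa_mats ?N" by (rule mat_kernel_sa) (rule c0[OF eS eS])
    moreover have "?m (cA j) \<in> sa_mats ?N" for j by (rule mat_kernel_sa) (rule cA[OF eS eS])
    moreover have "?m (?cz z) \<in> sa_mats ?N" for z by (rule mat_kernel_sa) (rule zh[OF eS eS])
    ultimately show ?thesis unfolding is_Gamma_pencil_def L_def by auto
  qed
  have 2: "length (pen_aux L) = length zs" by (simp add: L_def)
  show ?thesis
  proof (rule that[OF 1 2], intro allI impI)
    fix n X Y and U :: "ncword \<times> bool \<Rightarrow> complex mat"
    assume Y: "Y \<in> sa_tuples (length zs) n" and "\<forall>k < length zs. Y ! k = U (zs ! k)"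
    then have YU: "\<And>k. k < length zs \<Longrightarrow> Y ! k = U (zs ! k)" by blast
    let ?P = "pencil_eval \<Gamma> L n X Y"
    let ?M = "\<lambda>(s, a) (t, b). c0 s t * (if a = b then 1 else 0) +
        (\<Sum>j<length \<Gamma>. cA j s t * eval_mat n X (\<Gamma> ! j) $$ (a, b)) +
        (\<Sum>w\<in>W. cY w s t * sym_family U w a b)"
    have Yc: "Y ! k \<in> carrier_mat n n" if "k < length zs" for k
    proof -
      have "Y ! k \<in> set Y" using Y that by (intro nth_mem) (simp add: sa_tuples_def)
      then show ?thesis using Y by (auto simp: sa_tuples_def sa_mats_def)
    qed
    have P: "?P \<in> carrier_mat (?N * n) (?N * n)"
      by (auto simp: pencil_eval_def Let_def L_def)
    have entry: "?P $$ (i * n + a, j * n + b) = ?M (e i, a) (e j, b)"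
      if ij: "i < ?N" "j < ?N" and ab: "a < n" "b < n" for i j a b
    proof -
      have k: "kron (?m c) B $$ (i * n + a, j * n + b) = c (e i) (e j) * B $$ (a, b)"
        if "B \<in> carrier_mat n n" for c and B :: "complex mat"
        using kron_index[of "?m c" ?N B n i j a b] that ij ab by simp
      have lt: "i * n + a < ?N * n" "j * n + b < ?N * n" using ij ab by (simp_all add: mult_add_less)
      have "(\<Sum>k<length zs. kron (pen_aux L ! k) (Y ! k) $$ (i * n + a, j * n + b))
        = (\<Sum>k<length zs. ?cz (zs ! k) (e i) (e j) * U (zs ! k) $$ (a, b))"
      proof (intro sum.cong refl)
        fix l assume "l \<in> {..<length zs}"
        then have l: "l < length zs" by simp
        show "kron (pen_aux L ! l) (Y ! l) $$ (i * n + a, j * n + b) = ?cz (zs ! l) (e i) (e j) * U (zs ! l) $$ (a, b)"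
          using k[OF Yc[OF l], of "?cz (zs ! l)"] l YU[OF l] by (simp add: L_def)
      qed
      also have "\<dots> = (\<Sum>z\<in>W \<times> UNIV. ?cz z (e i) (e j) * U z $$ (a, b))"
        using sum.reindex_bij_betw[OF bij_betw_nth[OF zs(1) refl zs(2)[symmetric]],
            of "\<lambda>z. ?cz z (e i) (e j) * U z $$ (a, b)"] by simp
      also have "\<dots> = (\<Sum>w\<in>W. cY w (e i) (e j) * sym_family U w a b)"
        by (rule sum_sym_coeff[OF W])
      finally have aux: "(\<Sum>k<length zs. kron (pen_aux L ! k) (Y ! k) $$ (i * n + a, j * n + b))
        = (\<Sum>w\<in>W. cY w (e i) (e j) * sym_family U w a b)" .
      have gam: "(\<Sum>l<length \<Gamma>. kron (pen_gam L ! l) (eval_mat n X (\<Gamma> ! l)) $$ (i * n + a, j * n + b))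
        = (\<Sum>l<length \<Gamma>. cA l (e i) (e j) * eval_mat n X (\<Gamma> ! l) $$ (a, b))"
        using k[OF eval_mat_carrier] by (intro sum.cong refl) (simp add: L_def)
      have con: "kron (pen_const L) (1\<^sub>m n) $$ (i * n + a, j * n + b) = c0 (e i) (e j) * (if a = b then 1 else 0)"
        using ab k[OF one_carrier_mat, of c0] by (simp add: L_def)
      show ?thesis
        using lt by (simp add: pencil_eval_def Let_def L_def[THEN arg_cong[where f = pen_size]] aux[unfolded] gam con 2)
    qed
    let ?f = "\<lambda>(i, a). i * n + a"
    have "psd (pen_size L * n) ?P \<longleftrightarrow> pos_on {..<?N * n} (\<lambda>k l. ?P $$ (k, l))"
      using P by (simp add: psd_iff L_def)
    also have "\<dots> \<longleftrightarrow> pos_on ({..<?N} \<times> {..<n}) (\<lambda>s t. ?P $$ (?f s, ?f t))"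
      by (rule pos_on_bij[OF bij_betw_mult_add])
    also have "\<dots> \<longleftrightarrow> pos_on ({..<?N} \<times> {..<n}) (\<lambda>s t. ?M (map_prod e id s) (map_prod e id t))"
      by (rule pos_on_cong) (auto simp: entry)
    also have "\<dots> \<longleftrightarrow> pos_on (S \<times> {..<n}) ?M"
      by (rule pos_on_bij[symmetric]) (intro bij_betw_map_prod e bij_betw_id)
    finally show "psd (pen_size L * n) ?P \<longleftrightarrow> pos_on (S \<times> {..<n}) ?M" .
  qed
qed

text \<open>The pencil is block diagonal.  Its rows are indexed by the rows of the Hankel matrix, those of
  the localizing matrix, and both signs of each equation in (M): \<open>None\<close> stands for the
  normalization at the empty word and \<open>Some j\<close> for the equation of the \<open>j\<close>-th polynomial.\<close>

type_synonym pencil_row = "ncword + (ncword \<times> nat) + (nat option \<times> bool)"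

fun pencil_const :: "pencil_row \<Rightarrow> pencil_row \<Rightarrow> complex" where
  "pencil_const (Inr (Inr s)) (Inr (Inr t)) =
     (if s = t then (if snd s then 1 else -1) * (if fst s = None then -1 else 0) else 0)"
| "pencil_const _ _ = 0"

fun pencil_gam :: "nat \<Rightarrow> pencil_row \<Rightarrow> pencil_row \<Rightarrow> complex" where
  "pencil_gam j (Inr (Inr s)) (Inr (Inr t)) =
     (if s = t then (if snd s then 1 else -1) * (if fst s = Some j then -1 else 0) else 0)"
| "pencil_gam j _ _ = 0"

fun pencil_word :: "nat \<Rightarrow> ncpoly list \<Rightarrow> ncmpoly \<Rightarrow> ncword \<Rightarrow>
    pencil_row \<Rightarrow> pencil_row \<Rightarrow> complex" where
  "pencil_word \<mu> \<Gamma> p w (Inl \<alpha>) (Inl \<beta>) = (if rev \<alpha> @ \<beta> = w then 1 else 0)"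
| "pencil_word \<mu> \<Gamma> p w (Inr (Inl (\<alpha>, i))) (Inr (Inl (\<beta>, j))) =
     (\<Sum>v\<in>msupp \<mu> \<mu> p. if rev \<alpha> @ v @ \<beta> = w then p v $$ (i, j) else 0)"
| "pencil_word \<mu> \<Gamma> p w (Inr (Inr s)) (Inr (Inr t)) = (if s = t then (if snd s then 1 else -1) *
     (case fst s of None \<Rightarrow> if w = [] then 1 else 0 | Some j \<Rightarrow> (\<Gamma> ! j) w) else 0)"
| "pencil_word \<mu> \<Gamma> p w _ _ = 0"

lemma pencil_const_hermitian: "pencil_const t s = cnj (pencil_const s t)"
  by (induction s t rule: pencil_const.induct) simp_all

lemma pencil_gam_hermitian: "pencil_gam j t s = cnj (pencil_gam j s t)"
  by (induction j s t rule: pencil_gam.induct) simp_all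

lemma rev_append_eq_rev: "rev \<beta> @ \<alpha> = rev w \<longleftrightarrow> rev \<alpha> @ \<beta> = (w :: 'a list)"
  by (metis rev_append rev_rev_ident)

text \<open>Reversing the word transposes each block: directly for the Hankel rows, by symmetry of
  \<open>p\<close> for the localizing rows, and by symmetry of the polynomials in \<Gamma> for the
  rows of the equations.\<close>

lemma pencil_word_hermitian:
  assumes p: "is_ncmpoly g \<mu> \<mu> p" and ps: "symmetric_ncmpoly p"
    and \<Gamma>: "\<And>\<gamma>. \<gamma> \<in> set \<Gamma> \<Longrightarrow> symmetric_ncpoly \<gamma>"
    and s: "s \<in> A <+> (B \<times> {..<\<mu>}) <+> (insert None (Some ` {..<length \<Gamma>}) \<times> UNIV)"
    and t: "t \<in> A <+> (B \<times> {..<\<mu>}) <+> (insert None (Some ` {..<length \<Gamma>}) \<times> UNIV)"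
  shows "pencil_word \<mu> \<Gamma> p (rev w) t s = cnj (pencil_word \<mu> \<Gamma> p w s t)"
proof -
  have c: "p v \<in> carrier_mat \<mu> \<mu>" for v using p by (simp add: is_ncmpoly_def)
  have prev: "p (rev v) $$ (j, i) = cnj (p v $$ (i, j))" if "i < \<mu>" "j < \<mu>" for v i j
    using ps that c[of v] by (simp add: symmetric_ncmpoly_def)
  \<comment> \<open>Symmetry makes the support of \<open>p\<close> invariant under reversal, which
    permits reindexing the sum over it.\<close>
  have mrev: "rev ` msupp \<mu> \<mu> p = msupp \<mu> \<mu> p"
  proof -
    have "rev v \<in> msupp \<mu> \<mu> p" if v: "v \<in> msupp \<mu> \<mu> p" for v
    proof (rule ccontr)
      assume "rev v \<notin> msupp \<mu> \<mu> p"
      then have "p (rev v) = 0\<^sub>m \<mu> \<mu>" by (simp add: msupp_def)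
      then have "p v $$ (i, j) = 0" if "i < \<mu>" "j < \<mu>" for i j using prev[OF that, of v] that by simp
      then have "p v = 0\<^sub>m \<mu> \<mu>" using c[of v] by (intro eq_matI) auto
      then show False using v by (simp add: msupp_def)
    qed
    then show ?thesis by (force simp: image_iff)
  qed
  have r: "(\<Sum>v\<in>msupp \<mu> \<mu> p. f (rev v)) = (\<Sum>v\<in>msupp \<mu> \<mu> p. f v)" for f :: "ncword \<Rightarrow> complex"
    using sum.reindex[of rev "msupp \<mu> \<mu> p" f] by (simp add: mrev)
  have loc: "(\<Sum>v\<in>msupp \<mu> \<mu> p. if rev \<beta> @ v @ \<alpha> = rev w then p v $$ (j, i) else 0)
      = cnj (\<Sum>v\<in>msupp \<mu> \<mu> p. if rev \<alpha> @ v @ \<beta> = w then p v $$ (i, j) else 0)"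
    if "i < \<mu>" "j < \<mu>" for \<alpha> \<beta> i j
  proof -
    have "(\<Sum>v\<in>msupp \<mu> \<mu> p. if rev \<beta> @ v @ \<alpha> = rev w then p v $$ (j, i) else 0)
      = (\<Sum>v\<in>msupp \<mu> \<mu> p. if rev \<beta> @ rev v @ \<alpha> = rev w then p (rev v) $$ (j, i) else 0)"
      by (rule r[symmetric])
    also have "\<dots> = (\<Sum>v\<in>msupp \<mu> \<mu> p. if rev \<alpha> @ v @ \<beta> = w then cnj (p v $$ (i, j)) else 0)"
    proof (intro sum.cong refl)
      fix v
      have "rev \<beta> @ rev v @ \<alpha> = rev w \<longleftrightarrow> rev \<alpha> @ v @ \<beta> = w"
        using rev_append_eq_rev[of "v @ \<beta>" \<alpha> w] by simp
      then show "(if rev \<beta> @ rev v @ \<alpha> = rev w then p (rev v) $$ (j, i) else 0) =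
         (if rev \<alpha> @ v @ \<beta> = w then cnj (p v $$ (i, j)) else 0)"
        using prev[OF that] by simp
    qed
    also have "\<dots> = cnj (\<Sum>v\<in>msupp \<mu> \<mu> p. if rev \<alpha> @ v @ \<beta> = w then p v $$ (i, j) else 0)"
      by (simp add: if_distrib[of cnj] cong: if_cong)
    finally show ?thesis .
  qed
  have sym: "(\<Gamma> ! j) (rev w) = cnj ((\<Gamma> ! j) w)" if "j < length \<Gamma>" for j
    using \<Gamma>[OF nth_mem[OF that]] by (simp add: symmetric_ncpoly_def)
  have sc: "(\<exists>\<alpha>. x = Inl \<alpha>) \<or> (\<exists>\<alpha> i. x = Inr (Inl (\<alpha>, i)) \<and> i < \<mu>) \<or>
      (\<exists>q \<sigma>. x = Inr (Inr (q, \<sigma>)) \<and> (\<forall>j. q = Some j \<longrightarrow> j < length \<Gamma>))"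
    if "x \<in> A <+> (B \<times> {..<\<mu>}) <+> (insert None (Some ` {..<length \<Gamma>}) \<times> UNIV)"
    for x :: "pencil_row"
    using that by auto
  from sc[OF s] sc[OF t] show ?thesis
  proof (elim disjE exE conjE)
    fix \<alpha> i \<beta> j
    assume "s = Inr (Inl (\<alpha>, i))" "i < \<mu>" "t = Inr (Inl (\<beta>, j))" "j < \<mu>"
    then show ?thesis by (simp only: pencil_word.simps loc)
  next
    fix q \<sigma> q' \<sigma>'
    assume st: "s = Inr (Inr (q, \<sigma>))" "t = Inr (Inr (q', \<sigma>'))"
      and len: "\<forall>j. q = Some j \<longrightarrow> j < length \<Gamma>"
    show ?thesis
    proof (cases "(q', \<sigma>') = (q, \<sigma>)")
      case True
      show ?thesis
      proof (cases q)
        case None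
        then show ?thesis unfolding st using True by simp
      next
        case (Some j)
        then have "(\<Gamma> ! j) (rev w) = cnj ((\<Gamma> ! j) w)" using len by (intro sym) blast
        then show ?thesis unfolding st Some True[unfolded Some] by simp
      qed
    next
      case False
      then have "(q, \<sigma>) \<noteq> (q', \<sigma>')" by blast
      with False show ?thesis unfolding st by (simp only: pencil_word.simps if_False complex_cnj_zero)
    qed
  qed (simp_all add: rev_append_eq_rev)
qed

section \<open>The pencil at a fixed level\<close>

text \<open>Each condition is affine in the moments and in the evaluations of \<Gamma> at
  \<open>X\<close>. Since \<Gamma> begins with the variables, its first \<open>g\<close> equations
  force the degree-one moments to be \<open>X\<close> itself, so projecting to \<open>x\<close>
  recovers \<open>hat\<close>.\<close>

lemma L_fin_hat_pencil:
  assumes p: "is_ncmpoly g \<mu> \<mu> p" and ps: "symmetric_ncmpoly p"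
    and \<Gamma>: "\<And>\<gamma>. \<gamma> \<in> set \<Gamma> \<Longrightarrow> is_ncpoly g \<gamma> \<and> symmetric_ncpoly \<gamma> \<and> ncdeg \<gamma> \<le> d"
    and var: "\<And>j. j < g \<Longrightarrow> j < length \<Gamma> \<and> \<Gamma> ! j = ncvar j"
  obtains L where "is_Gamma_pencil \<Gamma> L" "\<And>n. L_fin_hat g \<Gamma> \<mu> p n d = proj_x g \<Gamma> L n"
proof -
  define W where "W = words_upto g (2 * d + ncmdeg \<mu> p + 1)"
  define A where "A = words_upto g (d + nat \<lceil>real (ncmdeg \<mu> p) / 2\<rceil>)"
  define B where "B = words_upto g d"
  define Q where "Q = insert None (Some ` {..<length \<Gamma>})"
  let ?S = "A <+> (B \<times> {..<\<mu>}) <+> (Q \<times> (UNIV :: bool set))"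
  have fin: "finite W" "finite A" "finite B" "finite Q"
    by (simp_all add: W_def A_def B_def Q_def finite_words_upto)
  have Wrev: "rev w \<in> W" if "w \<in> W" for w using that by (simp add: W_def words_upto_def)
  have AW: "rev \<alpha> @ \<beta> \<in> W" if "\<alpha> \<in> A" "\<beta> \<in> A" for \<alpha> \<beta>
    using that unfolding A_def W_def by (rule words_upto_hankel)
  have BW: "rev \<alpha> @ v @ \<beta> \<in> W" if "\<alpha> \<in> B" "\<beta> \<in> B" "v \<in> msupp \<mu> \<mu> p" for \<alpha> \<beta> v
    using that unfolding B_def W_def by (rule words_upto_loc[OF p])
  have \<Gamma>W: "supp \<gamma> \<subseteq> W" if "\<gamma> \<in> set \<Gamma>" for \<gamma>
    using \<Gamma>[OF that] ncdeg_ge[of g \<gamma>] by (fastforce simp: W_def words_upto_def is_ncpoly_def)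
  have nilW: "[] \<in> W" and varW: "\<And>i. i < g \<Longrightarrow> [i] \<in> W" by (auto simp: W_def words_upto_def)
  obtain zs where zs: "distinct zs" "set zs = W \<times> (UNIV :: bool set)"
    using finite_distinct_list[of "W \<times> (UNIV :: bool set)"] fin by auto
  have finS: "finite ?S" using fin by simp
  have herm: "pencil_word \<mu> \<Gamma> p (rev w) t s = cnj (pencil_word \<mu> \<Gamma> p w s t)" if "s \<in> ?S" "t \<in> ?S" for w s t
    using that \<Gamma> unfolding Q_def by (intro pencil_word_hermitian[OF p ps]) auto
  obtain L where L: "is_Gamma_pencil \<Gamma> L" "length (pen_aux L) = length zs"
    and psd: "\<forall>n X Y U. Y \<in> sa_tuples (length zs) n \<longrightarrow> (\<forall>k < length zs. Y ! k = U (zs ! k)) \<longrightarrow>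
      (psd (pen_size L * n) (pencil_eval \<Gamma> L n X Y) \<longleftrightarrow>
      pos_on (?S \<times> {..<n}) (\<lambda>(s, a) (t, b). pencil_const s t * (if a = b then 1 else 0) +
        (\<Sum>j<length \<Gamma>. pencil_gam j s t * eval_mat n X (\<Gamma> ! j) $$ (a, b)) +
        (\<Sum>w\<in>W. pencil_word \<mu> \<Gamma> p w s t * sym_family U w a b)))"
    by (rule kernel_pencil[where \<Gamma> = \<Gamma> and S = ?S and W = W and zs = zs and ?c0.0 = pencil_const
          and cA = pencil_gam and cY = "pencil_word \<mu> \<Gamma> p", OF finS fin(1) Wrev zs
          pencil_const_hermitian pencil_gam_hermitian herm]) blast
  \<comment> \<open>The defect of the normalization or of one equation of (M); with both signs,
    these defects form the last diagonal blocks of the pencil.\<close>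
  define E where "E n X U q a b = (case q of None \<Rightarrow> sym_family U [] a b - (if a = b then 1 else 0)
    | Some j \<Rightarrow> (\<Sum>w\<in>W. (\<Gamma> ! j) w * sym_family U w a b) - eval_mat n X (\<Gamma> ! j) $$ (a, b))"
    for n X U q a b
  have main: "psd (pen_size L * n) (pencil_eval \<Gamma> L n X Y) \<longleftrightarrow>
      pos_on (A \<times> {..<n}) (hankel_kernel (sym_family U)) \<and>
      pos_on (B \<times> {..<\<mu>} \<times> {..<n}) (loc_kernel \<mu> p (sym_family U)) \<and>
      (\<forall>q\<in>Q. \<forall>a<n. \<forall>b<n. E n X U q a b = 0)"
    if Y: "Y \<in> sa_tuples (length zs) n" "\<forall>k < length zs. Y ! k = U (zs ! k)" for n X Y U
  proof -
    let ?M = "\<lambda>(s, a) (t, b). pencil_const s t * (if a = b then 1 else 0) +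
        (\<Sum>j<length \<Gamma>. pencil_gam j s t * eval_mat n X (\<Gamma> ! j) $$ (a, b)) +
        (\<Sum>w\<in>W. pencil_word \<mu> \<Gamma> p w s t * sym_family U w a b)"
    let ?h = "\<lambda>((\<alpha>, i), a). (\<alpha>, i, a) :: ncword \<times> nat \<times> nat"
    have h: "pos_on (A \<times> {..<n}) (\<lambda>s t. ?M (map_prod Inl id s) (map_prod Inl id t))
       \<longleftrightarrow> pos_on (A \<times> {..<n}) (hankel_kernel (sym_family U))"
    proof (rule pos_on_cong)
      fix s t assume "s \<in> A \<times> {..<n}" "t \<in> A \<times> {..<n}"
      moreover have "(\<Sum>w\<in>W. (if rev \<alpha> @ \<beta> = w then 1 else 0) * sym_family U w a b) = sym_family U (rev \<alpha> @ \<beta>) a b"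
        if "\<alpha> \<in> A" "\<beta> \<in> A" for \<alpha> \<beta> a b
        using AW[OF that] fin by (simp add: if_distrib[of "\<lambda>x. x * _"] cong: if_cong)
      ultimately show "?M (map_prod Inl id s) (map_prod Inl id t) = hankel_kernel (sym_family U) s t"
        by (auto simp: hankel_kernel_def)
    qed
    have l: "pos_on ((B \<times> {..<\<mu>}) \<times> {..<n}) (\<lambda>s t. ?M (map_prod (Inr \<circ> Inl) id s) (map_prod (Inr \<circ> Inl) id t))
       \<longleftrightarrow> pos_on (B \<times> {..<\<mu>} \<times> {..<n}) (loc_kernel \<mu> p (sym_family U))"
    proof -
      have "bij_betw ?h ((B \<times> {..<\<mu>}) \<times> {..<n}) (B \<times> {..<\<mu>} \<times> {..<n})"
        by (rule bij_betw_byWitness[where f' = "\<lambda>(\<alpha>, i, a). ((\<alpha>, i), a)"]) auto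
      note b = pos_on_bij[OF this]
      show ?thesis
        unfolding b
      proof (rule pos_on_cong)
        fix s t :: "(ncword \<times> nat) \<times> nat"
        assume s: "s \<in> (B \<times> {..<\<mu>}) \<times> {..<n}" and t: "t \<in> (B \<times> {..<\<mu>}) \<times> {..<n}"
        obtain \<alpha> i a \<beta> j b where st: "s = ((\<alpha>, i), a)" "t = ((\<beta>, j), b)" by (metis surj_pair)
        have "(\<Sum>w\<in>W. (\<Sum>v\<in>msupp \<mu> \<mu> p. if rev \<alpha> @ v @ \<beta> = w then p v $$ (i, j) else 0) * sym_family U w a b)
          = (\<Sum>v\<in>msupp \<mu> \<mu> p. \<Sum>w\<in>W. (if rev \<alpha> @ v @ \<beta> = w then p v $$ (i, j) else 0) * sym_family U w a b)"
          unfolding sum_distrib_right by (rule sum.swap)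
        also have "\<dots> = (\<Sum>v\<in>msupp \<mu> \<mu> p. p v $$ (i, j) * sym_family U (rev \<alpha> @ v @ \<beta>) a b)"
        proof (intro sum.cong refl)
          fix v assume "v \<in> msupp \<mu> \<mu> p"
          then have "rev \<alpha> @ v @ \<beta> \<in> W" using s t st by (intro BW) auto
          then show "(\<Sum>w\<in>W. (if rev \<alpha> @ v @ \<beta> = w then p v $$ (i, j) else 0) * sym_family U w a b)
             = p v $$ (i, j) * sym_family U (rev \<alpha> @ v @ \<beta>) a b"
            using fin by (simp add: if_distrib[of "\<lambda>x. x * _"] cong: if_cong)
        qed
        finally show "?M (map_prod (Inr \<circ> Inl) id s) (map_prod (Inr \<circ> Inl) id t)
            = loc_kernel \<mu> p (sym_family U) (?h s) (?h t)"
          by (simp add: st loc_kernel_def)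
      qed
    qed
    have q: "pos_on ((Q \<times> UNIV) \<times> {..<n}) (\<lambda>s t. ?M (map_prod (Inr \<circ> Inr) id s) (map_prod (Inr \<circ> Inr) id t))
       \<longleftrightarrow> (\<forall>q\<in>Q. \<forall>a<n. \<forall>b<n. E n X U q a b = 0)"
      unfolding pos_on_signed_iff[symmetric]
    proof (rule pos_on_cong)
      fix s t :: "(nat option \<times> bool) \<times> nat"
      assume s: "s \<in> (Q \<times> UNIV) \<times> {..<n}"
      obtain x \<sigma> a z b where st: "s = ((x, \<sigma>), a)" "t = (z, b)" by (metis surj_pair)
      show "?M (map_prod (Inr \<circ> Inr) id s) (map_prod (Inr \<circ> Inr) id t)
        = (case s of (s, a) \<Rightarrow> \<lambda>(t, b). if s = t then (if snd s then 1 else -1) * E n X U (fst s) a b else 0) t"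
      proof (cases "z = (x, \<sigma>)")
        case True
        show ?thesis
        proof (cases x)
          case None
          then show ?thesis using True st fin nilW
            by (simp add: E_def if_distrib[of "\<lambda>x. x * _"] sum_negf cong: if_cong)
        next
          case (Some j)
          then have "j < length \<Gamma>" using s st by (auto simp: Q_def)
          then show ?thesis using True st Some
            by (simp add: E_def if_distrib[of "\<lambda>x. x * _"] sum_negf cong: if_cong)
        qed
      qed (use st in auto)
    qed
    have 1: "psd (pen_size L * n) (pencil_eval \<Gamma> L n X Y) \<longleftrightarrow> pos_on (?S \<times> {..<n}) ?M"
      using psd Y by blast
    have 2: "pos_on (?S \<times> {..<n}) ?M \<longleftrightarrow>
        pos_on (A \<times> {..<n}) (\<lambda>s t. ?M (map_prod Inl id s) (map_prod Inl id t)) \<and>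
        pos_on (((B \<times> {..<\<mu>}) <+> (Q \<times> UNIV)) \<times> {..<n}) (\<lambda>s t. ?M (map_prod Inr id s) (map_prod Inr id t))"
      by (rule pos_on_Plus_Times) (use fin in auto)
    have 3: "pos_on (((B \<times> {..<\<mu>}) <+> (Q \<times> UNIV)) \<times> {..<n}) (\<lambda>s t. ?M (map_prod Inr id s) (map_prod Inr id t))
      \<longleftrightarrow> pos_on ((B \<times> {..<\<mu>}) \<times> {..<n}) (\<lambda>s t. ?M (map_prod Inr id (map_prod Inl id s)) (map_prod Inr id (map_prod Inl id t)))
        \<and> pos_on ((Q \<times> UNIV) \<times> {..<n}) (\<lambda>s t. ?M (map_prod Inr id (map_prod Inr id s)) (map_prod Inr id (map_prod Inr id t)))"
      by (rule pos_on_Plus_Times) (use fin in auto)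
    show ?thesis
      unfolding 1 2 3 h using l q by (simp only: prod.map_comp id_comp comp_id)
  qed
  have "L_fin_hat g \<Gamma> \<mu> p n d \<subseteq> proj_x g \<Gamma> L n" for n
  proof
    fix X assume "X \<in> L_fin_hat g \<Gamma> \<mu> p n d"
    then obtain Z where X: "X = hat g Z" and Z: "Z \<in> L_fin g \<Gamma> \<mu> p n d" by (auto simp: L_fin_hat_def)
    have mf: "Z \<in> moment_families g \<Gamma> n W"
      and ph: "pos_on (A \<times> {..<n}) (hankel_kernel (entries Z))"
      and pl: "pos_on (B \<times> {..<\<mu>} \<times> {..<n}) (loc_kernel \<mu> p (entries Z))"
      using Z unfolding L_fin_iff[OF p] W_def A_def B_def by auto
    have c: "Z w \<in> carrier_mat n n" if "w \<in> W" for w using moment_families_carrier[OF mf that] .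
    have adj: "Z (rev w) $$ (a, b) = cnj (Z w $$ (b, a))" if "w \<in> W" "a < n" "b < n" for w a b
      using mf that c[OF that(1)] by (simp add: moment_families_def)
    \<comment> \<open>The self-adjoint real and imaginary parts of \<open>Z w\<close>; the factor
      \<open>- \<i>\<close> cancels the one in \<open>sym_family\<close>, which therefore returns
      \<open>Z\<close>.\<close>
    define U where "U = (\<lambda>(w, \<sigma>). mat n n (\<lambda>(a, b).
       if \<sigma> then - \<i> * (Z w $$ (a, b) - Z (rev w) $$ (a, b)) / 2 else (Z w $$ (a, b) + Z (rev w) $$ (a, b)) / 2))"
    have UZ: "sym_family U w a b = Z w $$ (a, b)" if "a < n" "b < n" for w a b
      using that by (simp add: sym_family_def U_def field_simps)
    have Usa: "U z \<in> sa_mats n" if "z \<in> W \<times> UNIV" for z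
    proof -
      obtain w \<sigma> where z: "z = (w, \<sigma>)" "w \<in> W" using \<open>z \<in> W \<times> UNIV\<close> by auto
      have "Z w $$ (a, b) = cnj (Z (rev w) $$ (b, a))" if "a < n" "b < n" for a b
        using adj[OF z(2) that(2,1)] by simp
      then show ?thesis using adj[OF z(2)] z(1)
        by (auto simp: sa_mats_def U_def intro!: eq_matI) (simp_all add: algebra_simps)
    qed
    have Y: "map U zs \<in> sa_tuples (length zs) n" using zs Usa by (auto simp: sa_tuples_def)
    have YU: "\<forall>k < length zs. map U zs ! k = U (zs ! k)" by simp
    have "X \<in> sa_tuples g n"
    proof -
      have "Z [i] \<in> sa_mats n" if "i < g" for i
      proof -
        have "Z (rev [i]) = mat_adjoint (Z [i])" using mf varW[OF that] unfolding moment_families_def by blast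
        then show ?thesis using c[OF varW[OF that]] by (simp add: sa_mats_def)
      qed
      then show ?thesis by (auto simp: sa_tuples_def X hat_def)
    qed
    moreover have "psd (pen_size L * n) (pencil_eval \<Gamma> L n X (map U zs))"
      unfolding main[OF Y YU]
    proof (intro conjI ballI allI impI)
      show "pos_on (A \<times> {..<n}) (hankel_kernel (sym_family U))"
        using ph by (subst pos_on_cong[where M' = "hankel_kernel (entries Z)"]) (auto simp: hankel_kernel_def UZ)
      show "pos_on (B \<times> {..<\<mu>} \<times> {..<n}) (loc_kernel \<mu> p (sym_family U))"
        using pl by (subst pos_on_cong[where M' = "loc_kernel \<mu> p (entries Z)"])
          (auto simp: loc_kernel_def UZ intro!: sum.cong)
      fix q a b assume q: "q \<in> Q" and ab: "a < n" "b < n"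
      show "E n X U q a b = 0"
      proof (cases q)
        case None
        have "Z [] = 1\<^sub>m n" using mf by (simp add: moment_families_def)
        then show ?thesis using None ab by (simp add: E_def UZ)
      next
        case (Some j)
        then have \<gamma>: "\<Gamma> ! j \<in> set \<Gamma>" using q by (auto simp: Q_def)
        have "(\<Sum>w\<in>W. (\<Gamma> ! j) w * Z w $$ (a, b)) = (\<Sum>w\<in>supp (\<Gamma> ! j). (\<Gamma> ! j) w * Z w $$ (a, b))"
          using fin \<Gamma>W[OF \<gamma>] by (intro sum.mono_neutral_right) (auto simp: supp_def)
        also have "\<dots> = (\<Sum>w\<in>supp (\<Gamma> ! j). ((\<Gamma> ! j) w \<cdot>\<^sub>m Z w) $$ (a, b))"
        proof (intro sum.cong refl)
          fix w assume "w \<in> supp (\<Gamma> ! j)"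
          then have "Z w \<in> carrier_mat n n" using \<Gamma>W[OF \<gamma>] c by blast
          then show "(\<Gamma> ! j) w * Z w $$ (a, b) = ((\<Gamma> ! j) w \<cdot>\<^sub>m Z w) $$ (a, b)" using ab by simp
        qed
        also have "\<dots> = eval_mat n X (\<Gamma> ! j) $$ (a, b)"
        proof -
          have "msum n n (\<lambda>m. (\<Gamma> ! j) m \<cdot>\<^sub>m Z m) (supp (\<Gamma> ! j)) = eval_mat n X (\<Gamma> ! j)"
            using mf \<gamma> unfolding moment_families_def X by blast
          then show ?thesis using ab by (metis msum_index)
        qed
        finally show ?thesis using Some ab by (simp add: E_def UZ)
      qed
    qed
    ultimately show "X \<in> proj_x g \<Gamma> L n" using Y L(2) unfolding proj_x_def by auto
  qed
  moreover have "proj_x g \<Gamma> L n \<subseteq> L_fin_hat g \<Gamma> \<mu> p n d" for n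
  proof
    fix X assume "X \<in> proj_x g \<Gamma> L n"
    then obtain Y where X: "X \<in> sa_tuples g n" and Y: "Y \<in> sa_tuples (length zs) n"
      and psdY: "psd (pen_size L * n) (pencil_eval \<Gamma> L n X Y)"
      using L(2) unfolding proj_x_def by auto
    \<comment> \<open>Reads the list of auxiliary variables as a family indexed by word and
      part.\<close>
    define U where "U z = Y ! the_inv_into {..<length zs} (nth zs) z" for z
    have inj: "inj_on (nth zs) {..<length zs}" using zs(1) by (simp add: inj_on_nth)
    have YU: "Y ! k = U (zs ! k)" if "k < length zs" for k
      using that by (simp add: U_def the_inv_into_f_f[OF inj])
    have Uadj: "U z $$ (a, b) = cnj (U z $$ (b, a))" if z: "z \<in> W \<times> UNIV" and ab: "a < n" "b < n" for z a b
    proof -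
      obtain k where k: "k < length zs" "z = zs ! k" using z zs(2) by (metis in_set_conv_nth)
      have "Y ! k \<in> set Y" using Y k(1) by (intro nth_mem) (simp add: sa_tuples_def)
      then have "Y ! k \<in> sa_mats n" using Y by (auto simp: sa_tuples_def)
      then have "mat_adjoint (U z) = U z" "U z \<in> carrier_mat n n"
        using YU[OF k(1)] k(2) by (auto simp: sa_mats_def)
      then show ?thesis using ab mat_adjoint_index[of a "U z" b] by auto
    qed
    have cond: "pos_on (A \<times> {..<n}) (hankel_kernel (sym_family U))"
      "pos_on (B \<times> {..<\<mu>} \<times> {..<n}) (loc_kernel \<mu> p (sym_family U))"
      "\<And>q a b. q \<in> Q \<Longrightarrow> a < n \<Longrightarrow> b < n \<Longrightarrow> E n X U q a b = 0"
      using psdY main[OF Y, of U X] YU by blast+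
    define Z where "Z = (\<lambda>w\<in>W. mat n n (\<lambda>(a, b). sym_family U w a b))"
    have Zs: "(\<Sum>w\<in>supp \<gamma>. (\<gamma> w \<cdot>\<^sub>m Z w) $$ (a, b)) = (\<Sum>w\<in>W. \<gamma> w * sym_family U w a b)"
      if "\<gamma> \<in> set \<Gamma>" "a < n" "b < n" for \<gamma> a b
    proof -
      have "(\<Sum>w\<in>supp \<gamma>. (\<gamma> w \<cdot>\<^sub>m Z w) $$ (a, b)) = (\<Sum>w\<in>supp \<gamma>. \<gamma> w * sym_family U w a b)"
        using \<Gamma>W[OF that(1)] that by (intro sum.cong refl) (auto simp: Z_def subset_iff)
      also have "\<dots> = (\<Sum>w\<in>W. \<gamma> w * sym_family U w a b)"
        using fin \<Gamma>W[OF that(1)] by (intro sum.mono_neutral_left) (auto simp: supp_def)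
      finally show ?thesis .
    qed
    have eqn: "(\<Sum>w\<in>W. (\<Gamma> ! j) w * sym_family U w a b) = eval_mat n X (\<Gamma> ! j) $$ (a, b)"
      if "j < length \<Gamma>" "a < n" "b < n" for j a b
      using cond(3)[of "Some j" a b] that by (simp add: E_def Q_def)
    have hat: "hat g Z = X"
    proof (rule nth_equalityI)
      show "length (hat g Z) = length X" using X by (simp add: hat_def sa_tuples_def)
      fix i assume "i < length (hat g Z)"
      then have i: "i < g" by (simp add: hat_def)
      have Xc: "X ! i \<in> carrier_mat n n"
      proof -
        have "X ! i \<in> set X" using X i by (intro nth_mem) (simp add: sa_tuples_def)
        then show ?thesis using X by (auto simp: sa_tuples_def sa_mats_def)
      qed
      \<comment> \<open>The \<open>i\<close>-th polynomial is the variable itself, so its equation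
        identifies the moment at \<open>[i]\<close> with \<open>X ! i\<close>.\<close>
      have "sym_family U [i] a b = X ! i $$ (a, b)" if "a < n" "b < n" for a b
      proof -
        have "(\<Sum>w\<in>W. ncvar i w * sym_family U w a b) = sym_family U [i] a b"
          using fin varW[OF i] by (simp add: ncvar_def if_distrib[of "\<lambda>x. x * _"] cong: if_cong)
        then show ?thesis using eqn[of i a b] var[OF i] that eval_mat_ncvar[of X i n, OF Xc] by simp
      qed
      then show "hat g Z ! i = X ! i" using i Xc varW[OF i] by (intro eq_matI) (auto simp: hat_def Z_def)
    qed
    have "Z \<in> moment_families g \<Gamma> n W"
      unfolding moment_families_def mem_Collect_eq
    proof (intro conjI ballI)
      show "Z \<in> W \<rightarrow>\<^sub>E carrier_mat n n" by (auto simp: Z_def)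
      have "sym_family U [] a b = (if a = b then 1 else 0)" if "a < n" "b < n" for a b
        using cond(3)[of None a b] that by (simp add: E_def Q_def)
      then show "Z [] = 1\<^sub>m n" using nilW by (intro eq_matI) (auto simp: Z_def)
      fix w assume w: "w \<in> W"
      \<comment> \<open>The averaging in \<open>sym_family\<close> turns self-adjointness of the
        variables into the adjoint relation between a word and its reversal.\<close>
      have "sym_family U (rev w) a b = cnj (sym_family U w b a)" if "a < n" "b < n" for a b
        using Uadj[of "(w, True)" b a] Uadj[of "(w, False)" b a] Uadj[of "(rev w, True)" b a]
          Uadj[of "(rev w, False)" b a] w Wrev[OF w] that
        by (simp add: sym_family_def field_simps)
      then show "Z (rev w) = mat_adjoint (Z w)"
        using w Wrev[OF w] by (intro eq_matI) (auto simp: Z_def)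
    next
      fix \<gamma> assume \<gamma>: "\<gamma> \<in> set \<Gamma>"
      then obtain j where j: "j < length \<Gamma>" "\<gamma> = \<Gamma> ! j" by (metis in_set_conv_nth)
      show "msum n n (\<lambda>m. \<gamma> m \<cdot>\<^sub>m Z m) (supp \<gamma>) = eval_mat n (hat g Z) \<gamma>"
        unfolding hat using Zs[OF \<gamma>] eqn[OF j(1)] eval_mat_carrier[of n X \<gamma>] j(2)
        by (intro eq_matI) auto
    qed
    moreover have "pos_on (A \<times> {..<n}) (hankel_kernel (entries Z))"
      using cond(1) AW by (subst pos_on_cong[where M' = "hankel_kernel (sym_family U)"])
        (auto simp: hankel_kernel_def Z_def)
    moreover have "pos_on (B \<times> {..<\<mu>} \<times> {..<n}) (loc_kernel \<mu> p (entries Z))"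
      using cond(2) BW by (subst pos_on_cong[where M' = "loc_kernel \<mu> p (sym_family U)"])
        (auto simp: loc_kernel_def Z_def intro!: sum.cong)
    ultimately have "Z \<in> L_fin g \<Gamma> \<mu> p n d"
      unfolding L_fin_iff[OF p] W_def A_def B_def by blast
    then show "X \<in> L_fin_hat g \<Gamma> \<mu> p n d" using hat by (auto simp: L_fin_hat_def)
  qed
  ultimately show ?thesis using L(1) that[of L] by blast
qed

theorem theorem4p10:
  fixes g r \<mu> \<delta> :: nat and \<Gamma> :: "ncpoly list" and p :: ncmpoly
  assumes "1 \<le> g" and "g \<le> r" and "length \<Gamma> = r"
    and "\<forall>\<gamma>\<in>set \<Gamma>. is_ncpoly g \<gamma> \<and> symmetric_ncpoly \<gamma>"
    and "\<forall>j<g. \<Gamma> ! j = ncvar j"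
    and "\<delta> = Max (ncdeg ` set \<Gamma>)"
    and "is_ncmpoly g \<mu> \<mu> p" and "symmetric_ncmpoly p" and "archimedean g \<mu> p"
  shows
    "(\<forall>n. (\<Inter>d\<in>{\<delta>..}. L_fin_hat g \<Gamma> \<mu> p n d) = L_inf_hat g \<Gamma> \<mu> p n \<and>
          L_inf_hat g \<Gamma> \<mu> p n = Gamma_conv g \<Gamma> \<mu> p n) \<and>
     (\<forall>d\<ge>\<delta>. \<exists>L. is_Gamma_pencil \<Gamma> L \<and> (\<forall>n. L_fin_hat g \<Gamma> \<mu> p n d = proj_x g \<Gamma> L n)) \<and>
     (\<forall>n. \<forall>d\<ge>\<delta>. Gamma_conv g \<Gamma> \<mu> p n \<subseteq> L_fin_hat g \<Gamma> \<mu> p n d \<and>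
          (\<forall>d'\<ge>d. L_fin_hat g \<Gamma> \<mu> p n d' \<subseteq> L_fin_hat g \<Gamma> \<mu> p n d))"
proof -
  note p = assms(7) and ps = assms(8) and arch = assms(9)
  have \<Gamma>: "is_ncpoly g \<gamma> \<and> ncdeg \<gamma> \<le> \<delta>" "symmetric_ncpoly \<gamma>" if "\<gamma> \<in> set \<Gamma>" for \<gamma>
    using assms(4,6) that by auto
  have \<Gamma>d: "is_ncpoly g \<gamma> \<and> ncdeg \<gamma> \<le> d" if "\<delta> \<le> d" "\<gamma> \<in> set \<Gamma>" for d \<gamma>
    using \<Gamma>[OF that(2)] that(1) by auto
  have fin_inf: "(\<Inter>d\<in>{\<delta>..}. L_fin_hat g \<Gamma> \<mu> p n d) = L_inf_hat g \<Gamma> \<mu> p n" for n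
  proof
    show "(\<Inter>d\<in>{\<delta>..}. L_fin_hat g \<Gamma> \<mu> p n d) \<subseteq> L_inf_hat g \<Gamma> \<mu> p n"
      by (rule Inter_L_fin_hat_subset_L_inf_hat[OF p arch \<Gamma>(1)])
    show "L_inf_hat g \<Gamma> \<mu> p n \<subseteq> (\<Inter>d\<in>{\<delta>..}. L_fin_hat g \<Gamma> \<mu> p n d)"
      by (intro INT_greatest L_inf_hat_subset_L_fin_hat[OF p \<Gamma>d]) auto
  qed
  have inf_conv: "L_inf_hat g \<Gamma> \<mu> p n = Gamma_conv g \<Gamma> \<mu> p n" for n
  proof
    show "L_inf_hat g \<Gamma> \<mu> p n \<subseteq> Gamma_conv g \<Gamma> \<mu> p n"
      by (rule L_inf_hat_subset_Gamma_conv[OF p arch]) (simp add: \<Gamma>)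
    show "Gamma_conv g \<Gamma> \<mu> p n \<subseteq> L_inf_hat g \<Gamma> \<mu> p n"
      by (rule Gamma_conv_subset_L_inf_hat[OF p]) (simp add: \<Gamma>)
  qed
  have pencil: "\<exists>L. is_Gamma_pencil \<Gamma> L \<and> (\<forall>n. L_fin_hat g \<Gamma> \<mu> p n d = proj_x g \<Gamma> L n)" if d: "\<delta> \<le> d" for d
  proof -
    obtain L where "is_Gamma_pencil \<Gamma> L" "\<And>n. L_fin_hat g \<Gamma> \<mu> p n d = proj_x g \<Gamma> L n"
      by (rule L_fin_hat_pencil[OF p ps, of \<Gamma> d]) (use \<Gamma>(2) \<Gamma>d[OF d] assms(2,3,5) in auto)
    then show ?thesis by blast
  qed
  have outer: "Gamma_conv g \<Gamma> \<mu> p n \<subseteq> L_fin_hat g \<Gamma> \<mu> p n d" if "\<delta> \<le> d" for n d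
    unfolding inf_conv[symmetric] by (rule L_inf_hat_subset_L_fin_hat[OF p \<Gamma>d[OF that]])
  have anti: "L_fin_hat g \<Gamma> \<mu> p n d' \<subseteq> L_fin_hat g \<Gamma> \<mu> p n d" if "\<delta> \<le> d" "d \<le> d'" for n d d'
    by (rule L_fin_hat_antimono[OF p \<Gamma>d[OF that(1)] that(2)])
  show ?thesis
    by (intro conjI allI impI fin_inf inf_conv pencil outer anti)
qed

end
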